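(* Let $\mathcal{A}$ be a $2$-category with finite weighted bilimits and let $P:\mathcal{A}\to\mathcal{C}at$ be a $2$-functor. If $P$ is left exact, then $\mathcal{E}l_P$ is $\sigma$-cofiltered with respect to $\mathscr{C}_P$.
   Context: $2$-categories and $2$-functors are strict; $\mathcal{A}^{op}$ reverses $1$-cells but not $2$-cells. $\mathcal{H}om_p(\mathcal{A},\mathcal{B})$ is the $2$-category of $2$-functors, pseudonatural transformations and modifications. For $2$-functors $W:\mathcal{D}\to\mathcal{C}at$ and $F:\mathcal{D}\to\mathcal{B}$, the (weighted) bilimit ${}_{bi}\{W,F\}_p$ is an object $L$ with equivalences $\mathcal{B}(B,L)\simeq\mathcal{H}om_p(\mathcal{D},\mathcal{C}at)(W,\mathcal{B}(B,F-))$ for all $B$, induced by a universal cone $W\Rightarrow\mathcal{B}(L,F-)$. The weight is finite if $\mathcal{D}$ is a finite $2$-category and each $WD$ is a finite category; a finite bilimit is one with finite weight. A $2$-functor whose domain has all finite weighted bilimits is left exact if it preserves them, i.e. the bilimit of the image diagram exists and the canonical comparison arrow is an equivalence. $\mathcal{E}l_P$: objects are pairs $(x,A)$, $A\in\mathcal{A}$, $x\in PA$; a morphism $(x,A)\to(y,B)$ is a pair $(f,\varphi)$ with $f:A\to B$ in $\mathcal{A}$ and $\varphi:Pf(x)\to y$ in $PB$; a $2$-cell $(f,\varphi)\Rightarrow(g,\psi)$ is a $2$-cell $\theta:f\Rightarrow g$ of $\mathcal{A}$ with $\psi\circ(P\theta)_x=\varphi$. Composition: $(g,\psi)(f,\varphi)=(gf,\psi\,Pg(\varphi))$;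 $2$-cells compose as in $\mathcal{A}$. $\mathscr{C}_P$ consists of the arrows $(f,\varphi)$ with $\varphi$ an isomorphism. Let $\Sigma$ be a wide $1$-subcategory of a $2$-category $\mathcal{C}$ (a subcategory of the underlying category containing all objects). $\mathcal{C}$ is $\sigma$-filtered with respect to $\Sigma$ if it is non-empty and: ($\sigma$F0) for all $A,B$ there are arrows $A\to E$, $B\to E$ in $\Sigma$; ($\sigma$F1) for $f,g:A\to B$ with $g\in\Sigma$ there are $h:B\to E$ in $\Sigma$ and a $2$-cell $\alpha:hf\Rightarrow hg$, and if also $f\in\Sigma$ then $\alpha$ may be chosen invertible; ($\sigma$F2) for $2$-cells $\alpha,\beta:f\Rightarrow g$ with $g:A\to B$ in $\Sigma$, there is $h:B\to E$ in $\Sigma$ with $h\alpha=h\beta$. $\mathcal{C}$ is $\sigma$-cofiltered with respect to $\Sigma$ if $\mathcal{C}^{op}$ is $\sigma$-filtered with respect to $\Sigma$ (viewed in $\mathcal{C}^{op}$). *)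

theory Defs
  imports Main "HOL-Library.FuncSet"
begin

section \<open>Categories, functors and natural transformations\<close>

text \<open>
  Categories live on carrier sets. Nothing is required of the operations outside the carriers, so
  one category may be represented by several records; these are isomorphic in the 2-category
  \<open>Cat\<close> below through a functor which is the identity on the carriers.
\<close>

record ('o, 'a) cat =
  Ob :: "'o set"
  Ar :: "'a set"
  dm :: "'a \<Rightarrow> 'o"
  cd :: "'a \<Rightarrow> 'o"
  idn :: "'o \<Rightarrow> 'a"
  cmp :: "'a \<Rightarrow> 'a \<Rightarrow> 'a"  (infixr \<open>\<cdot>\<index>\<close> 70)

locale category =
  fixes C :: "('o, 'a) cat" (structure)
  assumes dm_closed: "f \<in> Ar C \<Longrightarrow> dm C f \<in> Ob C"
    and cd_closed: "f \<in> Ar C \<Longrightarrow> cd C f \<in> Ob C"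
    and idn_closed: "x \<in> Ob C \<Longrightarrow> idn C x \<in> Ar C"
    and dm_idn: "x \<in> Ob C \<Longrightarrow> dm C (idn C x) = x"
    and cd_idn: "x \<in> Ob C \<Longrightarrow> cd C (idn C x) = x"
    and cmp_closed: "\<lbrakk>f \<in> Ar C; g \<in> Ar C; cd C f = dm C g\<rbrakk> \<Longrightarrow> g \<cdot> f \<in> Ar C"
    and dm_cmp: "\<lbrakk>f \<in> Ar C; g \<in> Ar C; cd C f = dm C g\<rbrakk> \<Longrightarrow> dm C (g \<cdot> f) = dm C f"
    and cd_cmp: "\<lbrakk>f \<in> Ar C; g \<in> Ar C; cd C f = dm C g\<rbrakk> \<Longrightarrow> cd C (g \<cdot> f) = cd C g"
    and cmp_idn: "f \<in> Ar C \<Longrightarrow> f \<cdot> idn C (dm C f) = f"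
    and idn_cmp: "f \<in> Ar C \<Longrightarrow> idn C (cd C f) \<cdot> f = f"
    and cmp_assoc: "\<lbrakk>f \<in> Ar C; g \<in> Ar C; h \<in> Ar C; cd C f = dm C g; cd C g = dm C h\<rbrakk>
                    \<Longrightarrow> (h \<cdot> g) \<cdot> f = h \<cdot> (g \<cdot> f)"

definition iso_arr :: "('o, 'a) cat \<Rightarrow> 'a \<Rightarrow> bool" where
  "iso_arr C f \<longleftrightarrow> f \<in> Ar C \<and>
     (\<exists>g\<in>Ar C. dm C g = cd C f \<and> cd C g = dm C f \<and>
        g \<cdot>\<^bsub>C\<^esub> f = idn C (dm C f) \<and> f \<cdot>\<^bsub>C\<^esub> g = idn C (cd C f))"

text \<open>
  Functors and natural transformations are extensional outside the carriers, so that equality of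
  the records is equality of functors and of natural transformations.
\<close>

record ('o, 'a, 'p, 'b) func =
  Src :: "('o, 'a) cat"
  Tgt :: "('p, 'b) cat"
  onOb :: "'o \<Rightarrow> 'p"
  onAr :: "'a \<Rightarrow> 'b"

locale cat_functor =
  fixes F :: "('o, 'a, 'p, 'b) func"
  assumes category_Src: "category (Src F)"
    and category_Tgt: "category (Tgt F)"
    and onOb_closed: "x \<in> Ob (Src F) \<Longrightarrow> onOb F x \<in> Ob (Tgt F)"
    and onAr_closed: "f \<in> Ar (Src F) \<Longrightarrow> onAr F f \<in> Ar (Tgt F)"
    and dm_onAr: "f \<in> Ar (Src F) \<Longrightarrow> dm (Tgt F) (onAr F f) = onOb F (dm (Src F) f)"
    and cd_onAr: "f \<in> Ar (Src F) \<Longrightarrow> cd (Tgt F) (onAr F f) = onOb F (cd (Src F) f)"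
    and onAr_idn: "x \<in> Ob (Src F) \<Longrightarrow> onAr F (idn (Src F) x) = idn (Tgt F) (onOb F x)"
    and onAr_cmp: "\<lbrakk>f \<in> Ar (Src F); g \<in> Ar (Src F); cd (Src F) f = dm (Src F) g\<rbrakk>
                    \<Longrightarrow> onAr F (g \<cdot>\<^bsub>Src F\<^esub> f) = onAr F g \<cdot>\<^bsub>Tgt F\<^esub> onAr F f"
    and onOb_extensional: "onOb F \<in> extensional (Ob (Src F))"
    and onAr_extensional: "onAr F \<in> extensional (Ar (Src F))"

definition id_func :: "('o, 'a) cat \<Rightarrow> ('o, 'a, 'o, 'a) func" where
  "id_func C = \<lparr>Src = C, Tgt = C, onOb = (\<lambda>x\<in>Ob C. x), onAr = (\<lambda>f\<in>Ar C. f)\<rparr>"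

definition comp_func ::
    "('p, 'b, 'q, 'c) func \<Rightarrow> ('o, 'a, 'p, 'b) func \<Rightarrow> ('o, 'a, 'q, 'c) func" where
  "comp_func G F = \<lparr>Src = Src F, Tgt = Tgt G,
     onOb = (\<lambda>x\<in>Ob (Src F). onOb G (onOb F x)),
     onAr = (\<lambda>f\<in>Ar (Src F). onAr G (onAr F f))\<rparr>"

record ('o, 'a, 'p, 'b) nattrans =
  nDom :: "('o, 'a, 'p, 'b) func"
  nCod :: "('o, 'a, 'p, 'b) func"
  ntAt :: "'o \<Rightarrow> 'b"

locale nat_trans =
  fixes \<alpha> :: "('o, 'a, 'p, 'b) nattrans"
  assumes functor_nDom: "cat_functor (nDom \<alpha>)"
    and functor_nCod: "cat_functor (nCod \<alpha>)"
    and Src_eq: "Src (nCod \<alpha>) = Src (nDom \<alpha>)"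
    and Tgt_eq: "Tgt (nCod \<alpha>) = Tgt (nDom \<alpha>)"
    and at_closed: "x \<in> Ob (Src (nDom \<alpha>)) \<Longrightarrow> ntAt \<alpha> x \<in> Ar (Tgt (nDom \<alpha>))"
    and dm_at: "x \<in> Ob (Src (nDom \<alpha>)) \<Longrightarrow> dm (Tgt (nDom \<alpha>)) (ntAt \<alpha> x) = onOb (nDom \<alpha>) x"
    and cd_at: "x \<in> Ob (Src (nDom \<alpha>)) \<Longrightarrow> cd (Tgt (nDom \<alpha>)) (ntAt \<alpha> x) = onOb (nCod \<alpha>) x"
    and naturality: "f \<in> Ar (Src (nDom \<alpha>)) \<Longrightarrow>
           ntAt \<alpha> (cd (Src (nDom \<alpha>)) f) \<cdot>\<^bsub>Tgt (nDom \<alpha>)\<^esub> onAr (nDom \<alpha>) f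
         = onAr (nCod \<alpha>) f \<cdot>\<^bsub>Tgt (nDom \<alpha>)\<^esub> ntAt \<alpha> (dm (Src (nDom \<alpha>)) f)"
    and at_extensional: "ntAt \<alpha> \<in> extensional (Ob (Src (nDom \<alpha>)))"

definition nat_iso :: "('o, 'a, 'p, 'b) nattrans \<Rightarrow> bool" where
  "nat_iso \<alpha> \<longleftrightarrow> nat_trans \<alpha> \<and> (\<forall>x\<in>Ob (Src (nDom \<alpha>)). iso_arr (Tgt (nDom \<alpha>)) (ntAt \<alpha> x))"

definition id_nt :: "('o, 'a, 'p, 'b) func \<Rightarrow> ('o, 'a, 'p, 'b) nattrans" where
  "id_nt F = \<lparr>nDom = F, nCod = F, ntAt = (\<lambda>x\<in>Ob (Src F). idn (Tgt F) (onOb F x))\<rparr>"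

definition vcomp_nt ::
    "('o, 'a, 'p, 'b) nattrans \<Rightarrow> ('o, 'a, 'p, 'b) nattrans \<Rightarrow> ('o, 'a, 'p, 'b) nattrans" where
  "vcomp_nt \<beta> \<alpha> = \<lparr>nDom = nDom \<alpha>, nCod = nCod \<beta>,
     ntAt = (\<lambda>x\<in>Ob (Src (nDom \<alpha>)). ntAt \<beta> x \<cdot>\<^bsub>Tgt (nDom \<alpha>)\<^esub> ntAt \<alpha> x)\<rparr>"

definition hcomp_nt ::
    "('p, 'b, 'q, 'c) nattrans \<Rightarrow> ('o, 'a, 'p, 'b) nattrans \<Rightarrow> ('o, 'a, 'q, 'c) nattrans" where
  "hcomp_nt \<beta> \<alpha> = \<lparr>nDom = comp_func (nDom \<beta>) (nDom \<alpha>), nCod = comp_func (nCod \<beta>) (nCod \<alpha>),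
     ntAt = (\<lambda>x\<in>Ob (Src (nDom \<alpha>)).
       ntAt \<beta> (onOb (nCod \<alpha>) x) \<cdot>\<^bsub>Tgt (nDom \<beta>)\<^esub> onAr (nDom \<beta>) (ntAt \<alpha> x))\<rparr>"

definition whisker_left ::
    "('p, 'b, 'q, 'c) func \<Rightarrow> ('o, 'a, 'p, 'b) nattrans \<Rightarrow> ('o, 'a, 'q, 'c) nattrans" where
  "whisker_left H \<alpha> = \<lparr>nDom = comp_func H (nDom \<alpha>), nCod = comp_func H (nCod \<alpha>),
     ntAt = (\<lambda>x\<in>Ob (Src (nDom \<alpha>)). onAr H (ntAt \<alpha> x))\<rparr>"

definition is_equivalence :: "('o, 'a, 'p, 'b) func \<Rightarrow> bool" where
  "is_equivalence F \<longleftrightarrow> cat_functor F \<and>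
     (\<exists>G \<eta> \<epsilon>. cat_functor G \<and> Src G = Tgt F \<and> Tgt G = Src F \<and>
        nat_iso \<eta> \<and> nDom \<eta> = id_func (Src F) \<and> nCod \<eta> = comp_func G F \<and>
        nat_iso \<epsilon> \<and> nDom \<epsilon> = comp_func F G \<and> nCod \<epsilon> = id_func (Tgt F))"

section \<open>Strict 2-categories and 2-functors\<close>

record ('o, 'm, 'n) cat2 =
  Obj :: "'o set"
  Cell1 :: "'m set"
  Cell2 :: "'n set"
  src :: "'m \<Rightarrow> 'o"
  tgt :: "'m \<Rightarrow> 'o"
  src2 :: "'n \<Rightarrow> 'm"
  tgt2 :: "'n \<Rightarrow> 'm"
  id1 :: "'o \<Rightarrow> 'm"
  id2 :: "'m \<Rightarrow> 'n"
  comp1 :: "'m \<Rightarrow> 'm \<Rightarrow> 'm"  (infixr \<open>\<odot>\<index>\<close> 75)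
  vcomp :: "'n \<Rightarrow> 'n \<Rightarrow> 'n"  (infixr \<open>\<diamondop>\<index>\<close> 70)
  hcomp :: "'n \<Rightarrow> 'n \<Rightarrow> 'n"  (infixr \<open>\<star>\<index>\<close> 75)

definition underlying_cat :: "('o, 'm, 'n) cat2 \<Rightarrow> ('o, 'm) cat" where
  "underlying_cat C = \<lparr>Ob = Obj C, Ar = Cell1 C, dm = src C, cd = tgt C,
     idn = id1 C, cmp = comp1 C\<rparr>"

definition vertical_cat :: "('o, 'm, 'n) cat2 \<Rightarrow> ('m, 'n) cat" where
  "vertical_cat C = \<lparr>Ob = Cell1 C, Ar = Cell2 C, dm = src2 C, cd = tgt2 C,
     idn = id2 C, cmp = vcomp C\<rparr>"

definition horizontal_cat :: "('o, 'm, 'n) cat2 \<Rightarrow> ('o, 'n) cat" where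
  "horizontal_cat C = \<lparr>Ob = Obj C, Ar = Cell2 C,
     dm = (\<lambda>\<alpha>. src C (src2 C \<alpha>)), cd = (\<lambda>\<alpha>. tgt C (src2 C \<alpha>)),
     idn = (\<lambda>X. id2 C (id1 C X)), cmp = hcomp C\<rparr>"

locale two_category =
  fixes C :: "('o, 'm, 'n) cat2" (structure)
  assumes category_underlying: "category (underlying_cat C)"
    and category_vertical: "category (vertical_cat C)"
    and category_horizontal: "category (horizontal_cat C)"
    and src_parallel: "\<alpha> \<in> Cell2 C \<Longrightarrow> src C (tgt2 C \<alpha>) = src C (src2 C \<alpha>)"
    and tgt_parallel: "\<alpha> \<in> Cell2 C \<Longrightarrow> tgt C (tgt2 C \<alpha>) = tgt C (src2 C \<alpha>)"
    and src2_hcomp: "\<lbrakk>\<alpha> \<in> Cell2 C; \<beta> \<in> Cell2 C; tgt C (src2 C \<alpha>) = src C (src2 C \<beta>)\<rbrakk>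
                      \<Longrightarrow> src2 C (\<beta> \<star> \<alpha>) = src2 C \<beta> \<odot> src2 C \<alpha>"
    and tgt2_hcomp: "\<lbrakk>\<alpha> \<in> Cell2 C; \<beta> \<in> Cell2 C; tgt C (src2 C \<alpha>) = src C (src2 C \<beta>)\<rbrakk>
                      \<Longrightarrow> tgt2 C (\<beta> \<star> \<alpha>) = tgt2 C \<beta> \<odot> tgt2 C \<alpha>"
    and hcomp_id2: "\<lbrakk>f \<in> Cell1 C; g \<in> Cell1 C; tgt C f = src C g\<rbrakk>
                      \<Longrightarrow> id2 C g \<star> id2 C f = id2 C (g \<odot> f)"
    and interchange: "\<lbrakk>\<alpha> \<in> Cell2 C; \<alpha>' \<in> Cell2 C; \<beta> \<in> Cell2 C; \<beta>' \<in> Cell2 C;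
                       tgt2 C \<alpha> = src2 C \<alpha>'; tgt2 C \<beta> = src2 C \<beta>';
                       tgt C (src2 C \<alpha>) = src C (src2 C \<beta>)\<rbrakk>
                      \<Longrightarrow> (\<beta>' \<diamondop> \<beta>) \<star> (\<alpha>' \<diamondop> \<alpha>) = (\<beta>' \<star> \<alpha>') \<diamondop> (\<beta> \<star> \<alpha>)"

definition hom_cat :: "('o, 'm, 'n) cat2 \<Rightarrow> 'o \<Rightarrow> 'o \<Rightarrow> ('m, 'n) cat" where
  "hom_cat C X Y = \<lparr>Ob = {f \<in> Cell1 C. src C f = X \<and> tgt C f = Y},
     Ar = {\<alpha> \<in> Cell2 C. src C (src2 C \<alpha>) = X \<and> tgt C (src2 C \<alpha>) = Y},
     dm = src2 C, cd = tgt2 C, idn = id2 C, cmp = vcomp C\<rparr>"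

definition invertible2 :: "('o, 'm, 'n) cat2 \<Rightarrow> 'n \<Rightarrow> bool" where
  "invertible2 C \<alpha> \<longleftrightarrow> iso_arr (vertical_cat C) \<alpha>"

definition equivalence1 :: "('o, 'm, 'n) cat2 \<Rightarrow> 'm \<Rightarrow> bool" where
  "equivalence1 C f \<longleftrightarrow> f \<in> Cell1 C \<and>
     (\<exists>g \<eta> \<epsilon>. g \<in> Cell1 C \<and> src C g = tgt C f \<and> tgt C g = src C f \<and>
        invertible2 C \<eta> \<and> src2 C \<eta> = id1 C (src C f) \<and> tgt2 C \<eta> = g \<odot>\<^bsub>C\<^esub> f \<and>
        invertible2 C \<epsilon> \<and> src2 C \<epsilon> = f \<odot>\<^bsub>C\<^esub> g \<and> tgt2 C \<epsilon> = id1 C (tgt C f))"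

definition op2 :: "('o, 'm, 'n) cat2 \<Rightarrow> ('o, 'm, 'n) cat2" where
  "op2 C = \<lparr>Obj = Obj C, Cell1 = Cell1 C, Cell2 = Cell2 C, src = tgt C, tgt = src C,
     src2 = src2 C, tgt2 = tgt2 C, id1 = id1 C, id2 = id2 C,
     comp1 = (\<lambda>g f. f \<odot>\<^bsub>C\<^esub> g), vcomp = vcomp C, hcomp = (\<lambda>\<beta> \<alpha>. \<alpha> \<star>\<^bsub>C\<^esub> \<beta>)\<rparr>"

text \<open>
  The 2-category of categories with carriers in two given types, which act as the universe. These
  types may even be finite: they always contain a terminal category, and testing against it is
  enough to recognise a bilimit of categories.
\<close>

definition Cat :: "(('o, 'a) cat, ('o, 'a, 'o, 'a) func, ('o, 'a, 'o, 'a) nattrans) cat2" where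
  "Cat = \<lparr>Obj = {C. category C}, Cell1 = {F. cat_functor F}, Cell2 = {\<alpha>. nat_trans \<alpha>},
     src = Src, tgt = Tgt, src2 = nDom, tgt2 = nCod, id1 = id_func, id2 = id_nt,
     comp1 = comp_func, vcomp = vcomp_nt, hcomp = hcomp_nt\<rparr>"

record ('o, 'm, 'n, 'p, 'q, 'r) func2 =
  on0 :: "'o \<Rightarrow> 'p"
  on1 :: "'m \<Rightarrow> 'q"
  on2 :: "'n \<Rightarrow> 'r"

type_synonym ('o, 'm, 'n, 'c, 'a) cat_valued =
  "('o, 'm, 'n, ('c, 'a) cat, ('c, 'a, 'c, 'a) func, ('c, 'a, 'c, 'a) nattrans) func2"

locale two_functor =
  fixes C :: "('o, 'm, 'n) cat2" and D :: "('p, 'q, 'r) cat2"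
    and F :: "('o, 'm, 'n, 'p, 'q, 'r) func2"
  assumes dom_two_category: "two_category C"
    and cod_two_category: "two_category D"
    and on0_closed: "X \<in> Obj C \<Longrightarrow> on0 F X \<in> Obj D"
    and on1_closed: "f \<in> Cell1 C \<Longrightarrow> on1 F f \<in> Cell1 D"
    and on2_closed: "\<alpha> \<in> Cell2 C \<Longrightarrow> on2 F \<alpha> \<in> Cell2 D"
    and src_on1: "f \<in> Cell1 C \<Longrightarrow> src D (on1 F f) = on0 F (src C f)"
    and tgt_on1: "f \<in> Cell1 C \<Longrightarrow> tgt D (on1 F f) = on0 F (tgt C f)"
    and src2_on2: "\<alpha> \<in> Cell2 C \<Longrightarrow> src2 D (on2 F \<alpha>) = on1 F (src2 C \<alpha>)"
    and tgt2_on2: "\<alpha> \<in> Cell2 C \<Longrightarrow> tgt2 D (on2 F \<alpha>) = on1 F (tgt2 C \<alpha>)"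
    and on1_id1: "X \<in> Obj C \<Longrightarrow> on1 F (id1 C X) = id1 D (on0 F X)"
    and on2_id2: "f \<in> Cell1 C \<Longrightarrow> on2 F (id2 C f) = id2 D (on1 F f)"
    and on1_comp1: "\<lbrakk>f \<in> Cell1 C; g \<in> Cell1 C; tgt C f = src C g\<rbrakk>
                     \<Longrightarrow> on1 F (g \<odot>\<^bsub>C\<^esub> f) = on1 F g \<odot>\<^bsub>D\<^esub> on1 F f"
    and on2_vcomp: "\<lbrakk>\<alpha> \<in> Cell2 C; \<beta> \<in> Cell2 C; tgt2 C \<alpha> = src2 C \<beta>\<rbrakk>
                     \<Longrightarrow> on2 F (\<beta> \<diamondop>\<^bsub>C\<^esub> \<alpha>) = on2 F \<beta> \<diamondop>\<^bsub>D\<^esub> on2 F \<alpha>"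
    and on2_hcomp: "\<lbrakk>\<alpha> \<in> Cell2 C; \<beta> \<in> Cell2 C; tgt C (src2 C \<alpha>) = src C (src2 C \<beta>)\<rbrakk>
                     \<Longrightarrow> on2 F (\<beta> \<star>\<^bsub>C\<^esub> \<alpha>) = on2 F \<beta> \<star>\<^bsub>D\<^esub> on2 F \<alpha>"

definition comp2 ::
    "('p, 'q, 'r, 'u, 'v, 'w) func2 \<Rightarrow> ('o, 'm, 'n, 'p, 'q, 'r) func2 \<Rightarrow> ('o, 'm, 'n, 'u, 'v, 'w) func2"
  where
  "comp2 G F = \<lparr>on0 = (\<lambda>X. on0 G (on0 F X)), on1 = (\<lambda>f. on1 G (on1 F f)),
     on2 = (\<lambda>\<alpha>. on2 G (on2 F \<alpha>))\<rparr>"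

definition postcomp :: "('o, 'm, 'n) cat2 \<Rightarrow> 'o \<Rightarrow> 'm \<Rightarrow> ('m, 'n, 'm, 'n) func" where
  "postcomp C X f = \<lparr>Src = hom_cat C X (src C f), Tgt = hom_cat C X (tgt C f),
     onOb = (\<lambda>u\<in>Ob (hom_cat C X (src C f)). f \<odot>\<^bsub>C\<^esub> u),
     onAr = (\<lambda>\<alpha>\<in>Ar (hom_cat C X (src C f)). id2 C f \<star>\<^bsub>C\<^esub> \<alpha>)\<rparr>"

definition precomp :: "('o, 'm, 'n) cat2 \<Rightarrow> 'm \<Rightarrow> 'o \<Rightarrow> ('m, 'n, 'm, 'n) func" where
  "precomp C u Z = \<lparr>Src = hom_cat C (tgt C u) Z, Tgt = hom_cat C (src C u) Z,
     onOb = (\<lambda>f\<in>Ob (hom_cat C (tgt C u) Z). f \<odot>\<^bsub>C\<^esub> u),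
     onAr = (\<lambda>\<alpha>\<in>Ar (hom_cat C (tgt C u) Z). \<alpha> \<star>\<^bsub>C\<^esub> id2 C u)\<rparr>"

definition hom_from :: "('o, 'm, 'n) cat2 \<Rightarrow> 'o \<Rightarrow> ('o, 'm, 'n, 'm, 'n) cat_valued" where
  "hom_from C X = \<lparr>on0 = hom_cat C X, on1 = postcomp C X,
     on2 = (\<lambda>\<theta>. \<lparr>nDom = postcomp C X (src2 C \<theta>), nCod = postcomp C X (tgt2 C \<theta>),
       ntAt = (\<lambda>u\<in>Ob (hom_cat C X (src C (src2 C \<theta>))). \<theta> \<star>\<^bsub>C\<^esub> id2 C u)\<rparr>)\<rparr>"

definition hom_map ::
    "('o, 'm, 'n) cat2 \<Rightarrow> ('p, 'q, 'r) cat2 \<Rightarrow> ('o, 'm, 'n, 'p, 'q, 'r) func2 \<Rightarrow> 'o \<Rightarrow> 'o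
     \<Rightarrow> ('m, 'n, 'q, 'r) func" where
  "hom_map C D P X Y = \<lparr>Src = hom_cat C X Y, Tgt = hom_cat D (on0 P X) (on0 P Y),
     onOb = (\<lambda>f\<in>Ob (hom_cat C X Y). on1 P f), onAr = (\<lambda>\<alpha>\<in>Ar (hom_cat C X Y). on2 P \<alpha>)\<rparr>"

section \<open>Pseudonatural transformations between Cat-valued 2-functors\<close>

text \<open>
  The values of the two 2-functors may be categories on different types: a weight takes values in
  small finite categories, whereas \<open>B(X, F -)\<close> takes values in categories of cells of \<open>B\<close>.
  The structure 2-cell at \<open>f : d \<rightarrow> e\<close> is an invertible \<open>V f \<circ> \<tau>\<^sub>d \<Rightarrow> \<tau>\<^sub>e \<circ> W f\<close>.
\<close>

record ('o, 'm, 'a, 'b, 'c, 'd) psnat =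
  ps0 :: "'o \<Rightarrow> ('a, 'b, 'c, 'd) func"
  ps1 :: "'m \<Rightarrow> ('a, 'b, 'c, 'd) nattrans"

locale pseudonatural =
  fixes D :: "('o, 'm, 'n) cat2"
    and W :: "('o, 'm, 'n, 'a, 'b) cat_valued"
    and V :: "('o, 'm, 'n, 'c, 'd) cat_valued"
    and \<tau> :: "('o, 'm, 'a, 'b, 'c, 'd) psnat"
  assumes two_functor_dom: "two_functor D Cat W"
    and two_functor_cod: "two_functor D Cat V"
    and functor_ps0: "d \<in> Obj D \<Longrightarrow> cat_functor (ps0 \<tau> d)"
    and Src_ps0: "d \<in> Obj D \<Longrightarrow> Src (ps0 \<tau> d) = on0 W d"
    and Tgt_ps0: "d \<in> Obj D \<Longrightarrow> Tgt (ps0 \<tau> d) = on0 V d"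
    and nat_iso_ps1: "f \<in> Cell1 D \<Longrightarrow> nat_iso (ps1 \<tau> f)"
    and nDom_ps1: "f \<in> Cell1 D \<Longrightarrow> nDom (ps1 \<tau> f) = comp_func (on1 V f) (ps0 \<tau> (src D f))"
    and nCod_ps1: "f \<in> Cell1 D \<Longrightarrow> nCod (ps1 \<tau> f) = comp_func (ps0 \<tau> (tgt D f)) (on1 W f)"
    and ps1_id1: "d \<in> Obj D \<Longrightarrow> ps1 \<tau> (id1 D d) = id_nt (ps0 \<tau> d)"
    and ps1_comp1: "\<lbrakk>f \<in> Cell1 D; g \<in> Cell1 D; tgt D f = src D g; w \<in> Ob (on0 W (src D f))\<rbrakk>
          \<Longrightarrow> ntAt (ps1 \<tau> (g \<odot>\<^bsub>D\<^esub> f)) w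
            = ntAt (ps1 \<tau> g) (onOb (on1 W f) w)
              \<cdot>\<^bsub>on0 V (tgt D g)\<^esub> onAr (on1 V g) (ntAt (ps1 \<tau> f) w)"
    and ps1_natural: "\<lbrakk>\<theta> \<in> Cell2 D; w \<in> Ob (on0 W (src D (src2 D \<theta>)))\<rbrakk>
          \<Longrightarrow> ntAt (ps1 \<tau> (tgt2 D \<theta>)) w
              \<cdot>\<^bsub>on0 V (tgt D (src2 D \<theta>))\<^esub> ntAt (on2 V \<theta>) (onOb (ps0 \<tau> (src D (src2 D \<theta>))) w)
            = onAr (ps0 \<tau> (tgt D (src2 D \<theta>))) (ntAt (on2 W \<theta>) w)
              \<cdot>\<^bsub>on0 V (tgt D (src2 D \<theta>))\<^esub> ntAt (ps1 \<tau> (src2 D \<theta>)) w"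
    and ps0_extensional: "ps0 \<tau> \<in> extensional (Obj D)"
    and ps1_extensional: "ps1 \<tau> \<in> extensional (Cell1 D)"

record ('o, 'm, 'a, 'b, 'c, 'd) modif =
  mDom :: "('o, 'm, 'a, 'b, 'c, 'd) psnat"
  mCod :: "('o, 'm, 'a, 'b, 'c, 'd) psnat"
  mAt :: "'o \<Rightarrow> ('a, 'b, 'c, 'd) nattrans"

locale modification =
  fixes D :: "('o, 'm, 'n) cat2"
    and W :: "('o, 'm, 'n, 'a, 'b) cat_valued"
    and V :: "('o, 'm, 'n, 'c, 'd) cat_valued"
    and \<rho> :: "('o, 'm, 'a, 'b, 'c, 'd) modif"
  assumes pseudonatural_mDom: "pseudonatural D W V (mDom \<rho>)"
    and pseudonatural_mCod: "pseudonatural D W V (mCod \<rho>)"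
    and nat_trans_mAt: "d \<in> Obj D \<Longrightarrow> nat_trans (mAt \<rho> d)"
    and nDom_mAt: "d \<in> Obj D \<Longrightarrow> nDom (mAt \<rho> d) = ps0 (mDom \<rho>) d"
    and nCod_mAt: "d \<in> Obj D \<Longrightarrow> nCod (mAt \<rho> d) = ps0 (mCod \<rho>) d"
    and mAt_compatible: "\<lbrakk>f \<in> Cell1 D; w \<in> Ob (on0 W (src D f))\<rbrakk>
          \<Longrightarrow> ntAt (ps1 (mCod \<rho>) f) w
              \<cdot>\<^bsub>on0 V (tgt D f)\<^esub> onAr (on1 V f) (ntAt (mAt \<rho> (src D f)) w)
            = ntAt (mAt \<rho> (tgt D f)) (onOb (on1 W f) w)
              \<cdot>\<^bsub>on0 V (tgt D f)\<^esub> ntAt (ps1 (mDom \<rho>) f) w"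
    and mAt_extensional: "mAt \<rho> \<in> extensional (Obj D)"

definition Hom_p ::
    "('o, 'm, 'n) cat2 \<Rightarrow> ('o, 'm, 'n, 'a, 'b) cat_valued \<Rightarrow> ('o, 'm, 'n, 'c, 'd) cat_valued
     \<Rightarrow> (('o, 'm, 'a, 'b, 'c, 'd) psnat, ('o, 'm, 'a, 'b, 'c, 'd) modif) cat" where
  "Hom_p D W V = \<lparr>Ob = {\<tau>. pseudonatural D W V \<tau>}, Ar = {\<rho>. modification D W V \<rho>},
     dm = mDom, cd = mCod,
     idn = (\<lambda>\<tau>. \<lparr>mDom = \<tau>, mCod = \<tau>, mAt = (\<lambda>d\<in>Obj D. id_nt (ps0 \<tau> d))\<rparr>),
     cmp = (\<lambda>\<rho>' \<rho>. \<lparr>mDom = mDom \<rho>, mCod = mCod \<rho>',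
       mAt = (\<lambda>d\<in>Obj D. vcomp_nt (mAt \<rho>' d) (mAt \<rho> d))\<rparr>)\<rparr>"

section \<open>Weighted bilimits\<close>

text \<open>
  For \<open>\<xi> : W \<Rightarrow> B(L, F -)\<close> and \<open>u : X \<rightarrow> L\<close>, the composite of \<open>\<xi>\<close> with
  \<open>B(u, F -) : B(L, F -) \<Rightarrow> B(X, F -)\<close>; and the functor
  \<open>B(X, L) \<rightarrow> Hom_p(D, Cat)(W, B(X, F -))\<close> that it induces.
\<close>

definition cone_restrict ::
    "('o, 'm, 'n) cat2 \<Rightarrow> ('p, 'q, 'r) cat2 \<Rightarrow> ('p, 'q, 'r, 'o, 'm, 'n) func2
     \<Rightarrow> ('p, 'q, 'a, 'b, 'm, 'n) psnat \<Rightarrow> 'm \<Rightarrow> ('p, 'q, 'a, 'b, 'm, 'n) psnat" where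
  "cone_restrict B D F \<xi> u =
     \<lparr>ps0 = (\<lambda>d\<in>Obj D. comp_func (precomp B u (on0 F d)) (ps0 \<xi> d)),
      ps1 = (\<lambda>f\<in>Cell1 D. whisker_left (precomp B u (on0 F (tgt D f))) (ps1 \<xi> f))\<rparr>"

definition cone_functor ::
    "('o, 'm, 'n) cat2 \<Rightarrow> ('p, 'q, 'r) cat2 \<Rightarrow> ('p, 'q, 'r, 'a, 'b) cat_valued
     \<Rightarrow> ('p, 'q, 'r, 'o, 'm, 'n) func2 \<Rightarrow> 'o \<Rightarrow> ('p, 'q, 'a, 'b, 'm, 'n) psnat \<Rightarrow> 'o
     \<Rightarrow> ('m, 'n, ('p, 'q, 'a, 'b, 'm, 'n) psnat, ('p, 'q, 'a, 'b, 'm, 'n) modif) func" where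
  "cone_functor B D W F L \<xi> X =
     \<lparr>Src = hom_cat B X L, Tgt = Hom_p D W (comp2 (hom_from B X) F),
      onOb = (\<lambda>u\<in>Ob (hom_cat B X L). cone_restrict B D F \<xi> u),
      onAr = (\<lambda>\<alpha>\<in>Ar (hom_cat B X L).
        \<lparr>mDom = cone_restrict B D F \<xi> (src2 B \<alpha>), mCod = cone_restrict B D F \<xi> (tgt2 B \<alpha>),
         mAt = (\<lambda>d\<in>Obj D.
           \<lparr>nDom = ps0 (cone_restrict B D F \<xi> (src2 B \<alpha>)) d,
            nCod = ps0 (cone_restrict B D F \<xi> (tgt2 B \<alpha>)) d,
            ntAt = (\<lambda>w\<in>Ob (on0 W d). id2 B (onOb (ps0 \<xi> d) w) \<star>\<^bsub>B\<^esub> \<alpha>)\<rparr>)\<rparr>)\<rparr>"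

definition is_bilimit ::
    "('o, 'm, 'n) cat2 \<Rightarrow> ('p, 'q, 'r) cat2 \<Rightarrow> ('p, 'q, 'r, 'a, 'b) cat_valued
     \<Rightarrow> ('p, 'q, 'r, 'o, 'm, 'n) func2 \<Rightarrow> 'o \<Rightarrow> ('p, 'q, 'a, 'b, 'm, 'n) psnat \<Rightarrow> bool" where
  "is_bilimit B D W F L \<xi> \<longleftrightarrow>
     L \<in> Obj B \<and> pseudonatural D W (comp2 (hom_from B L) F) \<xi> \<and>
     (\<forall>X\<in>Obj B. is_equivalence (cone_functor B D W F L \<xi> X))"

text \<open>
  Every finite 2-category is isomorphic to one with cells in \<^typ>\<open>nat\<close>, and every finite category
  to one with carriers in \<^typ>\<open>nat\<close>; finite weights are therefore taken on this type.
\<close>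

definition finite_weight :: "(nat, nat, nat) cat2 \<Rightarrow> (nat, nat, nat, nat, nat) cat_valued \<Rightarrow> bool" where
  "finite_weight D W \<longleftrightarrow> two_functor D Cat W \<and>
     finite (Obj D) \<and> finite (Cell1 D) \<and> finite (Cell2 D) \<and>
     (\<forall>d\<in>Obj D. finite (Ob (on0 W d)) \<and> finite (Ar (on0 W d)))"

definition has_finite_bilimits :: "('o, 'm, 'n) cat2 \<Rightarrow> bool" where
  "has_finite_bilimits A \<longleftrightarrow>
     (\<forall>D W F. finite_weight D W \<longrightarrow> two_functor D A F \<longrightarrow> (\<exists>L \<xi>. is_bilimit A D W F L \<xi>))"

text \<open>The image under \<open>P\<close> of a cone \<open>\<xi> : W \<Rightarrow> A(L, F -)\<close>, a cone \<open>W \<Rightarrow> B(P L, P F -)\<close>.\<close>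

definition image_cone ::
    "('o, 'm, 'n) cat2 \<Rightarrow> ('s, 't, 'u) cat2 \<Rightarrow> ('o, 'm, 'n, 's, 't, 'u) func2
     \<Rightarrow> ('p, 'q, 'r) cat2 \<Rightarrow> ('p, 'q, 'r, 'o, 'm, 'n) func2 \<Rightarrow> 'o
     \<Rightarrow> ('p, 'q, 'a, 'b, 'm, 'n) psnat \<Rightarrow> ('p, 'q, 'a, 'b, 't, 'u) psnat" where
  "image_cone A B P D F L \<xi> =
     \<lparr>ps0 = (\<lambda>d\<in>Obj D. comp_func (hom_map A B P L (on0 F d)) (ps0 \<xi> d)),
      ps1 = (\<lambda>f\<in>Cell1 D. whisker_left (hom_map A B P L (on0 F (tgt D f))) (ps1 \<xi> f))\<rparr>"

text \<open>
  A comparison arrow from the vertex \<open>N\<close> of a cone \<open>\<zeta>\<close> to a bilimit \<open>(M, \<eta>)\<close> is an arrow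
  \<open>k : N \<rightarrow> M\<close> with \<open>B(k, F -) \<circ> \<eta> \<cong> \<zeta>\<close>; it is unique up to isomorphism.
\<close>

definition is_comparison ::
    "('o, 'm, 'n) cat2 \<Rightarrow> ('p, 'q, 'r) cat2 \<Rightarrow> ('p, 'q, 'r, 'a, 'b) cat_valued
     \<Rightarrow> ('p, 'q, 'r, 'o, 'm, 'n) func2 \<Rightarrow> 'o \<Rightarrow> ('p, 'q, 'a, 'b, 'm, 'n) psnat
     \<Rightarrow> 'o \<Rightarrow> ('p, 'q, 'a, 'b, 'm, 'n) psnat \<Rightarrow> 'm \<Rightarrow> bool" where
  "is_comparison B D W F M \<eta> N \<zeta> k \<longleftrightarrow>
     k \<in> Cell1 B \<and> src B k = N \<and> tgt B k = M \<and>
     (\<exists>\<rho>. iso_arr (Hom_p D W (comp2 (hom_from B N) F)) \<rho> \<and>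
          mDom \<rho> = cone_restrict B D F \<eta> k \<and> mCod \<rho> = \<zeta>)"

definition left_exact ::
    "('o, 'm, 'n) cat2 \<Rightarrow> ('s, 't, 'u) cat2 \<Rightarrow> ('o, 'm, 'n, 's, 't, 'u) func2 \<Rightarrow> bool" where
  "left_exact A B P \<longleftrightarrow>
     (\<forall>D W F L \<xi>. finite_weight D W \<longrightarrow> two_functor D A F \<longrightarrow> is_bilimit A D W F L \<xi> \<longrightarrow>
        (\<exists>M \<eta> k. is_bilimit B D W (comp2 P F) M \<eta> \<and>
           is_comparison B D W (comp2 P F) M \<eta> (on0 P L) (image_cone A B P D F L \<xi>) k \<and>
           equivalence1 B k))"

section \<open>The 2-category of elements\<close>

text \<open>
  An arrow carries its source \<open>(x, A)\<close> and target \<open>(y, B)\<close> besides \<open>(f, \<phi>)\<close>, and a 2-cell its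
  source and target arrows.
\<close>

record ('o, 'm, 'c, 'a) el_arrow =
  elSrc :: "'c \<times> 'o"
  elTgt :: "'c \<times> 'o"
  elBase :: 'm
  elFib :: 'a

record ('o, 'm, 'n, 'c, 'a) el_cell =
  elSrc2 :: "('o, 'm, 'c, 'a) el_arrow"
  elTgt2 :: "('o, 'm, 'c, 'a) el_arrow"
  elBase2 :: 'n

definition el_objects ::
    "('o, 'm, 'n) cat2 \<Rightarrow> ('o, 'm, 'n, 'c, 'a) cat_valued \<Rightarrow> ('c \<times> 'o) set" where
  "el_objects A P = {(x, X). X \<in> Obj A \<and> x \<in> Ob (on0 P X)}"

definition el_arrows ::
    "('o, 'm, 'n) cat2 \<Rightarrow> ('o, 'm, 'n, 'c, 'a) cat_valued \<Rightarrow> ('o, 'm, 'c, 'a) el_arrow set" where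
  "el_arrows A P = {u. elSrc u \<in> el_objects A P \<and> elTgt u \<in> el_objects A P \<and>
     elBase u \<in> Cell1 A \<and> src A (elBase u) = snd (elSrc u) \<and> tgt A (elBase u) = snd (elTgt u) \<and>
     elFib u \<in> Ar (on0 P (snd (elTgt u))) \<and>
     dm (on0 P (snd (elTgt u))) (elFib u) = onOb (on1 P (elBase u)) (fst (elSrc u)) \<and>
     cd (on0 P (snd (elTgt u))) (elFib u) = fst (elTgt u)}"

definition el_cells ::
    "('o, 'm, 'n) cat2 \<Rightarrow> ('o, 'm, 'n, 'c, 'a) cat_valued \<Rightarrow> ('o, 'm, 'n, 'c, 'a) el_cell set" where
  "el_cells A P = {\<Theta>. elSrc2 \<Theta> \<in> el_arrows A P \<and> elTgt2 \<Theta> \<in> el_arrows A P \<and>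
     elSrc (elSrc2 \<Theta>) = elSrc (elTgt2 \<Theta>) \<and> elTgt (elSrc2 \<Theta>) = elTgt (elTgt2 \<Theta>) \<and>
     elBase2 \<Theta> \<in> Cell2 A \<and>
     src2 A (elBase2 \<Theta>) = elBase (elSrc2 \<Theta>) \<and> tgt2 A (elBase2 \<Theta>) = elBase (elTgt2 \<Theta>) \<and>
     elFib (elTgt2 \<Theta>) \<cdot>\<^bsub>on0 P (snd (elTgt (elSrc2 \<Theta>)))\<^esub>
       ntAt (on2 P (elBase2 \<Theta>)) (fst (elSrc (elSrc2 \<Theta>))) = elFib (elSrc2 \<Theta>)}"

definition el_comp ::
    "('o, 'm, 'n) cat2 \<Rightarrow> ('o, 'm, 'n, 'c, 'a) cat_valued
     \<Rightarrow> ('o, 'm, 'c, 'a) el_arrow \<Rightarrow> ('o, 'm, 'c, 'a) el_arrow \<Rightarrow> ('o, 'm, 'c, 'a) el_arrow" where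
  "el_comp A P v u = \<lparr>elSrc = elSrc u, elTgt = elTgt v, elBase = elBase v \<odot>\<^bsub>A\<^esub> elBase u,
     elFib = elFib v \<cdot>\<^bsub>on0 P (snd (elTgt v))\<^esub> onAr (on1 P (elBase v)) (elFib u)\<rparr>"

definition El ::
    "('o, 'm, 'n) cat2 \<Rightarrow> ('o, 'm, 'n, 'c, 'a) cat_valued
     \<Rightarrow> ('c \<times> 'o, ('o, 'm, 'c, 'a) el_arrow, ('o, 'm, 'n, 'c, 'a) el_cell) cat2" where
  "El A P = \<lparr>Obj = el_objects A P, Cell1 = el_arrows A P, Cell2 = el_cells A P,
     src = elSrc, tgt = elTgt, src2 = elSrc2, tgt2 = elTgt2,
     id1 = (\<lambda>p. \<lparr>elSrc = p, elTgt = p, elBase = id1 A (snd p), elFib = idn (on0 P (snd p)) (fst p)\<rparr>),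
     id2 = (\<lambda>u. \<lparr>elSrc2 = u, elTgt2 = u, elBase2 = id2 A (elBase u)\<rparr>),
     comp1 = el_comp A P,
     vcomp = (\<lambda>\<Phi> \<Theta>. \<lparr>elSrc2 = elSrc2 \<Theta>, elTgt2 = elTgt2 \<Phi>, elBase2 = elBase2 \<Phi> \<diamondop>\<^bsub>A\<^esub> elBase2 \<Theta>\<rparr>),
     hcomp = (\<lambda>\<Phi> \<Theta>. \<lparr>elSrc2 = el_comp A P (elSrc2 \<Phi>) (elSrc2 \<Theta>),
       elTgt2 = el_comp A P (elTgt2 \<Phi>) (elTgt2 \<Theta>), elBase2 = elBase2 \<Phi> \<star>\<^bsub>A\<^esub> elBase2 \<Theta>\<rparr>)\<rparr>"

definition cocartesian ::
    "('o, 'm, 'n) cat2 \<Rightarrow> ('o, 'm, 'n, 'c, 'a) cat_valued \<Rightarrow> ('o, 'm, 'c, 'a) el_arrow set" where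
  "cocartesian A P = {u \<in> Cell1 (El A P). iso_arr (on0 P (snd (elTgt u))) (elFib u)}"

section \<open>Sigma-filtered 2-categories\<close>

locale wide_subcategory = two_category C
  for C :: "('o, 'm, 'n) cat2" (structure) +
  fixes \<Sigma> :: "'m set"
  assumes Sigma_subset: "\<Sigma> \<subseteq> Cell1 C"
    and Sigma_id1: "X \<in> Obj C \<Longrightarrow> id1 C X \<in> \<Sigma>"
    and Sigma_comp1: "\<lbrakk>f \<in> \<Sigma>; g \<in> \<Sigma>; tgt C f = src C g\<rbrakk> \<Longrightarrow> g \<odot> f \<in> \<Sigma>"

locale sigma_filtered = wide_subcategory +
  assumes nonempty: "Obj C \<noteq> {}"
    and F0: "\<lbrakk>X \<in> Obj C; Y \<in> Obj C\<rbrakk>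
             \<Longrightarrow> \<exists>f\<in>\<Sigma>. \<exists>g\<in>\<Sigma>. src C f = X \<and> src C g = Y \<and> tgt C f = tgt C g"
    and F1: "\<lbrakk>f \<in> Cell1 C; g \<in> \<Sigma>; src C f = src C g; tgt C f = tgt C g\<rbrakk>
             \<Longrightarrow> \<exists>h\<in>\<Sigma>. \<exists>\<alpha>\<in>Cell2 C. src C h = tgt C f \<and>
                   src2 C \<alpha> = h \<odot> f \<and> tgt2 C \<alpha> = h \<odot> g \<and> (f \<in> \<Sigma> \<longrightarrow> invertible2 C \<alpha>)"
    and F2: "\<lbrakk>\<alpha> \<in> Cell2 C; \<beta> \<in> Cell2 C; src2 C \<alpha> = src2 C \<beta>; tgt2 C \<alpha> = tgt2 C \<beta>; tgt2 C \<alpha> \<in> \<Sigma>\<rbrakk>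
             \<Longrightarrow> \<exists>h\<in>\<Sigma>. src C h = tgt C (tgt2 C \<alpha>) \<and> id2 C h \<star> \<alpha> = id2 C h \<star> \<beta>"

definition sigma_cofiltered :: "('o, 'm, 'n) cat2 \<Rightarrow> 'm set \<Rightarrow> bool" where
  "sigma_cofiltered C \<Sigma> \<longleftrightarrow> sigma_filtered (op2 C) \<Sigma>"

end

theory Submission
  imports Defs
begin

text \<open>
  A pseudonatural transformation \<open>\<tau> : W \<Rightarrow> P F -\<close> is a cone with vertex the terminal category over
  the diagram \<open>P F\<close>. If \<open>P\<close> preserves the bilimit \<open>L\<close> of \<open>F\<close> weighted by \<open>W\<close>, then \<open>\<tau>\<close> comes from an
  object \<open>z\<close> of \<open>P L\<close>, up to isomorphisms \<open>P \<xi>\<^sub>d(w)(z) \<cong> \<tau>\<^sub>d(w)\<close> which are compatible with all the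
  structure. These isomorphisms are the second components of arrows of \<open>\<C>\<^sub>P\<close> from \<open>(z, L)\<close>.

  Every clause of \<open>\<sigma>\<close>-cofilteredness is an instance: the empty bilimit gives an object, a product
  gives (\<open>\<sigma>\<close>F0), and for \<open>(f, \<phi>)\<close> and \<open>(g, \<gamma>)\<close> with \<open>\<gamma>\<close> invertible the inserter of \<open>f\<close> and \<open>g\<close>
  gives (\<open>\<sigma>\<close>F1), because \<open>x\<close> together with \<open>\<gamma>\<inverse> \<phi>\<close> is an object of the inserter of \<open>P f\<close> and \<open>P g\<close>;
  if \<open>\<phi>\<close> is invertible too, one takes the iso-inserter. When 2-cells \<open>f \<Rightarrow> g\<close> belong to the diagram,
  they all become equal to the inserted cell, which gives (\<open>\<sigma>\<close>F2).
\<close>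

section \<open>The 2-category of categories\<close>

text \<open>Left exactness provides a bilimit \<open>M\<close> of \<open>P F\<close> in
  \<open>Cat\<close>, a comparison arrow \<open>k\<close> and an equivalence, all expressed through
  cones with values in functor categories. To make them usable, everything is evaluated at one
  object of the vertex: a cone becomes a family of objects and arrows of the categories
  \<open>P F d\<close>, and an equation of modifications becomes equations of arrows. The object to
  start from comes from the universal property of \<open>M\<close> at a terminal category, taken
  inside the types in which \<open>P\<close> has its values.

  The inverse of \<gamma> is never formed. The transformation sends the walking arrow to \<phi>
  itself, and \<gamma> becomes the structure isomorphism at the second of the two parallel arrows,
  with an identity at the first. An inverse appears on the side of \<open>A\<close> instead: a
  bicategorical inserter offers \<open>\<nu> : k 0 \<Rightarrow> k 1\<close> and isomorphisms
  \<open>s 2 : c 2 h \<Rightarrow> k 0\<close>, \<open>s 3 : c 3 h \<Rightarrow> k 1\<close>, so the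
  inserted cell is \<open>\<nu>\<close> after \<open>s 2\<close>, followed by the inverse of
  \<open>s 3\<close>.\<close>

lemma func_eqI:
  assumes "cat_functor F" "cat_functor G" "Src F = Src G" "Tgt F = Tgt G"
    and "\<And>x. x \<in> Ob (Src F) \<Longrightarrow> onOb F x = onOb G x"
    and "\<And>f. f \<in> Ar (Src F) \<Longrightarrow> onAr F f = onAr G f"
  shows "F = G"
proof -
  have "onOb F = onOb G"
    by (rule extensionalityI[of _ "Ob (Src F)"]) (use assms cat_functor.onOb_extensional in force)+
  moreover have "onAr F = onAr G"
    by (rule extensionalityI[of _ "Ar (Src F)"]) (use assms cat_functor.onAr_extensional in force)+
  ultimately show ?thesis using assms by (auto intro: func.equality)
qed

lemma nattrans_eqI:
  assumes "nat_trans \<alpha>" "nat_trans \<beta>" "nDom \<alpha> = nDom \<beta>" "nCod \<alpha> = nCod \<beta>"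
    and "\<And>x. x \<in> Ob (Src (nDom \<alpha>)) \<Longrightarrow> ntAt \<alpha> x = ntAt \<beta> x"
  shows "\<alpha> = \<beta>"
proof -
  have "ntAt \<alpha> = ntAt \<beta>"
    by (rule extensionalityI[of _ "Ob (Src (nDom \<alpha>))"])
      (use assms nat_trans.at_extensional in force)+
  then show ?thesis using assms by (auto intro: nattrans.equality)
qed

lemma id_func_simps [simp]:
  "Src (id_func C) = C" "Tgt (id_func C) = C"
  "x \<in> Ob C \<Longrightarrow> onOb (id_func C) x = x" "f \<in> Ar C \<Longrightarrow> onAr (id_func C) f = f"
  by (simp_all add: id_func_def)

lemma comp_func_simps [simp]:
  "Src (comp_func G F) = Src F" "Tgt (comp_func G F) = Tgt G"
  "x \<in> Ob (Src F) \<Longrightarrow> onOb (comp_func G F) x = onOb G (onOb F x)"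
  "f \<in> Ar (Src F) \<Longrightarrow> onAr (comp_func G F) f = onAr G (onAr F f)"
  by (simp_all add: comp_func_def)

lemma id_nt_simps [simp]:
  "nDom (id_nt F) = F" "nCod (id_nt F) = F"
  "x \<in> Ob (Src F) \<Longrightarrow> ntAt (id_nt F) x = idn (Tgt F) (onOb F x)"
  by (simp_all add: id_nt_def)

lemma vcomp_nt_simps [simp]:
  "nDom (vcomp_nt \<beta> \<alpha>) = nDom \<alpha>" "nCod (vcomp_nt \<beta> \<alpha>) = nCod \<beta>"
  "x \<in> Ob (Src (nDom \<alpha>)) \<Longrightarrow>
     ntAt (vcomp_nt \<beta> \<alpha>) x = ntAt \<beta> x \<cdot>\<^bsub>Tgt (nDom \<alpha>)\<^esub> ntAt \<alpha> x"
  by (simp_all add: vcomp_nt_def)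

lemma hcomp_nt_simps [simp]:
  "nDom (hcomp_nt \<beta> \<alpha>) = comp_func (nDom \<beta>) (nDom \<alpha>)"
  "nCod (hcomp_nt \<beta> \<alpha>) = comp_func (nCod \<beta>) (nCod \<alpha>)"
  "x \<in> Ob (Src (nDom \<alpha>)) \<Longrightarrow> ntAt (hcomp_nt \<beta> \<alpha>) x =
     ntAt \<beta> (onOb (nCod \<alpha>) x) \<cdot>\<^bsub>Tgt (nDom \<beta>)\<^esub> onAr (nDom \<beta>) (ntAt \<alpha> x)"
  by (simp_all add: hcomp_nt_def)

lemma whisker_left_simps [simp]:
  "nDom (whisker_left H \<alpha>) = comp_func H (nDom \<alpha>)"
  "nCod (whisker_left H \<alpha>) = comp_func H (nCod \<alpha>)"
  "x \<in> Ob (Src (nDom \<alpha>)) \<Longrightarrow> ntAt (whisker_left H \<alpha>) x = onAr H (ntAt \<alpha> x)"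
  by (simp_all add: whisker_left_def)

lemma Cat_simps [simp]:
  "Obj Cat = {C. category C}" "Cell1 Cat = {F. cat_functor F}" "Cell2 Cat = {\<alpha>. nat_trans \<alpha>}"
  "src Cat = Src" "tgt Cat = Tgt" "src2 Cat = nDom" "tgt2 Cat = nCod"
  "id1 Cat = id_func" "id2 Cat = id_nt" "comp1 Cat = comp_func" "vcomp Cat = vcomp_nt"
  "hcomp Cat = hcomp_nt"
  by (simp_all add: Cat_def)

lemma hom_cat_simps [simp]:
  "Ob (hom_cat C X Y) = {f \<in> Cell1 C. src C f = X \<and> tgt C f = Y}"
  "Ar (hom_cat C X Y) = {\<alpha> \<in> Cell2 C. src C (src2 C \<alpha>) = X \<and> tgt C (src2 C \<alpha>) = Y}"
  "dm (hom_cat C X Y) = src2 C" "cd (hom_cat C X Y) = tgt2 C" "idn (hom_cat C X Y) = id2 C"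
  "cmp (hom_cat C X Y) = vcomp C"
  by (simp_all add: hom_cat_def)

lemma underlying_cat_simps [simp]:
  "Ob (underlying_cat C) = Obj C" "Ar (underlying_cat C) = Cell1 C"
  "dm (underlying_cat C) = src C" "cd (underlying_cat C) = tgt C"
  "idn (underlying_cat C) = id1 C" "cmp (underlying_cat C) = comp1 C"
  by (simp_all add: underlying_cat_def)

lemma vertical_cat_simps [simp]:
  "Ob (vertical_cat C) = Cell1 C" "Ar (vertical_cat C) = Cell2 C"
  "dm (vertical_cat C) = src2 C" "cd (vertical_cat C) = tgt2 C"
  "idn (vertical_cat C) = id2 C" "cmp (vertical_cat C) = vcomp C"
  by (simp_all add: vertical_cat_def)

lemma horizontal_cat_simps [simp]:
  "Ob (horizontal_cat C) = Obj C" "Ar (horizontal_cat C) = Cell2 C"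
  "dm (horizontal_cat C) \<alpha> = src C (src2 C \<alpha>)" "cd (horizontal_cat C) \<alpha> = tgt C (src2 C \<alpha>)"
  "idn (horizontal_cat C) X = id2 C (id1 C X)" "cmp (horizontal_cat C) = hcomp C"
  by (simp_all add: horizontal_cat_def)

lemmas category_rules [simp] =
  category.dm_closed category.cd_closed category.idn_closed category.dm_idn category.cd_idn
  category.cmp_closed category.dm_cmp category.cd_cmp category.cmp_idn category.idn_cmp
  category.cmp_assoc

text \<open>With \<open>x = dm C f\<close> as a premise the unit law still applies after the
  simplifier has rewritten \<open>dm C f\<close> to something else. The same holds for
  \<open>idn_cmp'\<close>.\<close>

lemma (in category) cmp_idn' [simp]: "f \<in> Ar C \<Longrightarrow> x = dm C f \<Longrightarrow> f \<cdot> idn C x = f"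
  by (simp add: cmp_idn)

lemma (in category) idn_cmp' [simp]: "f \<in> Ar C \<Longrightarrow> x = cd C f \<Longrightarrow> idn C x \<cdot> f = f"
  by (simp add: idn_cmp)

lemmas category_units [simp] = category.cmp_idn' category.idn_cmp'

text \<open>The simplifier replaces \<open>Src F\<close> and \<open>Tgt F\<close> by concrete
  categories, after which a rule mentioning them literally would no longer match; hence the
  equations \<open>Tgt F = T\<close> and \<open>Src F = S\<close> as premises.\<close>

lemma functor_rules [simp]:
  assumes "cat_functor F"
  shows "category (Src F)" "category (Tgt F)"
    and "Tgt F = T \<Longrightarrow> x \<in> Ob (Src F) \<Longrightarrow> onOb F x \<in> Ob T"
    and "Tgt F = T \<Longrightarrow> f \<in> Ar (Src F) \<Longrightarrow> onAr F f \<in> Ar T"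
    and "Tgt F = T \<Longrightarrow> f \<in> Ar (Src F) \<Longrightarrow> dm T (onAr F f) = onOb F (dm (Src F) f)"
    and "Tgt F = T \<Longrightarrow> f \<in> Ar (Src F) \<Longrightarrow> cd T (onAr F f) = onOb F (cd (Src F) f)"
    and "Src F = S \<Longrightarrow> x \<in> Ob S \<Longrightarrow> onAr F (idn S x) = idn (Tgt F) (onOb F x)"
    and "Src F = S \<Longrightarrow> f \<in> Ar S \<Longrightarrow> g \<in> Ar S \<Longrightarrow> cd S f = dm S g \<Longrightarrow>
           onAr F (g \<cdot>\<^bsub>S\<^esub> f) = onAr F g \<cdot>\<^bsub>Tgt F\<^esub> onAr F f"
  using assms by (auto simp: cat_functor_def)

lemma nat_trans_rules [simp]:
  assumes "nat_trans \<alpha>"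
  shows "cat_functor (nDom \<alpha>)" "cat_functor (nCod \<alpha>)"
    and "Src (nCod \<alpha>) = Src (nDom \<alpha>)" "Tgt (nCod \<alpha>) = Tgt (nDom \<alpha>)"
    and "Tgt (nDom \<alpha>) = T \<Longrightarrow> x \<in> Ob (Src (nDom \<alpha>)) \<Longrightarrow> ntAt \<alpha> x \<in> Ar T"
    and "Tgt (nDom \<alpha>) = T \<Longrightarrow> x \<in> Ob (Src (nDom \<alpha>)) \<Longrightarrow> dm T (ntAt \<alpha> x) = onOb (nDom \<alpha>) x"
    and "Tgt (nDom \<alpha>) = T \<Longrightarrow> x \<in> Ob (Src (nDom \<alpha>)) \<Longrightarrow> cd T (ntAt \<alpha> x) = onOb (nCod \<alpha>) x"
  using assms by (auto simp: nat_trans_def)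

lemma nat_trans_naturality:
  assumes "nat_trans \<alpha>" "Src (nDom \<alpha>) = S" "Tgt (nDom \<alpha>) = T" "f \<in> Ar S"
  shows "ntAt \<alpha> (cd S f) \<cdot>\<^bsub>T\<^esub> onAr (nDom \<alpha>) f = onAr (nCod \<alpha>) f \<cdot>\<^bsub>T\<^esub> ntAt \<alpha> (dm S f)"
  using nat_trans.naturality[OF assms(1)] assms(2-4) by simp

lemma cat_functor_id_func: "category C \<Longrightarrow> cat_functor (id_func C)"
  by (rule cat_functor.intro) (auto simp: id_func_def)

lemma cat_functor_comp_func:
  assumes "cat_functor F" "cat_functor G" "Tgt F = Src G"
  shows "cat_functor (comp_func G F)"
  by (rule cat_functor.intro) (use assms in simp_all, simp_all add: comp_func_def)

lemma nat_trans_id_nt: "cat_functor F \<Longrightarrow> nat_trans (id_nt F)"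
  by (rule nat_trans.intro) (simp_all, simp add: id_nt_def)

lemma nat_trans_vcomp_nt:
  assumes "nat_trans \<alpha>" "nat_trans \<beta>" "nCod \<alpha> = nDom \<beta>"
  shows "nat_trans (vcomp_nt \<beta> \<alpha>)"
proof -
  have \<beta>: "nDom \<beta> = nCod \<alpha>" using assms by simp
  define S where "S = Src (nDom \<alpha>)"
  define T where "T = Tgt (nDom \<alpha>)"
  note [simp] = S_def[symmetric] T_def[symmetric] \<beta> assms(1,2)
  have [simp]: "Src (nCod \<beta>) = S" "Tgt (nCod \<beta>) = T"
    using nat_trans_rules(3,4)[OF assms(1)] nat_trans_rules(3,4)[OF assms(2)] by simp_all
  have [simp]: "category S" "category T"
    using functor_rules(1,2)[of "nDom \<alpha>"] by simp_all
  show ?thesis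
  proof (rule nat_trans.intro)
    fix f assume "f \<in> Ar (Src (nDom (vcomp_nt \<beta> \<alpha>)))"
    then have f: "f \<in> Ar S" by simp
    let ?d = "dm S f" and ?c = "cd S f"
    have "(ntAt \<beta> ?c \<cdot>\<^bsub>T\<^esub> ntAt \<alpha> ?c) \<cdot>\<^bsub>T\<^esub> onAr (nDom \<alpha>) f
        = ntAt \<beta> ?c \<cdot>\<^bsub>T\<^esub> (onAr (nCod \<alpha>) f \<cdot>\<^bsub>T\<^esub> ntAt \<alpha> ?d)"
      using f nat_trans_naturality[of \<alpha> S T f] by simp
    also have "\<dots> = (ntAt \<beta> ?c \<cdot>\<^bsub>T\<^esub> onAr (nDom \<beta>) f) \<cdot>\<^bsub>T\<^esub> ntAt \<alpha> ?d"
      using f by simp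
    also have "\<dots> = (onAr (nCod \<beta>) f \<cdot>\<^bsub>T\<^esub> ntAt \<beta> ?d) \<cdot>\<^bsub>T\<^esub> ntAt \<alpha> ?d"
      by (subst nat_trans_naturality) (use f in simp_all)
    finally show "ntAt (vcomp_nt \<beta> \<alpha>) (cd (Src (nDom (vcomp_nt \<beta> \<alpha>))) f)
          \<cdot>\<^bsub>Tgt (nDom (vcomp_nt \<beta> \<alpha>))\<^esub> onAr (nDom (vcomp_nt \<beta> \<alpha>)) f
        = onAr (nCod (vcomp_nt \<beta> \<alpha>)) f
          \<cdot>\<^bsub>Tgt (nDom (vcomp_nt \<beta> \<alpha>))\<^esub> ntAt (vcomp_nt \<beta> \<alpha>) (dm (Src (nDom (vcomp_nt \<beta> \<alpha>))) f)"
      using f by simp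
  qed (simp_all, simp add: vcomp_nt_def)
qed

text \<open>Two squares are pasted: the image under \<open>nDom \<beta>\<close> of the square of
  \<open>\<alpha>\<close> at \<open>f\<close>, and the square of \<open>\<beta>\<close> at
  \<open>onAr (nCod \<alpha>) f\<close>.\<close>

lemma nat_trans_hcomp_nt:
  assumes "nat_trans \<alpha>" "nat_trans \<beta>" "Tgt (nDom \<alpha>) = Src (nDom \<beta>)"
  shows "nat_trans (hcomp_nt \<beta> \<alpha>)"
proof -
  define S where "S = Src (nDom \<alpha>)"
  define T where "T = Tgt (nDom \<alpha>)"
  define U where "U = Tgt (nDom \<beta>)"
  have \<beta>: "Src (nDom \<beta>) = T" using assms T_def by simp
  note [simp] = S_def[symmetric] T_def[symmetric] U_def[symmetric] \<beta> assms(1,2)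
  have [simp]: "category S" "category T" "category U"
    using functor_rules(1,2)[of "nDom \<alpha>"] functor_rules(1,2)[of "nDom \<beta>"] by simp_all
  show ?thesis
  proof (rule nat_trans.intro)
    fix f assume "f \<in> Ar (Src (nDom (hcomp_nt \<beta> \<alpha>)))"
    then have f: "f \<in> Ar S" by simp
    let ?d = "dm S f" and ?c = "cd S f"
    have "(ntAt \<beta> (onOb (nCod \<alpha>) ?c) \<cdot>\<^bsub>U\<^esub> onAr (nDom \<beta>) (ntAt \<alpha> ?c)) \<cdot>\<^bsub>U\<^esub> onAr (nDom \<beta>) (onAr (nDom \<alpha>) f)
        = ntAt \<beta> (onOb (nCod \<alpha>) ?c) \<cdot>\<^bsub>U\<^esub> onAr (nDom \<beta>) (ntAt \<alpha> ?c \<cdot>\<^bsub>T\<^esub> onAr (nDom \<alpha>) f)"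
      using f by simp
    also have "\<dots> = (ntAt \<beta> (onOb (nCod \<alpha>) ?c) \<cdot>\<^bsub>U\<^esub> onAr (nDom \<beta>) (onAr (nCod \<alpha>) f)) \<cdot>\<^bsub>U\<^esub> onAr (nDom \<beta>) (ntAt \<alpha> ?d)"
      by (subst nat_trans_naturality[of \<alpha> S T f]) (use f in simp_all)
    also have "\<dots> = (onAr (nCod \<beta>) (onAr (nCod \<alpha>) f) \<cdot>\<^bsub>U\<^esub> ntAt \<beta> (onOb (nCod \<alpha>) ?d)) \<cdot>\<^bsub>U\<^esub> onAr (nDom \<beta>) (ntAt \<alpha> ?d)"
      using nat_trans_naturality[of \<beta> T U "onAr (nCod \<alpha>) f"] f by simp
    finally show "ntAt (hcomp_nt \<beta> \<alpha>) (cd (Src (nDom (hcomp_nt \<beta> \<alpha>))) f)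
          \<cdot>\<^bsub>Tgt (nDom (hcomp_nt \<beta> \<alpha>))\<^esub> onAr (nDom (hcomp_nt \<beta> \<alpha>)) f
        = onAr (nCod (hcomp_nt \<beta> \<alpha>)) f
          \<cdot>\<^bsub>Tgt (nDom (hcomp_nt \<beta> \<alpha>))\<^esub> ntAt (hcomp_nt \<beta> \<alpha>) (dm (Src (nDom (hcomp_nt \<beta> \<alpha>))) f)"
      using f by simp
  qed (simp_all add: cat_functor_comp_func, simp add: hcomp_nt_def)
qed

lemma category_underlying_Cat: "category (underlying_cat Cat)"
proof (rule category.intro)
  fix f :: "('a,'b,'a,'b) func" assume "f \<in> Ar (underlying_cat Cat)"
  then have f: "cat_functor f" by simp
  show "f \<cdot>\<^bsub>underlying_cat Cat\<^esub> idn (underlying_cat Cat) (dm (underlying_cat Cat) f) = f"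
    by (rule func_eqI) (use f in \<open>simp_all add: cat_functor_comp_func cat_functor_id_func\<close>)
  show "idn (underlying_cat Cat) (cd (underlying_cat Cat) f) \<cdot>\<^bsub>underlying_cat Cat\<^esub> f = f"
    by (rule func_eqI) (use f in \<open>simp_all add: cat_functor_comp_func cat_functor_id_func\<close>)
next
  fix f g h :: "('a,'b,'a,'b) func"
  assume "f \<in> Ar (underlying_cat Cat)" "g \<in> Ar (underlying_cat Cat)" "h \<in> Ar (underlying_cat Cat)"
    "cd (underlying_cat Cat) f = dm (underlying_cat Cat) g"
    "cd (underlying_cat Cat) g = dm (underlying_cat Cat) h"
  then show "(h \<cdot>\<^bsub>underlying_cat Cat\<^esub> g) \<cdot>\<^bsub>underlying_cat Cat\<^esub> f = h \<cdot>\<^bsub>underlying_cat Cat\<^esub> (g \<cdot>\<^bsub>underlying_cat Cat\<^esub> f)"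
    by (intro func_eqI) (simp_all add: cat_functor_comp_func)
qed (simp_all add: cat_functor_comp_func cat_functor_id_func)

lemma category_vertical_Cat: "category (vertical_cat Cat)"
proof (rule category.intro)
  fix f :: "('a,'b,'a,'b) nattrans" assume "f \<in> Ar (vertical_cat Cat)"
  then have f: "nat_trans f" by simp
  show "f \<cdot>\<^bsub>vertical_cat Cat\<^esub> idn (vertical_cat Cat) (dm (vertical_cat Cat) f) = f"
    by (rule nattrans_eqI) (use f in \<open>simp_all add: nat_trans_vcomp_nt nat_trans_id_nt\<close>)
  show "idn (vertical_cat Cat) (cd (vertical_cat Cat) f) \<cdot>\<^bsub>vertical_cat Cat\<^esub> f = f"
    by (rule nattrans_eqI) (use f in \<open>simp_all add: nat_trans_vcomp_nt nat_trans_id_nt\<close>)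
next
  fix f g h :: "('a,'b,'a,'b) nattrans"
  assume "f \<in> Ar (vertical_cat Cat)" "g \<in> Ar (vertical_cat Cat)" "h \<in> Ar (vertical_cat Cat)"
    "cd (vertical_cat Cat) f = dm (vertical_cat Cat) g"
    "cd (vertical_cat Cat) g = dm (vertical_cat Cat) h"
  then have a: "nat_trans f" "nat_trans g" "nat_trans h" "nDom g = nCod f" "nDom h = nCod g" by simp_all
  moreover have "Src (nCod g) = Src (nDom f)" "Tgt (nCod g) = Tgt (nDom f)"
    using a nat_trans_rules(3,4)[of g] by simp_all
  ultimately show "(h \<cdot>\<^bsub>vertical_cat Cat\<^esub> g) \<cdot>\<^bsub>vertical_cat Cat\<^esub> f = h \<cdot>\<^bsub>vertical_cat Cat\<^esub> (g \<cdot>\<^bsub>vertical_cat Cat\<^esub> f)"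
    by (intro nattrans_eqI) (simp_all add: nat_trans_vcomp_nt)
qed (simp_all add: nat_trans_vcomp_nt nat_trans_id_nt)

lemma comp_func_id [simp]:
  "cat_functor F \<Longrightarrow> S = Src F \<Longrightarrow> comp_func F (id_func S) = F"
  "cat_functor F \<Longrightarrow> T = Tgt F \<Longrightarrow> comp_func (id_func T) F = F"
  by (auto intro!: func_eqI simp: cat_functor_comp_func cat_functor_id_func)

lemma comp_func_assoc:
  "\<lbrakk>cat_functor F; cat_functor G; cat_functor H; Tgt F = Src G; Tgt G = Src H\<rbrakk> \<Longrightarrow>
     comp_func (comp_func H G) F = comp_func H (comp_func G F)"
  by (intro func_eqI) (simp_all add: cat_functor_comp_func)

lemma category_horizontal_Cat: "category (horizontal_cat Cat)"
proof (rule category.intro)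
  fix f :: "('a,'b,'a,'b) nattrans" assume "f \<in> Ar (horizontal_cat Cat)"
  then have f: "nat_trans f" by simp
  show "f \<cdot>\<^bsub>horizontal_cat Cat\<^esub> idn (horizontal_cat Cat) (dm (horizontal_cat Cat) f) = f"
    by (rule nattrans_eqI) (use f in \<open>simp_all add: nat_trans_hcomp_nt nat_trans_id_nt cat_functor_id_func\<close>)
  show "idn (horizontal_cat Cat) (cd (horizontal_cat Cat) f) \<cdot>\<^bsub>horizontal_cat Cat\<^esub> f = f"
    by (rule nattrans_eqI) (use f in \<open>simp_all add: nat_trans_hcomp_nt nat_trans_id_nt cat_functor_id_func\<close>)
next
  fix f g h :: "('a,'b,'a,'b) nattrans"
  assume "f \<in> Ar (horizontal_cat Cat)" "g \<in> Ar (horizontal_cat Cat)" "h \<in> Ar (horizontal_cat Cat)"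
    "cd (horizontal_cat Cat) f = dm (horizontal_cat Cat) g"
    "cd (horizontal_cat Cat) g = dm (horizontal_cat Cat) h"
  then have "nat_trans f" "nat_trans g" "nat_trans h"
     "Tgt (nDom f) = Src (nDom g)" "Tgt (nDom g) = Src (nDom h)" by simp_all
  then show "(h \<cdot>\<^bsub>horizontal_cat Cat\<^esub> g) \<cdot>\<^bsub>horizontal_cat Cat\<^esub> f = h \<cdot>\<^bsub>horizontal_cat Cat\<^esub> (g \<cdot>\<^bsub>horizontal_cat Cat\<^esub> f)"
    by (intro nattrans_eqI) (simp_all add: nat_trans_hcomp_nt comp_func_assoc cat_functor_comp_func)
qed (simp_all add: nat_trans_hcomp_nt nat_trans_id_nt cat_functor_id_func)

lemma two_category_Cat: "two_category Cat"
proof (rule two_category.intro)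
  fix \<alpha> \<alpha>' \<beta> \<beta>' :: "('a,'b,'a,'b) nattrans"
  assume "\<alpha> \<in> Cell2 Cat" "\<alpha>' \<in> Cell2 Cat" "\<beta> \<in> Cell2 Cat" "\<beta>' \<in> Cell2 Cat"
    "tgt2 Cat \<alpha> = src2 Cat \<alpha>'" "tgt2 Cat \<beta> = src2 Cat \<beta>'"
    "tgt Cat (src2 Cat \<alpha>) = src Cat (src2 Cat \<beta>)"
  then have a: "nat_trans \<alpha>" "nat_trans \<alpha>'" "nat_trans \<beta>" "nat_trans \<beta>'"
    "nDom \<alpha>' = nCod \<alpha>" "nDom \<beta>' = nCod \<beta>" "Tgt (nDom \<alpha>) = Src (nDom \<beta>)" by simp_all
  have b: "Src (nCod \<alpha>') = Src (nDom \<alpha>)" "Tgt (nCod \<alpha>') = Src (nDom \<beta>)"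
    "Src (nCod \<beta>') = Src (nDom \<beta>)" "Tgt (nCod \<beta>') = Tgt (nDom \<beta>)"
    using a nat_trans_rules(3,4)[of \<alpha>'] nat_trans_rules(3,4)[of \<beta>'] by simp_all
  have "hcomp_nt (vcomp_nt \<beta>' \<beta>) (vcomp_nt \<alpha>' \<alpha>)
      = vcomp_nt (hcomp_nt \<beta>' \<alpha>') (hcomp_nt \<beta> \<alpha>)"
  proof (rule nattrans_eqI)
    fix x assume "x \<in> Ob (Src (nDom (hcomp_nt (vcomp_nt \<beta>' \<beta>) (vcomp_nt \<alpha>' \<alpha>))))"
    then have x: "x \<in> Ob (Src (nDom \<alpha>))" by simp
    let ?U = "Tgt (nDom \<beta>)"
    define p where "p = ntAt \<alpha>' x"
    define q where "q = ntAt \<alpha> x"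
    have p: "p \<in> Ar (Src (nDom \<beta>))" "dm (Src (nDom \<beta>)) p = onOb (nCod \<alpha>) x"
       "cd (Src (nDom \<beta>)) p = onOb (nCod \<alpha>') x"
      "q \<in> Ar (Src (nDom \<beta>))" "dm (Src (nDom \<beta>)) q = onOb (nDom \<alpha>) x"
       "cd (Src (nDom \<beta>)) q = onOb (nCod \<alpha>) x" unfolding p_def q_def using a x by simp_all
    \<comment> \<open>At \<open>x\<close>, the interchange law is the naturality of
      \<open>\<beta>\<close> at the component of \<open>\<alpha>'\<close>.\<close>
    have "ntAt \<beta> (onOb (nCod \<alpha>') x) \<cdot>\<^bsub>?U\<^esub> onAr (nDom \<beta>) p = onAr (nCod \<beta>) p \<cdot>\<^bsub>?U\<^esub> ntAt \<beta> (onOb (nCod \<alpha>) x)"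
      using nat_trans_naturality[of \<beta> "Src (nDom \<beta>)" ?U p] p a by simp
    then have "(ntAt \<beta> (onOb (nCod \<alpha>') x) \<cdot>\<^bsub>?U\<^esub> onAr (nDom \<beta>) p) \<cdot>\<^bsub>?U\<^esub> onAr (nDom \<beta>) q
      = (onAr (nCod \<beta>) p \<cdot>\<^bsub>?U\<^esub> ntAt \<beta> (onOb (nCod \<alpha>) x)) \<cdot>\<^bsub>?U\<^esub> onAr (nDom \<beta>) q" by simp
    then show "ntAt (hcomp_nt (vcomp_nt \<beta>' \<beta>) (vcomp_nt \<alpha>' \<alpha>)) x
        = ntAt (vcomp_nt (hcomp_nt \<beta>' \<alpha>') (hcomp_nt \<beta> \<alpha>)) x"
      using x a b p by (simp add: p_def[symmetric] q_def[symmetric])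
  qed (use a b in \<open>simp_all add: nat_trans_hcomp_nt nat_trans_vcomp_nt\<close>)
  then show "(\<beta>' \<diamondop>\<^bsub>Cat\<^esub> \<beta>) \<star>\<^bsub>Cat\<^esub> (\<alpha>' \<diamondop>\<^bsub>Cat\<^esub> \<alpha>) = (\<beta>' \<star>\<^bsub>Cat\<^esub> \<alpha>') \<diamondop>\<^bsub>Cat\<^esub> (\<beta> \<star>\<^bsub>Cat\<^esub> \<alpha>)"
    by simp
next
  fix f g :: "('a,'b,'a,'b) func"
  assume "f \<in> Cell1 Cat" "g \<in> Cell1 Cat" "tgt Cat f = src Cat g"
  then show "id2 Cat g \<star>\<^bsub>Cat\<^esub> id2 Cat f = id2 Cat (g \<odot>\<^bsub>Cat\<^esub> f)"
    by (simp, intro nattrans_eqI) (simp_all add: nat_trans_hcomp_nt nat_trans_id_nt cat_functor_comp_func)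
qed (simp_all add: category_underlying_Cat category_vertical_Cat category_horizontal_Cat)

section \<open>Whiskering and hom-functors\<close>

context two_category
begin

lemma cell1_rules [simp]:
  "f \<in> Cell1 C \<Longrightarrow> src C f \<in> Obj C" "f \<in> Cell1 C \<Longrightarrow> tgt C f \<in> Obj C"
  "X \<in> Obj C \<Longrightarrow> id1 C X \<in> Cell1 C" "X \<in> Obj C \<Longrightarrow> src C (id1 C X) = X"
  "X \<in> Obj C \<Longrightarrow> tgt C (id1 C X) = X"
  "\<lbrakk>f \<in> Cell1 C; g \<in> Cell1 C; tgt C f = src C g\<rbrakk> \<Longrightarrow> g \<odot> f \<in> Cell1 C"
  "\<lbrakk>f \<in> Cell1 C; g \<in> Cell1 C; tgt C f = src C g\<rbrakk> \<Longrightarrow> src C (g \<odot> f) = src C f"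
  "\<lbrakk>f \<in> Cell1 C; g \<in> Cell1 C; tgt C f = src C g\<rbrakk> \<Longrightarrow> tgt C (g \<odot> f) = tgt C g"
  "f \<in> Cell1 C \<Longrightarrow> src C f = X \<Longrightarrow> f \<odot> id1 C X = f"
  "f \<in> Cell1 C \<Longrightarrow> tgt C f = X \<Longrightarrow> id1 C X \<odot> f = f"
  "\<lbrakk>f \<in> Cell1 C; g \<in> Cell1 C; h \<in> Cell1 C; tgt C f = src C g; tgt C g = src C h\<rbrakk>
     \<Longrightarrow> (h \<odot> g) \<odot> f = h \<odot> (g \<odot> f)"
  using category_underlying by (auto simp: category_def)

lemma cell2_rules [simp]:
  "\<alpha> \<in> Cell2 C \<Longrightarrow> src2 C \<alpha> \<in> Cell1 C" "\<alpha> \<in> Cell2 C \<Longrightarrow> tgt2 C \<alpha> \<in> Cell1 C"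
  "f \<in> Cell1 C \<Longrightarrow> id2 C f \<in> Cell2 C" "f \<in> Cell1 C \<Longrightarrow> src2 C (id2 C f) = f"
  "f \<in> Cell1 C \<Longrightarrow> tgt2 C (id2 C f) = f"
  "\<lbrakk>\<alpha> \<in> Cell2 C; \<beta> \<in> Cell2 C; tgt2 C \<alpha> = src2 C \<beta>\<rbrakk> \<Longrightarrow> \<beta> \<diamondop> \<alpha> \<in> Cell2 C"
  "\<lbrakk>\<alpha> \<in> Cell2 C; \<beta> \<in> Cell2 C; tgt2 C \<alpha> = src2 C \<beta>\<rbrakk> \<Longrightarrow> src2 C (\<beta> \<diamondop> \<alpha>) = src2 C \<alpha>"
  "\<lbrakk>\<alpha> \<in> Cell2 C; \<beta> \<in> Cell2 C; tgt2 C \<alpha> = src2 C \<beta>\<rbrakk> \<Longrightarrow> tgt2 C (\<beta> \<diamondop> \<alpha>) = tgt2 C \<beta>"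
  "\<alpha> \<in> Cell2 C \<Longrightarrow> src2 C \<alpha> = f \<Longrightarrow> \<alpha> \<diamondop> id2 C f = \<alpha>"
  "\<alpha> \<in> Cell2 C \<Longrightarrow> tgt2 C \<alpha> = f \<Longrightarrow> id2 C f \<diamondop> \<alpha> = \<alpha>"
  "\<lbrakk>\<alpha> \<in> Cell2 C; \<beta> \<in> Cell2 C; \<gamma> \<in> Cell2 C; tgt2 C \<alpha> = src2 C \<beta>; tgt2 C \<beta> = src2 C \<gamma>\<rbrakk>
     \<Longrightarrow> (\<gamma> \<diamondop> \<beta>) \<diamondop> \<alpha> = \<gamma> \<diamondop> (\<beta> \<diamondop> \<alpha>)"
  using category_vertical by (auto simp: category_def)

lemma hcomp_rules [simp]:
  "\<lbrakk>\<alpha> \<in> Cell2 C; \<beta> \<in> Cell2 C; tgt C (src2 C \<alpha>) = src C (src2 C \<beta>)\<rbrakk> \<Longrightarrow> \<beta> \<star> \<alpha> \<in> Cell2 C"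
  "\<lbrakk>\<alpha> \<in> Cell2 C; src C (src2 C \<alpha>) = X\<rbrakk> \<Longrightarrow> \<alpha> \<star> id2 C (id1 C X) = \<alpha>"
  "\<lbrakk>\<alpha> \<in> Cell2 C; tgt C (src2 C \<alpha>) = X\<rbrakk> \<Longrightarrow> id2 C (id1 C X) \<star> \<alpha> = \<alpha>"
  "\<lbrakk>\<alpha> \<in> Cell2 C; \<beta> \<in> Cell2 C; \<gamma> \<in> Cell2 C; tgt C (src2 C \<alpha>) = src C (src2 C \<beta>);
    tgt C (src2 C \<beta>) = src C (src2 C \<gamma>)\<rbrakk> \<Longrightarrow> (\<gamma> \<star> \<beta>) \<star> \<alpha> = \<gamma> \<star> (\<beta> \<star> \<alpha>)"
  using category_horizontal by (auto simp: category_def)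

declare src_parallel [simp] tgt_parallel [simp] src2_hcomp [simp] tgt2_hcomp [simp] hcomp_id2 [simp]

lemma category_hom_cat: "category (hom_cat C X Y)"
  by (rule category.intro) auto

lemma whisker_rules:
  "\<lbrakk>\<alpha> \<in> Cell2 C; \<beta> \<in> Cell2 C; u \<in> Cell1 C; tgt2 C \<alpha> = src2 C \<beta>; tgt C u = src C (src2 C \<alpha>)\<rbrakk>
     \<Longrightarrow> (\<beta> \<diamondop> \<alpha>) \<star> id2 C u = (\<beta> \<star> id2 C u) \<diamondop> (\<alpha> \<star> id2 C u)"
  "\<lbrakk>\<alpha> \<in> Cell2 C; \<beta> \<in> Cell2 C; u \<in> Cell1 C; tgt2 C \<alpha> = src2 C \<beta>; src C u = tgt C (src2 C \<alpha>)\<rbrakk>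
     \<Longrightarrow> id2 C u \<star> (\<beta> \<diamondop> \<alpha>) = (id2 C u \<star> \<beta>) \<diamondop> (id2 C u \<star> \<alpha>)"
  using interchange[of "id2 C u" "id2 C u" \<alpha> \<beta>] interchange[of \<alpha> \<beta> "id2 C u" "id2 C u"]
  by simp_all

text \<open>Interchange against identity 2-cells, in both orders. That the two composites agree is
  the naturality of the components \<open>\<theta> \<star> id2 C u\<close> of
  \<open>hom_from\<close>.\<close>

lemma hcomp_eq_vcomp_whisker:
  assumes "\<alpha> \<in> Cell2 C" "\<beta> \<in> Cell2 C" "tgt C (src2 C \<alpha>) = src C (src2 C \<beta>)"
  shows "(\<beta> \<star> id2 C (tgt2 C \<alpha>)) \<diamondop> (id2 C (src2 C \<beta>) \<star> \<alpha>) = \<beta> \<star> \<alpha>"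
    and "(id2 C (tgt2 C \<beta>) \<star> \<alpha>) \<diamondop> (\<beta> \<star> id2 C (src2 C \<alpha>)) = \<beta> \<star> \<alpha>"
  using interchange[of \<alpha> "id2 C (tgt2 C \<alpha>)" "id2 C (src2 C \<beta>)" \<beta>]
    interchange[of "id2 C (src2 C \<alpha>)" \<alpha> \<beta> "id2 C (tgt2 C \<beta>)"] assms
  by simp_all

end

lemma postcomp_simps [simp]:
  "Src (postcomp C X f) = hom_cat C X (src C f)" "Tgt (postcomp C X f) = hom_cat C X (tgt C f)"
  "\<lbrakk>u \<in> Cell1 C; src C u = X; tgt C u = src C f\<rbrakk> \<Longrightarrow> onOb (postcomp C X f) u = f \<odot>\<^bsub>C\<^esub> u"
  "\<lbrakk>\<alpha> \<in> Cell2 C; src C (src2 C \<alpha>) = X; tgt C (src2 C \<alpha>) = src C f\<rbrakk>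
     \<Longrightarrow> onAr (postcomp C X f) \<alpha> = id2 C f \<star>\<^bsub>C\<^esub> \<alpha>"
  by (simp_all add: postcomp_def)

lemma precomp_simps [simp]:
  "Src (precomp C u Z) = hom_cat C (tgt C u) Z" "Tgt (precomp C u Z) = hom_cat C (src C u) Z"
  "\<lbrakk>f \<in> Cell1 C; src C f = tgt C u; tgt C f = Z\<rbrakk> \<Longrightarrow> onOb (precomp C u Z) f = f \<odot>\<^bsub>C\<^esub> u"
  "\<lbrakk>\<alpha> \<in> Cell2 C; src C (src2 C \<alpha>) = tgt C u; tgt C (src2 C \<alpha>) = Z\<rbrakk>
     \<Longrightarrow> onAr (precomp C u Z) \<alpha> = \<alpha> \<star>\<^bsub>C\<^esub> id2 C u"
  by (simp_all add: precomp_def)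

lemma hom_from_simps [simp]:
  "on0 (hom_from C X) = hom_cat C X" "on1 (hom_from C X) = postcomp C X"
  "nDom (on2 (hom_from C X) \<theta>) = postcomp C X (src2 C \<theta>)"
  "nCod (on2 (hom_from C X) \<theta>) = postcomp C X (tgt2 C \<theta>)"
  "\<lbrakk>u \<in> Cell1 C; src C u = X; tgt C u = src C (src2 C \<theta>)\<rbrakk>
     \<Longrightarrow> ntAt (on2 (hom_from C X) \<theta>) u = \<theta> \<star>\<^bsub>C\<^esub> id2 C u"
  by (simp_all add: hom_from_def)

lemma hom_map_simps [simp]:
  "Src (hom_map C D P X Y) = hom_cat C X Y"
  "Tgt (hom_map C D P X Y) = hom_cat D (on0 P X) (on0 P Y)"
  "\<lbrakk>f \<in> Cell1 C; src C f = X; tgt C f = Y\<rbrakk> \<Longrightarrow> onOb (hom_map C D P X Y) f = on1 P f"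
  "\<lbrakk>\<alpha> \<in> Cell2 C; src C (src2 C \<alpha>) = X; tgt C (src2 C \<alpha>) = Y\<rbrakk>
     \<Longrightarrow> onAr (hom_map C D P X Y) \<alpha> = on2 P \<alpha>"
  by (simp_all add: hom_map_def)

lemma comp2_simps [simp]:
  "on0 (comp2 G F) X = on0 G (on0 F X)" "on1 (comp2 G F) f = on1 G (on1 F f)"
  "on2 (comp2 G F) \<alpha> = on2 G (on2 F \<alpha>)"
  by (simp_all add: comp2_def)

context two_category
begin

lemma cat_functor_postcomp:
  assumes "f \<in> Cell1 C" shows "cat_functor (postcomp C X f)"
  by (rule cat_functor.intro)
    (use assms in \<open>auto simp: category_hom_cat whisker_rules\<close>, auto simp: postcomp_def)

lemma nat_trans_on2_hom_from:
  assumes "\<theta> \<in> Cell2 C" shows "nat_trans (on2 (hom_from C X) \<theta>)"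
proof (rule nat_trans.intro)
  fix \<alpha> assume "\<alpha> \<in> Ar (Src (nDom (on2 (hom_from C X) \<theta>)))"
  then show "ntAt (on2 (hom_from C X) \<theta>) (cd (Src (nDom (on2 (hom_from C X) \<theta>))) \<alpha>)
      \<cdot>\<^bsub>Tgt (nDom (on2 (hom_from C X) \<theta>))\<^esub> onAr (nDom (on2 (hom_from C X) \<theta>)) \<alpha>
    = onAr (nCod (on2 (hom_from C X) \<theta>)) \<alpha>
      \<cdot>\<^bsub>Tgt (nDom (on2 (hom_from C X) \<theta>))\<^esub>
        ntAt (on2 (hom_from C X) \<theta>) (dm (Src (nDom (on2 (hom_from C X) \<theta>))) \<alpha>)"
    using assms hcomp_eq_vcomp_whisker[of \<alpha> \<theta>] by simp
qed (use assms in \<open>auto simp: cat_functor_postcomp\<close>, simp add: hom_from_def)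

lemma two_functor_hom_from: "two_functor C Cat (hom_from C X)"
proof (rule two_functor.intro)
  show "two_category C" ..
  show "two_category Cat" by (rule two_category_Cat)
  fix Y assume "Y \<in> Obj C"
  then show "on1 (hom_from C X) (id1 C Y) = id1 Cat (on0 (hom_from C X) Y)"
    by (simp, intro func_eqI) (auto simp: cat_functor_postcomp cat_functor_id_func category_hom_cat)
next
  fix f assume "f \<in> Cell1 C"
  then show "on2 (hom_from C X) (id2 C f) = id2 Cat (on1 (hom_from C X) f)"
    by (simp, intro nattrans_eqI) (auto simp: nat_trans_on2_hom_from nat_trans_id_nt cat_functor_postcomp)
next
  fix f g assume "f \<in> Cell1 C" "g \<in> Cell1 C" "tgt C f = src C g"
  then show "on1 (hom_from C X) (g \<odot> f) = on1 (hom_from C X) g \<odot>\<^bsub>Cat\<^esub> on1 (hom_from C X) f"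
    by (simp, intro func_eqI)
      (auto simp: cat_functor_postcomp cat_functor_comp_func hcomp_id2[symmetric] simp del: hcomp_id2)
next
  fix \<alpha> \<beta> assume "\<alpha> \<in> Cell2 C" "\<beta> \<in> Cell2 C" "tgt2 C \<alpha> = src2 C \<beta>"
  moreover from this have "src C (src2 C \<beta>) = src C (src2 C \<alpha>)" "tgt C (src2 C \<beta>) = tgt C (src2 C \<alpha>)"
    using src_parallel[of \<alpha>] tgt_parallel[of \<alpha>] by simp_all
  ultimately show "on2 (hom_from C X) (\<beta> \<diamondop> \<alpha>) = on2 (hom_from C X) \<beta> \<diamondop>\<^bsub>Cat\<^esub> on2 (hom_from C X) \<alpha>"
    by (simp, intro nattrans_eqI) (auto simp: nat_trans_on2_hom_from nat_trans_vcomp_nt whisker_rules)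
next
  fix \<alpha> \<beta> assume a: "\<alpha> \<in> Cell2 C" "\<beta> \<in> Cell2 C" "tgt C (src2 C \<alpha>) = src C (src2 C \<beta>)"
  \<comment> \<open>Components can only be compared once the two transformations have the same
    source and target functors. On 2-cells this means splitting \<open>id2 C (g \<odot> f)\<close>,
    so \<open>hcomp_id2\<close> is used from right to left.\<close>
  have *: "postcomp C X (g \<odot> f) = comp_func (postcomp C X g) (postcomp C X f)"
    if "f \<in> Cell1 C" "g \<in> Cell1 C" "tgt C f = src C g" for f g
    by (intro func_eqI) (use that in
      \<open>auto simp: cat_functor_postcomp cat_functor_comp_func hcomp_id2[symmetric] simp del: hcomp_id2\<close>)
  have "on2 (hom_from C X) (\<beta> \<star> \<alpha>) = hcomp_nt (on2 (hom_from C X) \<beta>) (on2 (hom_from C X) \<alpha>)"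
  proof (rule nattrans_eqI)
    fix u assume "u \<in> Ob (Src (nDom (on2 (hom_from C X) (\<beta> \<star> \<alpha>))))"
    then have u: "u \<in> Cell1 C" "src C u = X" "tgt C u = src C (src2 C \<alpha>)" using a by auto
    then show "ntAt (on2 (hom_from C X) (\<beta> \<star> \<alpha>)) u
        = ntAt (hcomp_nt (on2 (hom_from C X) \<beta>) (on2 (hom_from C X) \<alpha>)) u"
      using a hcomp_eq_vcomp_whisker(1)[of "\<alpha> \<star> id2 C u" \<beta>] by simp
  qed (use a in \<open>auto simp: nat_trans_on2_hom_from nat_trans_hcomp_nt *\<close>)
  then show "on2 (hom_from C X) (\<beta> \<star> \<alpha>) = on2 (hom_from C X) \<beta> \<star>\<^bsub>Cat\<^esub> on2 (hom_from C X) \<alpha>"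
    by simp
qed (auto simp: category_hom_cat cat_functor_postcomp nat_trans_on2_hom_from)

end

context two_functor
begin

declare on0_closed [simp] on1_closed [simp] on2_closed [simp] src_on1 [simp] tgt_on1 [simp]
  src2_on2 [simp] tgt2_on2 [simp] on1_id1 [simp] on2_id2 [simp] on1_comp1 [simp] on2_vcomp [simp]
  on2_hcomp [simp]

end

lemma two_functor_comp2:
  assumes "two_functor C D F" "two_functor D E G"
  shows "two_functor C E (comp2 G F)"
proof -
  interpret F: two_functor C D F by fact
  interpret G: two_functor D E G by fact
  interpret C: two_category C by (rule F.dom_two_category)
  interpret D: two_category D by (rule F.cod_two_category)
  show ?thesis
    by (rule two_functor.intro) (simp_all add: F.dom_two_category G.cod_two_category)
qed

section \<open>Values of cones at a point\<close>

text \<open>In this locale the laws of a 2-functor into \<open>Cat\<close> are restated once in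
  terms of \<open>cat_functor\<close>, \<open>nat_trans\<close>, \<open>comp_func\<close> and the
  like, and the rules for cells of \<open>D\<close> become available under the prefix
  \<open>dom\<close>.\<close>

locale cat_valued_functor = two_functor D Cat V
  for D :: "('o, 'm, 'n) cat2" and V :: "('o, 'm, 'n, 'c, 'd) cat_valued"
begin

lemma cat_valued_rules [simp]:
  "d \<in> Obj D \<Longrightarrow> category (on0 V d)"
  "f \<in> Cell1 D \<Longrightarrow> cat_functor (on1 V f)"
  "f \<in> Cell1 D \<Longrightarrow> Src (on1 V f) = on0 V (src D f)"
  "f \<in> Cell1 D \<Longrightarrow> Tgt (on1 V f) = on0 V (tgt D f)"
  "\<theta> \<in> Cell2 D \<Longrightarrow> nat_trans (on2 V \<theta>)"
  "\<theta> \<in> Cell2 D \<Longrightarrow> nDom (on2 V \<theta>) = on1 V (src2 D \<theta>)"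
  "\<theta> \<in> Cell2 D \<Longrightarrow> nCod (on2 V \<theta>) = on1 V (tgt2 D \<theta>)"
  "d \<in> Obj D \<Longrightarrow> on1 V (id1 D d) = id_func (on0 V d)"
  "f \<in> Cell1 D \<Longrightarrow> on2 V (id2 D f) = id_nt (on1 V f)"
  "\<lbrakk>f \<in> Cell1 D; g \<in> Cell1 D; tgt D f = src D g\<rbrakk>
     \<Longrightarrow> on1 V (g \<odot>\<^bsub>D\<^esub> f) = comp_func (on1 V g) (on1 V f)"
  "\<lbrakk>\<alpha> \<in> Cell2 D; \<beta> \<in> Cell2 D; tgt2 D \<alpha> = src2 D \<beta>\<rbrakk>
     \<Longrightarrow> on2 V (\<beta> \<diamondop>\<^bsub>D\<^esub> \<alpha>) = vcomp_nt (on2 V \<beta>) (on2 V \<alpha>)"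
  "\<lbrakk>\<alpha> \<in> Cell2 D; \<beta> \<in> Cell2 D; tgt D (src2 D \<alpha>) = src D (src2 D \<beta>)\<rbrakk>
     \<Longrightarrow> on2 V (\<beta> \<star>\<^bsub>D\<^esub> \<alpha>) = hcomp_nt (on2 V \<beta>) (on2 V \<alpha>)"
  using on0_closed on1_closed on2_closed src_on1 tgt_on1 src2_on2 tgt2_on2 on1_id1 on2_id2
    on1_comp1 on2_vcomp on2_hcomp by simp_all

sublocale dom: two_category D by (rule dom_two_category)

end

lemma cat_valued_functorI: "two_functor D Cat V \<Longrightarrow> cat_valued_functor D V"
  by (simp add: cat_valued_functor_def)

section \<open>Isomorphisms in a category\<close>

lemma iso_arrI:
  "\<lbrakk>f \<in> Ar C; g \<in> Ar C; dm C g = cd C f; cd C g = dm C f;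
    g \<cdot>\<^bsub>C\<^esub> f = idn C (dm C f); f \<cdot>\<^bsub>C\<^esub> g = idn C (cd C f)\<rbrakk> \<Longrightarrow> iso_arr C f"
  by (auto simp: iso_arr_def)

lemma iso_arrE:
  assumes "iso_arr C f"
  obtains g where "iso_arr C g" "dm C g = cd C f" "cd C g = dm C f"
    "g \<cdot>\<^bsub>C\<^esub> f = idn C (dm C f)" "f \<cdot>\<^bsub>C\<^esub> g = idn C (cd C f)"
  using assms by (auto simp: iso_arr_def)

lemma iso_arr_closed: "iso_arr C f \<Longrightarrow> f \<in> Ar C"
  by (simp add: iso_arr_def)

lemma (in category) iso_arr_idn: "x \<in> Ob C \<Longrightarrow> iso_arr C (idn C x)"
  by (rule iso_arrI[where g = "idn C x"]) (use category_axioms in simp_all)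

lemma (in category) iso_arr_cmp:
  assumes "iso_arr C f" "iso_arr C g" "cd C f = dm C g"
  shows "iso_arr C (g \<cdot> f)"
proof -
  have f: "f \<in> Ar C" and g: "g \<in> Ar C" using assms by (simp_all add: iso_arr_closed)
  obtain f' where f': "f' \<in> Ar C" "dm C f' = cd C f" "cd C f' = dm C f"
      "f' \<cdot> f = idn C (dm C f)" "f \<cdot> f' = idn C (cd C f)"
    using assms(1) by (auto simp: iso_arr_def)
  obtain g' where g': "g' \<in> Ar C" "dm C g' = cd C g" "cd C g' = dm C g"
      "g' \<cdot> g = idn C (dm C g)" "g \<cdot> g' = idn C (cd C g)"
    using assms(2) by (auto simp: iso_arr_def)
  have "(f' \<cdot> g') \<cdot> (g \<cdot> f) = f' \<cdot> ((g' \<cdot> g) \<cdot> f)"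
    using category_axioms f g f'(1-3) g'(1-3) assms(3) by simp
  moreover have "(g \<cdot> f) \<cdot> (f' \<cdot> g') = g \<cdot> ((f \<cdot> f') \<cdot> g')"
    using category_axioms f g f'(1-3) g'(1-3) assms(3) by simp
  ultimately show ?thesis
    by (intro iso_arrI[where g = "f' \<cdot> g'"]) (use category_axioms f g f' g' assms(3) in simp_all)
qed

lemma iso_arr_onAr:
  assumes "cat_functor F" "iso_arr (Src F) f" "Tgt F = T"
  shows "iso_arr T (onAr F f)"
proof -
  obtain g where "g \<in> Ar (Src F)" "dm (Src F) g = cd (Src F) f" "cd (Src F) g = dm (Src F) f"
      "g \<cdot>\<^bsub>Src F\<^esub> f = idn (Src F) (dm (Src F) f)" "f \<cdot>\<^bsub>Src F\<^esub> g = idn (Src F) (cd (Src F) f)"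
    using assms by (auto simp: iso_arr_def)
  then show ?thesis
    using functor_rules(8)[OF assms(1) refl, of f g] functor_rules(8)[OF assms(1) refl, of g f] assms
    by (intro iso_arrI[where g = "onAr F g"]) (simp_all add: iso_arr_closed)
qed

text \<open>Vertical composition is componentwise, so the components of an inverse transformation
  are inverses of the components.\<close>

lemma iso_arr_hom_Cat_at:
  assumes "iso_arr (hom_cat Cat X Y) \<alpha>" "x \<in> Ob X"
  shows "iso_arr Y (ntAt \<alpha> x)"
proof -
  have a: "nat_trans \<alpha>" "Src (nDom \<alpha>) = X" "Tgt (nDom \<alpha>) = Y"
    using assms by (auto simp: iso_arr_def)
  obtain \<beta> where b: "nat_trans \<beta>" "nDom \<beta> = nCod \<alpha>" "nCod \<beta> = nDom \<alpha>"
     "vcomp_nt \<beta> \<alpha> = id_nt (nDom \<alpha>)" "vcomp_nt \<alpha> \<beta> = id_nt (nCod \<alpha>)"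
    using assms by (auto simp: iso_arr_def)
  show ?thesis
    using a b(1-3) arg_cong[OF b(4), of "\<lambda>\<gamma>. ntAt \<gamma> x"] arg_cong[OF b(5), of "\<lambda>\<gamma>. ntAt \<gamma> x"] assms(2)
    by (intro iso_arrI[where g = "ntAt \<beta> x"]) simp_all
qed

text \<open>
  The data of a pseudonatural transformation \<open>W \<Rightarrow> V\<close> without its 2-dimensional equations. Cones over
  \<open>Cat(X, V -)\<close> are compared through their values at the objects of \<open>X\<close>, which have this form.
\<close>

record ('o, 'm, 'a, 'b, 'c, 'd) wpoint =
  p0 :: "'o \<Rightarrow> 'a \<Rightarrow> 'c"
  p1 :: "'o \<Rightarrow> 'b \<Rightarrow> 'd"
  p2 :: "'m \<Rightarrow> 'a \<Rightarrow> 'd"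

section \<open>Families of objects and arrows over a weight, and isomorphisms between them\<close>

definition is_wpoint where
  "is_wpoint D W V t \<longleftrightarrow>
     (\<forall>d\<in>Obj D. \<forall>w\<in>Ob (on0 W d). p0 t d w \<in> Ob (on0 V d)) \<and>
     (\<forall>d\<in>Obj D. \<forall>\<nu>\<in>Ar (on0 W d). p1 t d \<nu> \<in> Ar (on0 V d) \<and>
        dm (on0 V d) (p1 t d \<nu>) = p0 t d (dm (on0 W d) \<nu>) \<and>
        cd (on0 V d) (p1 t d \<nu>) = p0 t d (cd (on0 W d) \<nu>)) \<and>
     (\<forall>f\<in>Cell1 D. \<forall>w\<in>Ob (on0 W (src D f)). p2 t f w \<in> Ar (on0 V (tgt D f)) \<and>
        dm (on0 V (tgt D f)) (p2 t f w) = onOb (on1 V f) (p0 t (src D f) w) \<and>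
        cd (on0 V (tgt D f)) (p2 t f w) = p0 t (tgt D f) (onOb (on1 W f) w))"

text \<open>An invertible modification in this reduced setting: natural along the arrows of the
  weight and compatible with the structure cells, in the orientation of
  \<open>mAt_compatible\<close>.\<close>

definition wpoint_iso where
  "wpoint_iso D W V s t \<zeta> \<longleftrightarrow>
     (\<forall>d\<in>Obj D. \<forall>w\<in>Ob (on0 W d). iso_arr (on0 V d) (\<zeta> d w) \<and>
        dm (on0 V d) (\<zeta> d w) = p0 s d w \<and> cd (on0 V d) (\<zeta> d w) = p0 t d w) \<and>
     (\<forall>d\<in>Obj D. \<forall>\<nu>\<in>Ar (on0 W d).
        \<zeta> d (cd (on0 W d) \<nu>) \<cdot>\<^bsub>on0 V d\<^esub> p1 s d \<nu> = p1 t d \<nu> \<cdot>\<^bsub>on0 V d\<^esub> \<zeta> d (dm (on0 W d) \<nu>)) \<and>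
     (\<forall>f\<in>Cell1 D. \<forall>w\<in>Ob (on0 W (src D f)).
        p2 t f w \<cdot>\<^bsub>on0 V (tgt D f)\<^esub> onAr (on1 V f) (\<zeta> (src D f) w)
      = \<zeta> (tgt D f) (onOb (on1 W f) w) \<cdot>\<^bsub>on0 V (tgt D f)\<^esub> p2 s f w)"

text \<open>The fields of a family are total functions with arbitrary values outside the carriers,
  so two descriptions of one family need not be equal as records; agreement on the carriers is the
  right notion.\<close>

definition wpoint_agree where
  "wpoint_agree D W s t \<longleftrightarrow>
     (\<forall>d\<in>Obj D. \<forall>w\<in>Ob (on0 W d). p0 s d w = p0 t d w) \<and>
     (\<forall>d\<in>Obj D. \<forall>\<nu>\<in>Ar (on0 W d). p1 s d \<nu> = p1 t d \<nu>) \<and>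
     (\<forall>f\<in>Cell1 D. \<forall>w\<in>Ob (on0 W (src D f)). p2 s f w = p2 t f w)"

text \<open>Evaluation at \<open>x\<close> of a cone
  \<open>\<sigma> : W \<Rightarrow> Cat(X, V -)\<close>. The definition of \<open>point_of\<close>
  corresponds to a terminal \<open>X\<close>, with functors out of it identified with
  objects.\<close>

definition point_at where
  "point_at \<sigma> x = \<lparr>p0 = \<lambda>d w. onOb (onOb (ps0 \<sigma> d) w) x, p1 = \<lambda>d \<nu>. ntAt (onAr (ps0 \<sigma> d) \<nu>) x,
     p2 = \<lambda>f w. ntAt (ntAt (ps1 \<sigma> f) w) x\<rparr>"

definition point_of where
  "point_of \<tau> = \<lparr>p0 = \<lambda>d. onOb (ps0 \<tau> d), p1 = \<lambda>d. onAr (ps0 \<tau> d), p2 = \<lambda>f. ntAt (ps1 \<tau> f)\<rparr>"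

text \<open>What the cone \<open>image_cone\<close> becomes when evaluated at \<open>z\<close>,
  expressed directly through the cells of \<open>\<xi>\<close>.\<close>

definition image_point where
  "image_point P \<xi> z = \<lparr>p0 = \<lambda>d w. onOb (on1 P (onOb (ps0 \<xi> d) w)) z,
     p1 = \<lambda>d \<nu>. ntAt (on2 P (onAr (ps0 \<xi> d) \<nu>)) z, p2 = \<lambda>f w. ntAt (on2 P (ntAt (ps1 \<xi> f) w)) z\<rparr>"

lemma wpoint_iso_agree:
  assumes "wpoint_iso D W V s t \<zeta>" "wpoint_agree D W s s'" "wpoint_agree D W t t'"
    and "cat_valued_functor D W"
  shows "wpoint_iso D W V s' t' \<zeta>"
proof -
  interpret W: cat_valued_functor D W by fact
  show ?thesis using assms(1-3) by (simp add: wpoint_iso_def wpoint_agree_def)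
qed

lemma is_wpoint_agree:
  assumes "is_wpoint D W V s" "wpoint_agree D W s s'" "cat_valued_functor D W"
  shows "is_wpoint D W V s'"
proof -
  interpret W: cat_valued_functor D W by fact
  have *: "onOb (on1 W f) w \<in> Ob (on0 W (tgt D f))" if "f \<in> Cell1 D" "w \<in> Ob (on0 W (src D f))" for f w
    using that by simp
  show ?thesis using assms(1-2) * by (simp add: is_wpoint_def wpoint_agree_def)
qed

text \<open>Squares are pasted, along the arrows of the weight and along the 1-cells
  \<open>f\<close> of \<open>D\<close>; in the second case \<open>on1 V f\<close> has to preserve a
  composite. The assumptions \<open>is_wpoint\<close> supply the domains and codomains that
  associativity asks for.\<close>

lemma wpoint_iso_trans:
  assumes W: "cat_valued_functor D W" and V: "cat_valued_functor D V"
    and r: "is_wpoint D W V r" and s: "is_wpoint D W V s" and t: "is_wpoint D W V t"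
    and \<zeta>: "wpoint_iso D W V r s \<zeta>" and \<omega>: "wpoint_iso D W V s t \<omega>"
  shows "wpoint_iso D W V r t (\<lambda>d w. \<omega> d w \<cdot>\<^bsub>on0 V d\<^esub> \<zeta> d w)"
proof -
  interpret W: cat_valued_functor D W by fact
  interpret V: cat_valued_functor D V by fact
  note [simp] = W.dom.cell1_rules
  have [simp]: "iso_arr (on0 V d) (\<zeta> d w)" "dm (on0 V d) (\<zeta> d w) = p0 r d w"
    "cd (on0 V d) (\<zeta> d w) = p0 s d w" "\<zeta> d w \<in> Ar (on0 V d)"
    "iso_arr (on0 V d) (\<omega> d w)" "dm (on0 V d) (\<omega> d w) = p0 s d w"
    "cd (on0 V d) (\<omega> d w) = p0 t d w" "\<omega> d w \<in> Ar (on0 V d)"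
    if "d \<in> Obj D" "w \<in> Ob (on0 W d)" for d w
    using that \<zeta> \<omega> by (simp_all add: wpoint_iso_def iso_arr_closed)
  have [simp]: "p0 r d w \<in> Ob (on0 V d)" "p0 s d w \<in> Ob (on0 V d)" "p0 t d w \<in> Ob (on0 V d)"
    if "d \<in> Obj D" "w \<in> Ob (on0 W d)" for d w
    using that r s t by (simp_all add: is_wpoint_def)
  have nat: "\<zeta> d (cd (on0 W d) \<nu>) \<cdot>\<^bsub>on0 V d\<^esub> p1 r d \<nu> = p1 s d \<nu> \<cdot>\<^bsub>on0 V d\<^esub> \<zeta> d (dm (on0 W d) \<nu>)"
    "\<omega> d (cd (on0 W d) \<nu>) \<cdot>\<^bsub>on0 V d\<^esub> p1 s d \<nu> = p1 t d \<nu> \<cdot>\<^bsub>on0 V d\<^esub> \<omega> d (dm (on0 W d) \<nu>)"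
    "p1 r d \<nu> \<in> Ar (on0 V d)" "p1 s d \<nu> \<in> Ar (on0 V d)" "p1 t d \<nu> \<in> Ar (on0 V d)"
    "dm (on0 V d) (p1 r d \<nu>) = p0 r d (dm (on0 W d) \<nu>)"
    "dm (on0 V d) (p1 s d \<nu>) = p0 s d (dm (on0 W d) \<nu>)"
    "dm (on0 V d) (p1 t d \<nu>) = p0 t d (dm (on0 W d) \<nu>)"
    "cd (on0 V d) (p1 r d \<nu>) = p0 r d (cd (on0 W d) \<nu>)"
    "cd (on0 V d) (p1 s d \<nu>) = p0 s d (cd (on0 W d) \<nu>)"
    "cd (on0 V d) (p1 t d \<nu>) = p0 t d (cd (on0 W d) \<nu>)"
    if "d \<in> Obj D" "\<nu> \<in> Ar (on0 W d)" for d \<nu>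
    using that r s t \<zeta> \<omega> by (simp_all add: is_wpoint_def wpoint_iso_def)
  have str: "p2 s f w \<cdot>\<^bsub>on0 V (tgt D f)\<^esub> onAr (on1 V f) (\<zeta> (src D f) w)
      = \<zeta> (tgt D f) (onOb (on1 W f) w) \<cdot>\<^bsub>on0 V (tgt D f)\<^esub> p2 r f w"
    "p2 t f w \<cdot>\<^bsub>on0 V (tgt D f)\<^esub> onAr (on1 V f) (\<omega> (src D f) w)
      = \<omega> (tgt D f) (onOb (on1 W f) w) \<cdot>\<^bsub>on0 V (tgt D f)\<^esub> p2 s f w"
    "p2 r f w \<in> Ar (on0 V (tgt D f))" "p2 s f w \<in> Ar (on0 V (tgt D f))" "p2 t f w \<in> Ar (on0 V (tgt D f))"
    "dm (on0 V (tgt D f)) (p2 r f w) = onOb (on1 V f) (p0 r (src D f) w)"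
    "dm (on0 V (tgt D f)) (p2 s f w) = onOb (on1 V f) (p0 s (src D f) w)"
    "dm (on0 V (tgt D f)) (p2 t f w) = onOb (on1 V f) (p0 t (src D f) w)"
    "cd (on0 V (tgt D f)) (p2 r f w) = p0 r (tgt D f) (onOb (on1 W f) w)"
    "cd (on0 V (tgt D f)) (p2 s f w) = p0 s (tgt D f) (onOb (on1 W f) w)"
    "cd (on0 V (tgt D f)) (p2 t f w) = p0 t (tgt D f) (onOb (on1 W f) w)"
    if "f \<in> Cell1 D" "w \<in> Ob (on0 W (src D f))" for f w
    using that r s t \<zeta> \<omega> by (simp_all add: is_wpoint_def wpoint_iso_def)
  show ?thesis
    unfolding wpoint_iso_def
  proof (intro conjI ballI)
    fix d \<nu> assume d: "d \<in> Obj D" and \<nu>: "\<nu> \<in> Ar (on0 W d)"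
    let ?V = "on0 V d" and ?c = "cd (on0 W d) \<nu>" and ?d = "dm (on0 W d) \<nu>"
    have "(\<omega> d ?c \<cdot>\<^bsub>?V\<^esub> \<zeta> d ?c) \<cdot>\<^bsub>?V\<^esub> p1 r d \<nu> = \<omega> d ?c \<cdot>\<^bsub>?V\<^esub> (p1 s d \<nu> \<cdot>\<^bsub>?V\<^esub> \<zeta> d ?d)"
      using d \<nu> by (simp add: nat)
    also have "\<dots> = (\<omega> d ?c \<cdot>\<^bsub>?V\<^esub> p1 s d \<nu>) \<cdot>\<^bsub>?V\<^esub> \<zeta> d ?d"
      using d \<nu> by (simp add: nat(3-))
    also have "\<dots> = p1 t d \<nu> \<cdot>\<^bsub>?V\<^esub> (\<omega> d ?d \<cdot>\<^bsub>?V\<^esub> \<zeta> d ?d)"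
      using d \<nu> by (subst nat) (simp_all add: nat(3-))
    finally show "(\<omega> d ?c \<cdot>\<^bsub>?V\<^esub> \<zeta> d ?c) \<cdot>\<^bsub>?V\<^esub> p1 r d \<nu>
        = p1 t d \<nu> \<cdot>\<^bsub>?V\<^esub> (\<omega> d ?d \<cdot>\<^bsub>?V\<^esub> \<zeta> d ?d)" .
  next
    fix f w assume f: "f \<in> Cell1 D" and w: "w \<in> Ob (on0 W (src D f))"
    let ?V = "on0 V (tgt D f)" and ?d = "src D f" and ?e = "tgt D f" and ?w = "onOb (on1 W f) w"
    let ?F = "onAr (on1 V f)"
    have "p2 t f w \<cdot>\<^bsub>?V\<^esub> ?F (\<omega> ?d w \<cdot>\<^bsub>on0 V ?d\<^esub> \<zeta> ?d w)
        = (p2 t f w \<cdot>\<^bsub>?V\<^esub> ?F (\<omega> ?d w)) \<cdot>\<^bsub>?V\<^esub> ?F (\<zeta> ?d w)"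
      using f w by (simp add: str(3-))
    also have "\<dots> = \<omega> ?e ?w \<cdot>\<^bsub>?V\<^esub> (p2 s f w \<cdot>\<^bsub>?V\<^esub> ?F (\<zeta> ?d w))"
      using f w by (subst str) (simp_all add: str(3-))
    also have "\<dots> = (\<omega> ?e ?w \<cdot>\<^bsub>?V\<^esub> \<zeta> ?e ?w) \<cdot>\<^bsub>?V\<^esub> p2 r f w"
      using f w by (subst str) (simp_all add: str(3-))
    finally show "p2 t f w \<cdot>\<^bsub>?V\<^esub> ?F (\<omega> ?d w \<cdot>\<^bsub>on0 V ?d\<^esub> \<zeta> ?d w)
        = (\<omega> ?e ?w \<cdot>\<^bsub>?V\<^esub> \<zeta> ?e ?w) \<cdot>\<^bsub>?V\<^esub> p2 r f w" .
  qed (simp_all add: category.iso_arr_cmp)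
qed

section \<open>Cones read as families of cells, and their values at an object\<close>

lemma pseudonatural_ps1:
  assumes "pseudonatural D W V \<tau>" "f \<in> Cell1 D"
  shows "nat_trans (ps1 \<tau> f)"
  using pseudonatural.nat_iso_ps1[OF assms] by (simp add: nat_iso_def)

text \<open>Membership in hom-categories is unfolded into statements on cells of \<open>B\<close>.
  With \<open>B = Cat\<close> these cells are functors and transformations, ready for evaluation;
  with \<open>B = A\<close> they are the projections and the structure cells of a bilimit.\<close>

lemma cone_rules:
  assumes \<sigma>: "pseudonatural D W (comp2 (hom_from B X) F) \<sigma>" and F: "two_functor D B F"
  shows "\<lbrakk>d \<in> Obj D; w \<in> Ob (on0 W d)\<rbrakk> \<Longrightarrow>
      onOb (ps0 \<sigma> d) w \<in> Cell1 B \<and> src B (onOb (ps0 \<sigma> d) w) = X \<and>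
      tgt B (onOb (ps0 \<sigma> d) w) = on0 F d"
    and "\<lbrakk>d \<in> Obj D; \<nu> \<in> Ar (on0 W d)\<rbrakk> \<Longrightarrow>
      onAr (ps0 \<sigma> d) \<nu> \<in> Cell2 B \<and>
      src2 B (onAr (ps0 \<sigma> d) \<nu>) = onOb (ps0 \<sigma> d) (dm (on0 W d) \<nu>) \<and>
      tgt2 B (onAr (ps0 \<sigma> d) \<nu>) = onOb (ps0 \<sigma> d) (cd (on0 W d) \<nu>)"
    and "\<lbrakk>f \<in> Cell1 D; w \<in> Ob (on0 W (src D f))\<rbrakk> \<Longrightarrow>
      ntAt (ps1 \<sigma> f) w \<in> Cell2 B \<and>
      src2 B (ntAt (ps1 \<sigma> f) w) = on1 F f \<odot>\<^bsub>B\<^esub> onOb (ps0 \<sigma> (src D f)) w \<and>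
      tgt2 B (ntAt (ps1 \<sigma> f) w) = onOb (ps0 \<sigma> (tgt D f)) (onOb (on1 W f) w) \<and>
      iso_arr (hom_cat B X (on0 F (tgt D f))) (ntAt (ps1 \<sigma> f) w)"
proof -
  interpret \<sigma>: pseudonatural D W "comp2 (hom_from B X) F" \<sigma> by fact
  interpret F: two_functor D B F by fact
  interpret W: cat_valued_functor D W by (rule cat_valued_functorI[OF \<sigma>.two_functor_dom])
  note [simp] = \<sigma>.functor_ps0 \<sigma>.Src_ps0 \<sigma>.Tgt_ps0
  show 0: "onOb (ps0 \<sigma> d) w \<in> Cell1 B \<and> src B (onOb (ps0 \<sigma> d) w) = X \<and>
      tgt B (onOb (ps0 \<sigma> d) w) = on0 F d"
    if "d \<in> Obj D" "w \<in> Ob (on0 W d)" for d w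
    using functor_rules(3)[OF \<sigma>.functor_ps0[OF that(1)] refl, of w] that by simp
  show "onAr (ps0 \<sigma> d) \<nu> \<in> Cell2 B \<and>
      src2 B (onAr (ps0 \<sigma> d) \<nu>) = onOb (ps0 \<sigma> d) (dm (on0 W d) \<nu>) \<and>
      tgt2 B (onAr (ps0 \<sigma> d) \<nu>) = onOb (ps0 \<sigma> d) (cd (on0 W d) \<nu>)"
    if "d \<in> Obj D" "\<nu> \<in> Ar (on0 W d)" for d \<nu>
    using functor_rules(4-6)[OF \<sigma>.functor_ps0[OF that(1)] refl, of \<nu>] that by simp
  show "ntAt (ps1 \<sigma> f) w \<in> Cell2 B \<and>
      src2 B (ntAt (ps1 \<sigma> f) w) = on1 F f \<odot>\<^bsub>B\<^esub> onOb (ps0 \<sigma> (src D f)) w \<and>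
      tgt2 B (ntAt (ps1 \<sigma> f) w) = onOb (ps0 \<sigma> (tgt D f)) (onOb (on1 W f) w) \<and>
      iso_arr (hom_cat B X (on0 F (tgt D f))) (ntAt (ps1 \<sigma> f) w)"
    if f: "f \<in> Cell1 D" "w \<in> Ob (on0 W (src D f))" for f w
  proof -
    note n = \<sigma>.nDom_ps1[OF f(1)] \<sigma>.nCod_ps1[OF f(1)] pseudonatural_ps1[OF \<sigma> f(1)]
    have "iso_arr (hom_cat B X (on0 F (tgt D f))) (ntAt (ps1 \<sigma> f) w)"
      using \<sigma>.nat_iso_ps1[OF f(1)] f n by (simp add: nat_iso_def)
    then show ?thesis
      using nat_trans_rules(5-7)[OF n(3) refl, of w] f n 0[of "src D f" w] by simp
  qed
qed

lemma is_wpoint_point_of: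
  assumes "pseudonatural D W V \<tau>"
  shows "is_wpoint D W V (point_of \<tau>)"
proof -
  interpret \<tau>: pseudonatural D W V \<tau> by fact
  interpret W: cat_valued_functor D W by (rule cat_valued_functorI[OF \<tau>.two_functor_dom])
  interpret V: cat_valued_functor D V by (rule cat_valued_functorI[OF \<tau>.two_functor_cod])
  note [simp] = \<tau>.functor_ps0 \<tau>.Src_ps0 \<tau>.Tgt_ps0 \<tau>.nDom_ps1 \<tau>.nCod_ps1 pseudonatural_ps1[OF assms]
  show ?thesis
    by (simp add: is_wpoint_def point_of_def)
qed

lemma is_wpoint_point_at:
  assumes \<sigma>: "pseudonatural D W (comp2 (hom_from Cat X) V) \<sigma>" and V: "cat_valued_functor D V"
    and x: "x \<in> Ob X"
  shows "is_wpoint D W V (point_at \<sigma> x)"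
proof -
  interpret \<sigma>: pseudonatural D W "comp2 (hom_from Cat X) V" \<sigma> by fact
  interpret W: cat_valued_functor D W by (rule cat_valued_functorI[OF \<sigma>.two_functor_dom])
  interpret V: cat_valued_functor D V by fact
  note [simp] = cone_rules[OF \<sigma> V.two_functor_axioms, simplified]
  show ?thesis using x
    by (simp add: is_wpoint_def point_at_def)
qed

lemma Hom_p_simps [simp]:
  "Ob (Hom_p D W V) = {\<tau>. pseudonatural D W V \<tau>}" "Ar (Hom_p D W V) = {\<rho>. modification D W V \<rho>}"
  "dm (Hom_p D W V) = mDom" "cd (Hom_p D W V) = mCod"
  "d \<in> Obj D \<Longrightarrow> mAt (idn (Hom_p D W V) \<tau>) d = id_nt (ps0 \<tau> d)"
  "d \<in> Obj D \<Longrightarrow> mAt (\<rho>' \<cdot>\<^bsub>Hom_p D W V\<^esub> \<rho>) d = vcomp_nt (mAt \<rho>' d) (mAt \<rho> d)"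
  by (simp_all add: Hom_p_def)

text \<open>Modifications compose componentwise at each \<open>d\<close>, and natural
  transformations at each \<open>w\<close>, so an inverse modification yields an inverse arrow at
  \<open>d\<close> and \<open>w\<close>.\<close>

lemma iso_modification_at:
  assumes \<rho>: "iso_arr (Hom_p D W V) \<rho>" and d: "d \<in> Obj D" and w: "w \<in> Ob (on0 W d)"
  shows "iso_arr (on0 V d) (ntAt (mAt \<rho> d) w)"
proof -
  obtain \<rho>' where r: "modification D W V \<rho>" "modification D W V \<rho>'" "mDom \<rho>' = mCod \<rho>" "mCod \<rho>' = mDom \<rho>"
    "\<rho>' \<cdot>\<^bsub>Hom_p D W V\<^esub> \<rho> = idn (Hom_p D W V) (mDom \<rho>)"
    "\<rho> \<cdot>\<^bsub>Hom_p D W V\<^esub> \<rho>' = idn (Hom_p D W V) (mCod \<rho>)"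
    using \<rho> by (auto simp: iso_arr_def)
  interpret m: modification D W V \<rho> by fact
  interpret m': modification D W V \<rho>' by fact
  have n: "nat_trans (mAt \<rho> d)" "nat_trans (mAt \<rho>' d)"
    "nDom (mAt \<rho> d) = ps0 (mDom \<rho>) d" "nCod (mAt \<rho> d) = ps0 (mCod \<rho>) d"
    "nDom (mAt \<rho>' d) = ps0 (mCod \<rho>) d" "nCod (mAt \<rho>' d) = ps0 (mDom \<rho>) d"
    using m.nat_trans_mAt m.nDom_mAt m.nCod_mAt m'.nat_trans_mAt m'.nDom_mAt m'.nCod_mAt d r by simp_all
  have s: "Src (ps0 (mDom \<rho>) d) = on0 W d" "Tgt (ps0 (mDom \<rho>) d) = on0 V d"
     "Src (ps0 (mCod \<rho>) d) = on0 W d" "Tgt (ps0 (mCod \<rho>) d) = on0 V d"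
    using pseudonatural.Src_ps0[OF m.pseudonatural_mDom d] pseudonatural.Tgt_ps0[OF m.pseudonatural_mDom d]
      pseudonatural.Src_ps0[OF m.pseudonatural_mCod d] pseudonatural.Tgt_ps0[OF m.pseudonatural_mCod d]
    by simp_all
  have "vcomp_nt (mAt \<rho>' d) (mAt \<rho> d) = id_nt (ps0 (mDom \<rho>) d)"
    "vcomp_nt (mAt \<rho> d) (mAt \<rho>' d) = id_nt (ps0 (mCod \<rho>) d)"
    using arg_cong[OF r(5), of "\<lambda>\<rho>. mAt \<rho> d"] arg_cong[OF r(6), of "\<lambda>\<rho>. mAt \<rho> d"] d by simp_all
  from this[THEN arg_cong, of "\<lambda>\<alpha>. ntAt \<alpha> w"] show ?thesis
    using n s w by (intro iso_arrI[where g = "ntAt (mAt \<rho>' d) w"]) simp_all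
qed

text \<open>Each law of a modification into \<open>Cat(X, V -)\<close> is an equation between
  natural transformations of functors on \<open>X\<close>; taking components at \<open>x\<close>
  gives the law required of the family.\<close>

lemma wpoint_iso_modification:
  assumes \<rho>: "iso_arr (Hom_p D W (comp2 (hom_from Cat X) V)) \<rho>" and V: "cat_valued_functor D V"
    and x: "x \<in> Ob X"
  shows "wpoint_iso D W V (point_at (mDom \<rho>) x) (point_at (mCod \<rho>) x) (\<lambda>d w. ntAt (ntAt (mAt \<rho> d) w) x)"
proof -
  have m: "modification D W (comp2 (hom_from Cat X) V) \<rho>" using \<rho> by (simp add: iso_arr_def)
  interpret m: modification D W "comp2 (hom_from Cat X) V" \<rho> by fact
  interpret S: pseudonatural D W "comp2 (hom_from Cat X) V" "mDom \<rho>" by (rule m.pseudonatural_mDom)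
  interpret T: pseudonatural D W "comp2 (hom_from Cat X) V" "mCod \<rho>" by (rule m.pseudonatural_mCod)
  interpret W: cat_valued_functor D W by (rule cat_valued_functorI[OF S.two_functor_dom])
  interpret V: cat_valued_functor D V by fact
  note sr [simp] = cone_rules[OF S.pseudonatural_axioms V.two_functor_axioms, simplified]
  note tr [simp] = cone_rules[OF T.pseudonatural_axioms V.two_functor_axioms, simplified]
  have mat [simp]: "nat_trans (ntAt (mAt \<rho> d) w)"
    "nDom (ntAt (mAt \<rho> d) w) = onOb (ps0 (mDom \<rho>) d) w"
    "nCod (ntAt (mAt \<rho> d) w) = onOb (ps0 (mCod \<rho>) d) w"
    if "d \<in> Obj D" "w \<in> Ob (on0 W d)" for d w
    using nat_trans_rules(5-7)[OF m.nat_trans_mAt[OF that(1)] refl, of w] that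
    by (simp_all add: m.nDom_mAt m.nCod_mAt S.Src_ps0 S.Tgt_ps0)
  show ?thesis
    unfolding wpoint_iso_def
  proof (intro conjI ballI)
    fix d w assume d: "d \<in> Obj D" "w \<in> Ob (on0 W d)"
    show "iso_arr (on0 V d) (ntAt (ntAt (mAt \<rho> d) w) x)"
      using iso_arr_hom_Cat_at[OF _ x, of "on0 V d"] iso_modification_at[OF \<rho> d] by simp
    show "dm (on0 V d) (ntAt (ntAt (mAt \<rho> d) w) x) = p0 (point_at (mDom \<rho>) x) d w"
      "cd (on0 V d) (ntAt (ntAt (mAt \<rho> d) w) x) = p0 (point_at (mCod \<rho>) x) d w"
      using d x by (simp_all add: point_at_def)
  next
    fix d \<nu> assume d: "d \<in> Obj D" and \<nu>: "\<nu> \<in> Ar (on0 W d)"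
    have "vcomp_nt (ntAt (mAt \<rho> d) (cd (on0 W d) \<nu>)) (onAr (ps0 (mDom \<rho>) d) \<nu>)
        = vcomp_nt (onAr (ps0 (mCod \<rho>) d) \<nu>) (ntAt (mAt \<rho> d) (dm (on0 W d) \<nu>))"
      using nat_trans_naturality[OF m.nat_trans_mAt[OF d] refl refl, of \<nu>] d \<nu>
      by (simp add: m.nDom_mAt m.nCod_mAt S.Src_ps0 S.Tgt_ps0)
    from arg_cong[OF this, of "\<lambda>\<alpha>. ntAt \<alpha> x"]
    show "ntAt (ntAt (mAt \<rho> d) (cd (on0 W d) \<nu>)) x \<cdot>\<^bsub>on0 V d\<^esub> p1 (point_at (mDom \<rho>) x) d \<nu>
        = p1 (point_at (mCod \<rho>) x) d \<nu> \<cdot>\<^bsub>on0 V d\<^esub> ntAt (ntAt (mAt \<rho> d) (dm (on0 W d) \<nu>)) x"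
      using d \<nu> x by (simp add: point_at_def)
  next
    fix f w assume f: "f \<in> Cell1 D" "w \<in> Ob (on0 W (src D f))"
    have "vcomp_nt (ntAt (ps1 (mCod \<rho>) f) w) (hcomp_nt (id_nt (on1 V f)) (ntAt (mAt \<rho> (src D f)) w))
        = vcomp_nt (ntAt (mAt \<rho> (tgt D f)) (onOb (on1 W f) w)) (ntAt (ps1 (mDom \<rho>) f) w)"
      using m.mAt_compatible[OF f] f by simp
    from arg_cong[OF this, of "\<lambda>\<alpha>. ntAt \<alpha> x"]
    show "p2 (point_at (mCod \<rho>) x) f w \<cdot>\<^bsub>on0 V (tgt D f)\<^esub>
           onAr (on1 V f) (ntAt (ntAt (mAt \<rho> (src D f)) w) x)
         = ntAt (ntAt (mAt \<rho> (tgt D f)) (onOb (on1 W f) w)) x \<cdot>\<^bsub>on0 V (tgt D f)\<^esub>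
           p2 (point_at (mDom \<rho>) x) f w"
      using f x by (simp add: point_at_def)
  qed
qed

text \<open>The 2-cells of the cone are natural transformations between functors on
  \<open>X\<close>, and their naturality at \<open>e\<close> is exactly the compatibility to be
  shown.\<close>

lemma wpoint_iso_point_at:
  assumes \<sigma>: "pseudonatural D W (comp2 (hom_from Cat X) V) \<sigma>" and V: "cat_valued_functor D V"
    and e: "iso_arr X e" and X: "category X"
  shows "wpoint_iso D W V (point_at \<sigma> (dm X e)) (point_at \<sigma> (cd X e)) (\<lambda>d w. onAr (onOb (ps0 \<sigma> d) w) e)"
proof -
  interpret \<sigma>: pseudonatural D W "comp2 (hom_from Cat X) V" \<sigma> by fact
  interpret W: cat_valued_functor D W by (rule cat_valued_functorI[OF \<sigma>.two_functor_dom])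
  interpret V: cat_valued_functor D V by fact
  note [simp] = cone_rules[OF \<sigma> V.two_functor_axioms, simplified]
  have [simp]: "e \<in> Ar X" "category X" using e X by (simp_all add: iso_arr_closed)
  show ?thesis
    unfolding wpoint_iso_def
  proof (intro conjI ballI)
    fix d w assume d: "d \<in> Obj D" "w \<in> Ob (on0 W d)"
    then show "iso_arr (on0 V d) (onAr (onOb (ps0 \<sigma> d) w) e)"
      "dm (on0 V d) (onAr (onOb (ps0 \<sigma> d) w) e) = p0 (point_at \<sigma> (dm X e)) d w"
      "cd (on0 V d) (onAr (onOb (ps0 \<sigma> d) w) e) = p0 (point_at \<sigma> (cd X e)) d w"
      using e by (simp_all add: point_at_def iso_arr_onAr)
  next
    fix d \<nu> assume d: "d \<in> Obj D" and \<nu>: "\<nu> \<in> Ar (on0 W d)"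
    show "onAr (onOb (ps0 \<sigma> d) (cd (on0 W d) \<nu>)) e \<cdot>\<^bsub>on0 V d\<^esub> p1 (point_at \<sigma> (dm X e)) d \<nu>
        = p1 (point_at \<sigma> (cd X e)) d \<nu> \<cdot>\<^bsub>on0 V d\<^esub> onAr (onOb (ps0 \<sigma> d) (dm (on0 W d) \<nu>)) e"
      using nat_trans_naturality[of "onAr (ps0 \<sigma> d) \<nu>" X "on0 V d" e] d \<nu> by (simp add: point_at_def)
  next
    fix f w assume f: "f \<in> Cell1 D" "w \<in> Ob (on0 W (src D f))"
    show "p2 (point_at \<sigma> (cd X e)) f w \<cdot>\<^bsub>on0 V (tgt D f)\<^esub> onAr (on1 V f) (onAr (onOb (ps0 \<sigma> (src D f)) w) e)
        = onAr (onOb (ps0 \<sigma> (tgt D f)) (onOb (on1 W f) w)) e \<cdot>\<^bsub>on0 V (tgt D f)\<^esub> p2 (point_at \<sigma> (dm X e)) f w"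
      using nat_trans_naturality[of "ntAt (ps1 \<sigma> f) w" X "on0 V (tgt D f)" e] f by (simp add: point_at_def)
  qed
qed

text \<open>Restriction along \<open>k\<close> is precomposition, so evaluation at \<open>z\<close>
  after it is evaluation of \<open>\<eta>\<close> at \<open>k z\<close>.\<close>

lemma point_at_cone_restrict:
  assumes \<eta>: "pseudonatural D W (comp2 (hom_from Cat M) V) \<eta>" and V: "cat_valued_functor D V"
    and k: "cat_functor k" "Tgt k = M" and z: "z \<in> Ob (Src k)"
  shows "wpoint_agree D W (point_at (cone_restrict Cat D V \<eta> k) z) (point_at \<eta> (onOb k z))"
proof -
  interpret \<eta>: pseudonatural D W "comp2 (hom_from Cat M) V" \<eta> by fact
  interpret W: cat_valued_functor D W by (rule cat_valued_functorI[OF \<eta>.two_functor_dom])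
  interpret V: cat_valued_functor D V by fact
  note [simp] = cone_rules[OF \<eta> V.two_functor_axioms, simplified] \<eta>.Src_ps0 \<eta>.nDom_ps1
  show ?thesis using k z
    by (simp add: wpoint_agree_def point_at_def cone_restrict_def cat_functor_comp_func)
qed

lemma point_at_image_cone:
  assumes \<xi>: "pseudonatural D W (comp2 (hom_from A L) F) \<xi>" and F: "two_functor D A F"
  shows "wpoint_agree D W (point_at (image_cone A Cat P D F L \<xi>) z) (image_point P \<xi> z)"
proof -
  interpret \<xi>: pseudonatural D W "comp2 (hom_from A L) F" \<xi> by fact
  interpret F: two_functor D A F by fact
  interpret A: two_category A by (rule F.cod_two_category)
  interpret W: cat_valued_functor D W by (rule cat_valued_functorI[OF \<xi>.two_functor_dom])
  note [simp] = cone_rules[OF \<xi> F, simplified] \<xi>.Src_ps0 \<xi>.nDom_ps1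
  show ?thesis
    by (simp add: wpoint_agree_def point_at_def image_point_def image_cone_def)
qed

section \<open>Constant cones and left exact 2-functors\<close>

definition const_func :: "('o, 'a) cat \<Rightarrow> ('p, 'b) cat \<Rightarrow> 'p \<Rightarrow> ('o, 'a, 'p, 'b) func" where
  "const_func X C c = \<lparr>Src = X, Tgt = C, onOb = (\<lambda>x\<in>Ob X. c), onAr = (\<lambda>f\<in>Ar X. idn C c)\<rparr>"

definition const_nt :: "('o, 'a) cat \<Rightarrow> ('p, 'b) cat \<Rightarrow> 'b \<Rightarrow> ('o, 'a, 'p, 'b) nattrans" where
  "const_nt X C \<phi> = \<lparr>nDom = const_func X C (dm C \<phi>), nCod = const_func X C (cd C \<phi>),
     ntAt = (\<lambda>x\<in>Ob X. \<phi>)\<rparr>"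

text \<open>The diagonal functor \<open>C \<rightarrow> Cat(X, C)\<close>.\<close>

definition const_emb where
  "const_emb X C = \<lparr>Src = C, Tgt = hom_cat Cat X C, onOb = (\<lambda>c\<in>Ob C. const_func X C c),
     onAr = (\<lambda>\<phi>\<in>Ar C. const_nt X C \<phi>)\<rparr>"

text \<open>Whiskering with the diagonals makes \<open>\<tau> : W \<Rightarrow> V\<close> a cone
  with vertex \<open>X\<close>, to which the universal property of a bilimit in \<open>Cat\<close>
  can be applied.\<close>

definition const_cone where
  "const_cone X D V \<tau> =
     \<lparr>ps0 = (\<lambda>d\<in>Obj D. comp_func (const_emb X (on0 V d)) (ps0 \<tau> d)),
      ps1 = (\<lambda>f\<in>Cell1 D. whisker_left (const_emb X (on0 V (tgt D f))) (ps1 \<tau> f))\<rparr>"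

lemma const_func_simps [simp]:
  "Src (const_func X C c) = X" "Tgt (const_func X C c) = C"
  "x \<in> Ob X \<Longrightarrow> onOb (const_func X C c) x = c" "f \<in> Ar X \<Longrightarrow> onAr (const_func X C c) f = idn C c"
  by (simp_all add: const_func_def)

lemma const_nt_simps [simp]:
  "nDom (const_nt X C \<phi>) = const_func X C (dm C \<phi>)" "nCod (const_nt X C \<phi>) = const_func X C (cd C \<phi>)"
  "x \<in> Ob X \<Longrightarrow> ntAt (const_nt X C \<phi>) x = \<phi>"
  by (simp_all add: const_nt_def)

lemma const_emb_simps [simp]:
  "Src (const_emb X C) = C" "Tgt (const_emb X C) = hom_cat Cat X C"
  "c \<in> Ob C \<Longrightarrow> onOb (const_emb X C) c = const_func X C c"
  "\<phi> \<in> Ar C \<Longrightarrow> onAr (const_emb X C) \<phi> = const_nt X C \<phi>"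
  by (simp_all add: const_emb_def)

lemma cat_functor_const_func: "category X \<Longrightarrow> category C \<Longrightarrow> c \<in> Ob C \<Longrightarrow> cat_functor (const_func X C c)"
  by (rule cat_functor.intro) (simp_all, simp_all add: const_func_def)

lemma nat_trans_const_nt: "category X \<Longrightarrow> category C \<Longrightarrow> \<phi> \<in> Ar C \<Longrightarrow> nat_trans (const_nt X C \<phi>)"
  by (rule nat_trans.intro) (simp_all add: cat_functor_const_func, simp_all add: const_nt_def)

lemma category_hom_Cat: "category (hom_cat Cat X C)"
  by (rule two_category.category_hom_cat[OF two_category_Cat])

lemmas two_functor_hom_from_Cat = two_category.two_functor_hom_from[OF two_category_Cat]

lemma cat_functor_postcomp_Cat: "cat_functor f \<Longrightarrow> cat_functor (postcomp Cat X f)"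
  by (rule two_category.cat_functor_postcomp[OF two_category_Cat]) simp

lemma cat_functor_const_emb:
  assumes "category X" "category C" shows "cat_functor (const_emb X C)"
proof (rule cat_functor.intro)
  fix c assume "c \<in> Ob (Src (const_emb X C))"
  then show "onAr (const_emb X C) (idn (Src (const_emb X C)) c)
      = idn (Tgt (const_emb X C)) (onOb (const_emb X C) c)"
    using assms by (simp, intro nattrans_eqI) (simp_all add: nat_trans_const_nt nat_trans_id_nt cat_functor_const_func)
next
  fix \<phi> \<psi> assume "\<phi> \<in> Ar (Src (const_emb X C))" "\<psi> \<in> Ar (Src (const_emb X C))"
    "cd (Src (const_emb X C)) \<phi> = dm (Src (const_emb X C)) \<psi>"
  then show "onAr (const_emb X C) (\<psi> \<cdot>\<^bsub>Src (const_emb X C)\<^esub> \<phi>)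
      = onAr (const_emb X C) \<psi> \<cdot>\<^bsub>Tgt (const_emb X C)\<^esub> onAr (const_emb X C) \<phi>"
    using assms by (simp, intro nattrans_eqI) (simp_all add: nat_trans_const_nt nat_trans_vcomp_nt)
qed (use assms in \<open>simp_all add: category_hom_Cat cat_functor_const_func nat_trans_const_nt\<close>,
    simp_all add: const_emb_def)

lemma postcomp_const:
  assumes F: "cat_functor F" and X: "category X" and C: "Src F = C" "Tgt F = C'"
  shows "c \<in> Ob C \<Longrightarrow> comp_func F (const_func X C c) = const_func X C' (onOb F c)"
    and "\<phi> \<in> Ar C \<Longrightarrow> hcomp_nt (id_nt F) (const_nt X C \<phi>) = const_nt X C' (onAr F \<phi>)"
proof -
  have [simp]: "category C" "category C'" using F C by auto
  show *: "comp_func F (const_func X C c) = const_func X C' (onOb F c)" if "c \<in> Ob C" for c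
    using assms that by (intro func_eqI) (simp_all add: cat_functor_comp_func cat_functor_const_func)
  show "hcomp_nt (id_nt F) (const_nt X C \<phi>) = const_nt X C' (onAr F \<phi>)" if "\<phi> \<in> Ar C"
    using assms that by (intro nattrans_eqI)
      (simp_all add: * nat_trans_hcomp_nt nat_trans_const_nt nat_trans_id_nt)
qed

text \<open>The diagonal is strictly natural in \<open>C\<close>. For this reason the whiskered
  structure cells of \<open>\<tau>\<close> already have the source demanded of a cone, and no
  coherence cell has to be inserted.\<close>

lemma postcomp_const_emb:
  assumes F: "cat_functor F" and X: "category X" and C: "Src F = C" "Tgt F = C'"
  shows "comp_func (postcomp Cat X F) (const_emb X C) = comp_func (const_emb X C') F"
proof -
  have [simp]: "category C" "category C'" using F C by auto
  show ?thesis
    using assms by (intro func_eqI) (simp_all add: cat_functor_comp_func cat_functor_postcomp_Cat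
        cat_functor_const_emb cat_functor_const_func nat_trans_const_nt postcomp_const)
qed

lemma hcomp_id_const_func:
  assumes \<theta>: "nat_trans \<theta>" and X: "category X" and C: "Src (nDom \<theta>) = C" "Tgt (nDom \<theta>) = C'" and c: "c \<in> Ob C"
  shows "hcomp_nt \<theta> (id_nt (const_func X C c)) = const_nt X C' (ntAt \<theta> c)"
proof -
  have "category C" "category C'" using functor_rules(1,2)[OF nat_trans_rules(1)[OF \<theta>]] C by simp_all
  then show ?thesis
    using assms by (intro nattrans_eqI) (simp_all add: postcomp_const nat_trans_hcomp_nt nat_trans_id_nt
       nat_trans_const_nt cat_functor_const_func)
qed

lemma nat_iso_whisker_left:
  assumes \<alpha>: "nat_iso \<alpha>" and H: "cat_functor H" "Tgt (nDom \<alpha>) = Src H"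
  shows "nat_iso (whisker_left H \<alpha>)"
proof -
  have n: "nat_trans \<alpha>" using \<alpha> by (simp add: nat_iso_def)
  have "nat_trans (whisker_left H \<alpha>)"
  proof (rule nat_trans.intro)
    fix f assume "f \<in> Ar (Src (nDom (whisker_left H \<alpha>)))"
    then have f: "f \<in> Ar (Src (nDom \<alpha>))" by simp
    let ?S = "Src (nDom \<alpha>)"
    have "onAr H (ntAt \<alpha> (cd ?S f)) \<cdot>\<^bsub>Tgt H\<^esub> onAr H (onAr (nDom \<alpha>) f)
        = onAr H (ntAt \<alpha> (cd ?S f) \<cdot>\<^bsub>Src H\<^esub> onAr (nDom \<alpha>) f)"
      using f n H by simp
    also have "\<dots> = onAr H (onAr (nCod \<alpha>) f) \<cdot>\<^bsub>Tgt H\<^esub> onAr H (ntAt \<alpha> (dm ?S f))"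
      using f n H nat_trans_naturality[OF n refl H(2) f] by simp
    finally show "ntAt (whisker_left H \<alpha>) (cd (Src (nDom (whisker_left H \<alpha>))) f)
          \<cdot>\<^bsub>Tgt (nDom (whisker_left H \<alpha>))\<^esub> onAr (nDom (whisker_left H \<alpha>)) f
        = onAr (nCod (whisker_left H \<alpha>)) f
          \<cdot>\<^bsub>Tgt (nDom (whisker_left H \<alpha>))\<^esub> ntAt (whisker_left H \<alpha>) (dm (Src (nDom (whisker_left H \<alpha>))) f)"
      using f n by simp
  qed (use n H in \<open>simp_all add: cat_functor_comp_func\<close>, simp add: whisker_left_def)
  then show ?thesis
    using assms by (simp add: nat_iso_def iso_arr_onAr)
qed

text \<open>Each law is the image of the corresponding law of \<open>\<tau>\<close> under the
  diagonal, which is functorial and strictly natural.\<close>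

lemma pseudonatural_const_cone:
  assumes \<tau>: "pseudonatural D W V \<tau>" and X: "category X"
  shows "pseudonatural D W (comp2 (hom_from Cat X) V) (const_cone X D V \<tau>)"
proof -
  interpret \<tau>: pseudonatural D W V \<tau> by fact
  interpret W: cat_valued_functor D W by (rule cat_valued_functorI[OF \<tau>.two_functor_dom])
  interpret V: cat_valued_functor D V by (rule cat_valued_functorI[OF \<tau>.two_functor_cod])
  note [simp] = \<tau>.functor_ps0 \<tau>.Src_ps0 \<tau>.Tgt_ps0 \<tau>.nDom_ps1 \<tau>.nCod_ps1 pseudonatural_ps1[OF \<tau>] X
  have [simp]: "ps0 (const_cone X D V \<tau>) d = comp_func (const_emb X (on0 V d)) (ps0 \<tau> d)" if "d \<in> Obj D" for d
    using that by (simp add: const_cone_def)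
  have [simp]: "ps1 (const_cone X D V \<tau>) f = whisker_left (const_emb X (on0 V (tgt D f))) (ps1 \<tau> f)"
    if "f \<in> Cell1 D" for f
    using that by (simp add: const_cone_def)
  show ?thesis
  proof (rule pseudonatural.intro)
    show "two_functor D Cat (comp2 (hom_from Cat X) V)"
      by (rule two_functor_comp2[OF V.two_functor_axioms two_functor_hom_from_Cat])
    fix f assume f: "f \<in> Cell1 D"
    show "nat_iso (ps1 (const_cone X D V \<tau>) f)"
      using f \<tau>.nat_iso_ps1[OF f] by (simp add: nat_iso_whisker_left cat_functor_const_emb)
    have "comp_func (const_emb X (on0 V (tgt D f))) (comp_func (on1 V f) (ps0 \<tau> (src D f)))
        = comp_func (comp_func (const_emb X (on0 V (tgt D f))) (on1 V f)) (ps0 \<tau> (src D f))"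
      using f by (subst comp_func_assoc) (simp_all add: cat_functor_const_emb)
    also have "\<dots> = comp_func (comp_func (postcomp Cat X (on1 V f)) (const_emb X (on0 V (src D f)))) (ps0 \<tau> (src D f))"
      using f by (subst postcomp_const_emb) simp_all
    also have "\<dots> = comp_func (postcomp Cat X (on1 V f)) (comp_func (const_emb X (on0 V (src D f))) (ps0 \<tau> (src D f)))"
      using f by (subst comp_func_assoc) (simp_all add: cat_functor_const_emb cat_functor_postcomp_Cat)
    finally show "nDom (ps1 (const_cone X D V \<tau>) f)
        = comp_func (on1 (comp2 (hom_from Cat X) V) f) (ps0 (const_cone X D V \<tau>) (src D f))"
      using f by simp
    show "nCod (ps1 (const_cone X D V \<tau>) f) = comp_func (ps0 (const_cone X D V \<tau>) (tgt D f)) (on1 W f)"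
      using f by (simp add: comp_func_assoc cat_functor_const_emb)
  next
    fix d assume "d \<in> Obj D"
    then show "ps1 (const_cone X D V \<tau>) (id1 D d) = id_nt (ps0 (const_cone X D V \<tau>) d)"
      using nat_iso_whisker_left[OF \<tau>.nat_iso_ps1, of "id1 D d" "const_emb X (on0 V d)"]
      by (simp add: \<tau>.ps1_id1, intro nattrans_eqI)
        (auto simp: nat_iso_def cat_functor_const_emb nat_trans_id_nt cat_functor_comp_func cat_functor_const_func)
  next
    fix f g w assume "f \<in> Cell1 D" "g \<in> Cell1 D" "tgt D f = src D g" "w \<in> Ob (on0 W (src D f))"
    moreover from this have "onOb (on1 W f) w \<in> Ob (on0 W (src D g))" by simp
    ultimately show "ntAt (ps1 (const_cone X D V \<tau>) (g \<odot>\<^bsub>D\<^esub> f)) w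
            = ntAt (ps1 (const_cone X D V \<tau>) g) (onOb (on1 W f) w)
              \<cdot>\<^bsub>on0 (comp2 (hom_from Cat X) V) (tgt D g)\<^esub>
              onAr (on1 (comp2 (hom_from Cat X) V) g) (ntAt (ps1 (const_cone X D V \<tau>) f) w)"
      using functor_rules(8)[OF cat_functor_const_emb[OF X, of "on0 V (tgt D g)"] refl,
          of "onAr (on1 V g) (ntAt (ps1 \<tau> f) w)" "ntAt (ps1 \<tau> g) (onOb (on1 W f) w)"]
      by (simp add: \<tau>.ps1_comp1 postcomp_const nat_trans_const_nt cat_functor_const_func)
  next
    fix \<theta> w assume a: "\<theta> \<in> Cell2 D" "w \<in> Ob (on0 W (src D (src2 D \<theta>)))"
    let ?s = "src D (src2 D \<theta>)" and ?t = "tgt D (src2 D \<theta>)"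
    have "const_nt X (on0 V ?t) (ntAt (ps1 \<tau> (tgt2 D \<theta>)) w \<cdot>\<^bsub>on0 V ?t\<^esub> ntAt (on2 V \<theta>) (onOb (ps0 \<tau> ?s) w))
       = const_nt X (on0 V ?t) (onAr (ps0 \<tau> (tgt D (src2 D \<theta>))) (ntAt (on2 W \<theta>) w)
              \<cdot>\<^bsub>on0 V ?t\<^esub> ntAt (ps1 \<tau> (src2 D \<theta>)) w)"
      using \<tau>.ps1_natural[OF a] by simp
    then show "ntAt (ps1 (const_cone X D V \<tau>) (tgt2 D \<theta>)) w
          \<cdot>\<^bsub>on0 (comp2 (hom_from Cat X) V) ?t\<^esub> ntAt (on2 (comp2 (hom_from Cat X) V) \<theta>) (onOb (ps0 (const_cone X D V \<tau>) ?s) w)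
        = onAr (ps0 (const_cone X D V \<tau>) ?t) (ntAt (on2 W \<theta>) w)
          \<cdot>\<^bsub>on0 (comp2 (hom_from Cat X) V) ?t\<^esub> ntAt (ps1 (const_cone X D V \<tau>) (src2 D \<theta>)) w"
      using a functor_rules(8)[OF cat_functor_const_emb[OF X, of "on0 V ?t"] refl,
          of "ntAt (on2 V \<theta>) (onOb (ps0 \<tau> ?s) w)" "ntAt (ps1 \<tau> (tgt2 D \<theta>)) w"]
        functor_rules(8)[OF cat_functor_const_emb[OF X, of "on0 V ?t"] refl,
          of "ntAt (ps1 \<tau> (src2 D \<theta>)) w" "onAr (ps0 \<tau> ?t) (ntAt (on2 W \<theta>) w)"]
      by (simp add: hcomp_id_const_func cat_functor_const_func)
  qed (simp_all add: \<tau>.two_functor_dom cat_functor_comp_func cat_functor_const_emb, simp_all add: const_cone_def)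
qed

lemma point_at_const_cone:
  assumes \<tau>: "pseudonatural D W V \<tau>" and x: "x \<in> Ob X"
  shows "wpoint_agree D W (point_at (const_cone X D V \<tau>) x) (point_of \<tau>)"
proof -
  interpret \<tau>: pseudonatural D W V \<tau> by fact
  interpret W: cat_valued_functor D W by (rule cat_valued_functorI[OF \<tau>.two_functor_dom])
  interpret V: cat_valued_functor D V by (rule cat_valued_functorI[OF \<tau>.two_functor_cod])
  note [simp] = \<tau>.functor_ps0 \<tau>.Src_ps0 \<tau>.Tgt_ps0 \<tau>.nDom_ps1 \<tau>.nCod_ps1 pseudonatural_ps1[OF \<tau>]
  show ?thesis using x
    by (simp add: wpoint_agree_def point_at_def point_of_def const_cone_def)
qed

text \<open>A quasi-inverse applied to \<open>y\<close> gives the object, and the component of the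
  counit at \<open>y\<close> gives the isomorphism.\<close>

lemma equivalence_ess_surj:
  assumes "is_equivalence F" "y \<in> Ob (Tgt F)"
  obtains x \<epsilon> where "x \<in> Ob (Src F)" "iso_arr (Tgt F) \<epsilon>" "dm (Tgt F) \<epsilon> = onOb F x" "cd (Tgt F) \<epsilon> = y"
proof -
  obtain G \<epsilon> where *: "cat_functor G" "Src G = Tgt F" "Tgt G = Src F" "nat_iso \<epsilon>"
     "nDom \<epsilon> = comp_func F G" "nCod \<epsilon> = id_func (Tgt F)"
    using assms(1) by (auto simp: is_equivalence_def)
  show thesis
    by (rule that[of "onOb G y" "ntAt \<epsilon> y"])
      (use * assms(2) nat_trans_rules(6,7)[of \<epsilon> "Tgt F" y] in \<open>simp_all add: nat_iso_def\<close>)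
qed

lemma cone_functor_simps [simp]:
  "Src (cone_functor B D W F L \<xi> X) = hom_cat B X L"
  "Tgt (cone_functor B D W F L \<xi> X) = Hom_p D W (comp2 (hom_from B X) F)"
  "u \<in> Ob (hom_cat B X L) \<Longrightarrow> onOb (cone_functor B D W F L \<xi> X) u = cone_restrict B D F \<xi> u"
  by (simp_all add: cone_functor_def)

text \<open>Three isomorphisms of families are composed. The comparison leads from the image cone at
  \<open>z\<close> to \<open>\<eta>\<close> at \<open>k z\<close>; the counit of the equivalence
  \<open>k\<close> leads on to \<open>\<eta>\<close> at \<open>m\<close>; the universal property of
  \<open>M\<close> leads from there to \<open>\<tau>\<close>. It is that property which supplies
  \<open>m\<close>, and \<open>z\<close> is the value at \<open>m\<close> of a quasi-inverse of
  \<open>k\<close>.\<close>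

lemma left_exact_point:
  fixes P :: "('o, 'm, 'n, 'c, 'a) cat_valued"
  assumes P: "two_functor A Cat P" and lex: "left_exact A Cat P"
    and W: "finite_weight D W" and F: "two_functor D A F" and \<xi>: "is_bilimit A D W F L \<xi>"
    and \<tau>: "pseudonatural D W (comp2 P F) \<tau>"
  obtains z \<zeta> where "z \<in> Ob (on0 P L)" "wpoint_iso D W (comp2 P F) (image_point P \<xi> z) (point_of \<tau>) \<zeta>"
proof -
  let ?V = "comp2 P F"
  obtain M \<eta> k where M: "is_bilimit Cat D W ?V M \<eta>"
    and k: "is_comparison Cat D W ?V M \<eta> (on0 P L) (image_cone A Cat P D F L \<xi>) k" "equivalence1 Cat k"
    using lex W F \<xi> unfolding left_exact_def by blast
  interpret V: cat_valued_functor D ?V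
    by (rule cat_valued_functorI[OF two_functor_comp2[OF F P]])
  interpret W: cat_valued_functor D W
    using W by (simp add: cat_valued_functorI finite_weight_def)
  have \<eta>: "pseudonatural D W (comp2 (hom_from Cat M) ?V) \<eta>" and catM: "category M"
    using M by (simp_all add: is_bilimit_def)
  have \<xi>': "pseudonatural D W (comp2 (hom_from A L) F) \<xi>" using \<xi> by (simp add: is_bilimit_def)
  \<comment> \<open>A terminal category in the universe where \<open>P\<close> takes its values;
    \<open>undefined\<close> serves as an element available in every type.\<close>
  define X :: "('c, 'a) cat" where
    "X = \<lparr>Ob = {undefined}, Ar = {undefined}, dm = (\<lambda>_. undefined), cd = (\<lambda>_. undefined),
       idn = (\<lambda>_. undefined), cmp = (\<lambda>_ _. undefined)\<rparr>"
  have X: "category X" "undefined \<in> Ob X" by (simp_all add: X_def category_def)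
  have "is_equivalence (cone_functor Cat D W ?V M \<eta> X)" using M X by (simp add: is_bilimit_def)
  moreover have "const_cone X D ?V \<tau> \<in> Ob (Tgt (cone_functor Cat D W ?V M \<eta> X))"
    using pseudonatural_const_cone[OF \<tau> X(1)] by simp
  ultimately obtain u \<rho> where u: "cat_functor u" "Src u = X" "Tgt u = M"
    and \<rho>: "iso_arr (Hom_p D W (comp2 (hom_from Cat X) ?V)) \<rho>"
      "mDom \<rho> = cone_restrict Cat D ?V \<eta> u" "mCod \<rho> = const_cone X D ?V \<tau>"
    by (elim equivalence_ess_surj) auto
  \<comment> \<open>The functor \<open>u\<close> from the terminal category to \<open>M\<close>
    amounts to this object.\<close>
  define m where "m = onOb u undefined"
  have m: "m \<in> Ob M" using u X unfolding m_def by simp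
  have iso1: "wpoint_iso D W ?V (point_at \<eta> m) (point_of \<tau>) (\<lambda>d w. ntAt (ntAt (mAt \<rho> d) w) undefined)"
    using wpoint_iso_modification[OF \<rho>(1) V.cat_valued_functor_axioms X(2)]
      point_at_cone_restrict[OF \<eta> V.cat_valued_functor_axioms u(1,3), of undefined]
      point_at_const_cone[OF \<tau> X(2)] X(2) u(2)
    by (auto simp: \<rho> m_def intro: wpoint_iso_agree[OF _ _ _ W.cat_valued_functor_axioms])
  obtain g \<epsilon> where g: "cat_functor k" "Src k = on0 P L" "Tgt k = M" "cat_functor g" "Src g = M" "Tgt g = on0 P L"
    and \<epsilon>: "iso_arr (vertical_cat Cat) \<epsilon>" "nDom \<epsilon> = comp_func k g" "nCod \<epsilon> = id_func M"
    using k by (auto simp: equivalence1_def is_comparison_def invertible2_def)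
  \<comment> \<open>The inverse in the vertical category also goes between endofunctors of
    \<open>M\<close>, so \<open>\<epsilon>\<close> is invertible in the hom-category as well, and
    there invertibility can be evaluated at \<open>m\<close>.\<close>
  have "iso_arr (hom_cat Cat M M) \<epsilon>"
  proof -
    obtain \<epsilon>' where "iso_arr (vertical_cat Cat) \<epsilon>'" "nDom \<epsilon>' = id_func M" "nCod \<epsilon>' = comp_func k g"
       "vcomp_nt \<epsilon>' \<epsilon> = id_nt (comp_func k g)" "vcomp_nt \<epsilon> \<epsilon>' = id_nt (id_func M)"
      using \<epsilon> by (auto elim: iso_arrE)
    then show ?thesis
      using \<epsilon> g by (intro iso_arrI[where g = \<epsilon>']) (auto simp: iso_arr_def)
  qed
  then have e: "iso_arr M (ntAt \<epsilon> m)" by (rule iso_arr_hom_Cat_at[OF _ m])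
  define z where "z = onOb g m"
  have z: "z \<in> Ob (on0 P L)" using g m by (simp add: z_def)
  have "nat_trans \<epsilon>" using \<epsilon> by (simp add: iso_arr_def)
  then have "dm M (ntAt \<epsilon> m) = onOb k z" "cd M (ntAt \<epsilon> m) = m"
    using nat_trans_rules(6,7)[of \<epsilon> M m] \<epsilon> g m by (simp_all add: z_def)
  then have iso2: "wpoint_iso D W ?V (point_at \<eta> (onOb k z)) (point_at \<eta> m) (\<lambda>d w. onAr (onOb (ps0 \<eta> d) w) (ntAt \<epsilon> m))"
    using wpoint_iso_point_at[OF \<eta> V.cat_valued_functor_axioms e catM] by simp
  obtain \<chi> where "iso_arr (Hom_p D W (comp2 (hom_from Cat (on0 P L)) ?V)) \<chi>"
    "mDom \<chi> = cone_restrict Cat D ?V \<eta> k" "mCod \<chi> = image_cone A Cat P D F L \<xi>"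
    using k by (auto simp: is_comparison_def)
  \<comment> \<open>A comparison isomorphism ends at the image cone, whereas the chain of
    isomorphisms has to begin there; hence the inverse.\<close>
  then obtain \<chi>' where \<chi>': "iso_arr (Hom_p D W (comp2 (hom_from Cat (on0 P L)) ?V)) \<chi>'"
    "mCod \<chi>' = cone_restrict Cat D ?V \<eta> k" "mDom \<chi>' = image_cone A Cat P D F L \<xi>"
    by (metis iso_arrE Hom_p_simps(3,4))
  have iso3: "wpoint_iso D W ?V (image_point P \<xi> z) (point_at \<eta> (onOb k z)) (\<lambda>d w. ntAt (ntAt (mAt \<chi>' d) w) z)"
    using wpoint_iso_modification[OF \<chi>'(1) V.cat_valued_functor_axioms z]
      point_at_cone_restrict[OF \<eta> V.cat_valued_functor_axioms g(1,3), of z]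
      point_at_image_cone[OF \<xi>' F, of P z] z g
    by (auto simp: \<chi>' intro: wpoint_iso_agree[OF _ _ _ W.cat_valued_functor_axioms])
  have "pseudonatural D W (comp2 (hom_from Cat (on0 P L)) ?V) (image_cone A Cat P D F L \<xi>)"
    using \<chi>' modification.pseudonatural_mDom[of D W _ \<chi>'] by (auto simp: iso_arr_def)
  then have im: "is_wpoint D W ?V (image_point P \<xi> z)"
    by (rule is_wpoint_agree[OF is_wpoint_point_at[OF _ V.cat_valued_functor_axioms z]
          point_at_image_cone[OF \<xi>' F] W.cat_valued_functor_axioms])
  have kz: "onOb k z \<in> Ob M" using g z by simp
  note t = wpoint_iso_trans[OF W.cat_valued_functor_axioms V.cat_valued_functor_axioms]
  note \<eta>p = is_wpoint_point_at[OF \<eta> V.cat_valued_functor_axioms]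
  show thesis
    by (rule that[OF z t[OF im \<eta>p[OF m] is_wpoint_point_of[OF \<tau>]
          t[OF im \<eta>p[OF kz] \<eta>p[OF m] iso3 iso2] iso1]])
qed

section \<open>The shapes\<close>

text \<open>
  A single family of shapes suffices. The objects are \<open>0\<close> and \<open>1\<close>; the 1-cells are their identities
  \<open>0\<close>, \<open>1\<close> and two arrows \<open>2, 3 : 0 \<rightarrow> 1\<close>; the 2-cells are the identities \<open>0, \<dots>, 3\<close> and, from \<open>4\<close> on,
  cells \<open>2 \<Rightarrow> 3\<close>. Only the cells below \<open>n\<close> are kept, so that \<open>n = 0, 2, 4, 6\<close> gives the empty
  2-category, two objects, two parallel arrows and two parallel 2-cells.
\<close>

definition shape :: "nat \<Rightarrow> (nat, nat, nat) cat2" where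
  "shape n = \<lparr>Obj = {m. m < n \<and> m < 2}, Cell1 = {m. m < n \<and> m < 4}, Cell2 = {..<n},
     src = (\<lambda>m. if m = 1 then 1 else 0), tgt = (\<lambda>m. if m = 0 then 0 else 1),
     src2 = (\<lambda>m. if m < 4 then m else 2), tgt2 = (\<lambda>m. if m < 4 then m else 3),
     id1 = (\<lambda>m. m), id2 = (\<lambda>m. m), comp1 = (\<lambda>g f. if f = 0 then g else f),
     vcomp = (\<lambda>\<beta> \<alpha>. if \<alpha> < 4 then \<beta> else \<alpha>), hcomp = (\<lambda>\<beta> \<alpha>. if \<alpha> = 0 then \<beta> else \<alpha>)\<rparr>"

lemma shape_simps [simp]:
  "Obj (shape n) = {m. m < n \<and> m < 2}" "Cell1 (shape n) = {m. m < n \<and> m < 4}" "Cell2 (shape n) = {..<n}"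
  "src (shape n) m = (if m = 1 then 1 else 0)" "tgt (shape n) m = (if m = 0 then 0 else 1)"
  "src2 (shape n) m = (if m < 4 then m else 2)" "tgt2 (shape n) m = (if m < 4 then m else 3)"
  "id1 (shape n) m = m" "id2 (shape n) m = m" "comp1 (shape n) g f = (if f = 0 then g else f)"
  "vcomp (shape n) \<beta> \<alpha> = (if \<alpha> < 4 then \<beta> else \<alpha>)"
  "hcomp (shape n) \<beta> \<alpha> = (if \<alpha> = 0 then \<beta> else \<alpha>)"
  by (simp_all add: shape_def)

text \<open>In a composable pair one factor is always an identity. This explains the simple
  composition tables, and with composability in the form of a case distinction the axioms are within
  reach of \<open>force\<close>.\<close>

lemma shape_composable:
  "tgt (shape n) f = src (shape n) g \<longleftrightarrow> (f = 0 \<longleftrightarrow> g \<noteq> 1)"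
  "tgt2 (shape n) \<alpha> = src2 (shape n) \<beta> \<longleftrightarrow>
     \<alpha> < 4 \<and> \<beta> = \<alpha> \<or> \<alpha> = 2 \<and> \<not> \<beta> < 4 \<or> \<not> \<alpha> < 4 \<and> \<beta> = 3"
  by auto

lemma shape_composable2:
  "tgt (shape n) (src2 (shape n) \<alpha>) = src (shape n) (src2 (shape n) \<beta>) \<longleftrightarrow> (\<alpha> = 0 \<longleftrightarrow> \<beta> \<noteq> 1)"
  by auto

lemma two_category_shape: "two_category (shape n)"
proof (rule two_category.intro)
  show "category (underlying_cat (shape n))"
    by (rule category.intro; unfold underlying_cat_simps shape_composable; force)
  show "category (vertical_cat (shape n))"
    by (rule category.intro; unfold vertical_cat_simps shape_composable; force)
  show "category (horizontal_cat (shape n))"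
    by (rule category.intro; unfold horizontal_cat_simps shape_composable2; force)
next
  fix \<alpha> \<alpha>' \<beta> \<beta>'
  assume "tgt2 (shape n) \<alpha> = src2 (shape n) \<alpha>'" "tgt2 (shape n) \<beta> = src2 (shape n) \<beta>'"
    and "tgt (shape n) (src2 (shape n) \<alpha>) = src (shape n) (src2 (shape n) \<beta>)"
  then show "(\<beta>' \<diamondop>\<^bsub>shape n\<^esub> \<beta>) \<star>\<^bsub>shape n\<^esub> (\<alpha>' \<diamondop>\<^bsub>shape n\<^esub> \<alpha>)
      = (\<beta>' \<star>\<^bsub>shape n\<^esub> \<alpha>') \<diamondop>\<^bsub>shape n\<^esub> (\<beta> \<star>\<^bsub>shape n\<^esub> \<alpha>)"
    unfolding shape_composable2 shape_composable by (cases "\<alpha> = 0") auto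
qed ((unfold shape_composable2 shape_composable)?, force)+

text \<open>The diagrams in \<open>A\<close> and the weights in \<open>Cat\<close> are both built by
  this constructor.\<close>

definition diagram where
  "diagram B X Y c \<theta> =
    (let on1 = \<lambda>m::nat. if m = 0 then id1 B X else if m = 1 then id1 B Y else c m
     in \<lparr>on0 = \<lambda>d::nat. if d = 0 then X else Y, on1 = on1,
         on2 = \<lambda>m::nat. if m < 4 then id2 B (on1 m) else \<theta> m\<rparr>)"

lemma diagram_simps [simp]:
  "on0 (diagram B X Y c \<theta>) d = (if d = 0 then X else Y)"
  "on1 (diagram B X Y c \<theta>) m = (if m = 0 then id1 B X else if m = 1 then id1 B Y else c m)"
  "on2 (diagram B X Y c \<theta>) m = (if m < 4 then id2 B (on1 (diagram B X Y c \<theta>) m) else \<theta> m)"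
  by (simp_all add: diagram_def Let_def)

text \<open>Since composable pairs in the shape contain an identity, functoriality comes down to the
  unit laws of \<open>B\<close>.\<close>

lemma two_functor_diagram:
  assumes B: "two_category B"
    and ob: "0 < n \<Longrightarrow> X \<in> Obj B" "1 < n \<Longrightarrow> Y \<in> Obj B"
    and c: "\<And>m. \<lbrakk>2 \<le> m; m < 4; m < n\<rbrakk> \<Longrightarrow> c m \<in> Cell1 B \<and> src B (c m) = X \<and> tgt B (c m) = Y"
    and \<theta>: "\<And>m. \<lbrakk>4 \<le> m; m < n\<rbrakk> \<Longrightarrow> \<theta> m \<in> Cell2 B \<and> src2 B (\<theta> m) = c 2 \<and> tgt2 B (\<theta> m) = c 3"
  shows "two_functor (shape n) B (diagram B X Y c \<theta>)"
proof -
  interpret B: two_category B by fact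
  let ?F = "diagram B X Y c \<theta>"
  have 1: "on1 ?F m \<in> Cell1 B \<and> src B (on1 ?F m) = on0 ?F (src (shape n) m)
      \<and> tgt B (on1 ?F m) = on0 ?F (tgt (shape n) m)"
    if "m < n" "m < 4" for m
    using that ob c[of m] by (cases "m = 0"; cases "m = 1") simp_all
  have 2: "on2 ?F m \<in> Cell2 B \<and> src2 B (on2 ?F m) = on1 ?F (src2 (shape n) m) \<and>
      tgt2 B (on2 ?F m) = on1 ?F (tgt2 (shape n) m)"
    if "m < n" for m
    using that 1[of m] \<theta>[of m] by (cases "m < 4") (simp_all del: diagram_simps(2), simp_all)
  have id: "on2 ?F m = id2 B (on1 ?F m)" if "m < 4" for m using that by simp
  have ids: "on1 ?F 0 = id1 B X" "on1 ?F (Suc 0) = id1 B Y" by simp_all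
  note [simp del] = diagram_simps(2,3)
  show ?thesis
  proof (rule two_functor.intro)
    fix \<alpha> \<beta> assume a: "\<alpha> \<in> Cell2 (shape n)" "\<beta> \<in> Cell2 (shape n)"
      "tgt (shape n) (src2 (shape n) \<alpha>) = src (shape n) (src2 (shape n) \<beta>)"
    have "\<alpha> = 0 \<or> \<alpha> \<noteq> 0 \<and> \<beta> = 1" using a(3) unfolding shape_composable2 by auto
    then show "on2 ?F (\<beta> \<star>\<^bsub>shape n\<^esub> \<alpha>) = on2 ?F \<beta> \<star>\<^bsub>B\<^esub> on2 ?F \<alpha>"
    proof
      assume "\<alpha> = 0"
      moreover from this have "src B (src2 B (on2 ?F \<beta>)) = X"
        using a 2[of \<beta>] 1[of "src2 (shape n) \<beta>"] by (auto split: if_splits)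
      ultimately show ?thesis using a 2[of \<beta>] by (simp add: id ids)
    next
      assume \<alpha>: "\<alpha> \<noteq> 0 \<and> \<beta> = 1"
      then have "tgt B (src2 B (on2 ?F \<alpha>)) = Y"
        using a 2[of \<alpha>] 1[of "src2 (shape n) \<alpha>"] by (auto split: if_splits)
      then show ?thesis using \<alpha> a 2[of \<alpha>] by (simp add: id ids)
    qed
  next
    fix \<alpha> \<beta> assume a: "\<alpha> \<in> Cell2 (shape n)" "\<beta> \<in> Cell2 (shape n)" "tgt2 (shape n) \<alpha> = src2 (shape n) \<beta>"
    then have "\<alpha> < 4 \<or> \<not> \<alpha> < 4 \<and> \<beta> = 3" unfolding shape_composable by auto
    then show "on2 ?F (\<beta> \<diamondop>\<^bsub>shape n\<^esub> \<alpha>) = on2 ?F \<beta> \<diamondop>\<^bsub>B\<^esub> on2 ?F \<alpha>"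
      using a 2[of \<alpha>] 2[of \<beta>] by (elim disjE) (simp_all add: id split: if_splits)
  next
    fix f g assume a: "f \<in> Cell1 (shape n)" "g \<in> Cell1 (shape n)" "tgt (shape n) f = src (shape n) g"
    then have "f = 0 \<and> g \<noteq> 1 \<or> f \<noteq> 0 \<and> g = 1" unfolding shape_composable by auto
    then show "on1 ?F (g \<odot>\<^bsub>shape n\<^esub> f) = on1 ?F g \<odot>\<^bsub>B\<^esub> on1 ?F f"
    proof
      assume f: "f = 0 \<and> g \<noteq> 1"
      then have "src B (on1 ?F g) = X" using a 1[of g] by simp
      then show ?thesis using f a 1[of g] by (simp add: ids)
    next
      assume g: "f \<noteq> 0 \<and> g = 1"
      then have "tgt B (on1 ?F f) = Y" using a 1[of f] by simp
      then show ?thesis using g a 1[of f] by (simp add: ids)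
    qed
  qed (use 1 2 id ob B in \<open>simp_all add: two_category_shape\<close>, simp_all add: diagram_simps)
qed

text \<open>In these thin categories the arrow \<open>i \<rightarrow> j\<close> is encoded as \<open>2 * i + j\<close>.\<close>

definition thin_cat :: "nat set \<Rightarrow> nat set \<Rightarrow> (nat, nat) cat" where
  "thin_cat I R = \<lparr>Ob = I, Ar = R, dm = (\<lambda>a. a div 2), cd = (\<lambda>a. a mod 2), idn = (\<lambda>i. 3 * i),
     cmp = (\<lambda>b a. 2 * (a div 2) + b mod 2)\<rparr>"

section \<open>The weights of inserters and iso-inserters\<close>

abbreviation point_cat :: "(nat, nat) cat" where
  "point_cat \<equiv> thin_cat {0} {0}"

text \<open>The free arrow, or the free isomorphism. Arrow 1 goes from 0 to 1, arrow 2 is its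
  inverse, and 0 and 3 are the identities.\<close>

definition walking :: "bool \<Rightarrow> (nat, nat) cat" where
  "walking invertible = thin_cat {0, 1} (if invertible then {0, 1, 2, 3} else {0, 1, 3})"

lemma thin_cat_simps [simp]:
  "Ob (thin_cat I R) = I" "Ar (thin_cat I R) = R" "dm (thin_cat I R) a = a div 2"
  "cd (thin_cat I R) a = a mod 2" "idn (thin_cat I R) i = 3 * i"
  "b \<cdot>\<^bsub>thin_cat I R\<^esub> a = 2 * (a div 2) + b mod 2"
  by (simp_all add: thin_cat_def)

lemma category_point_cat: "category point_cat"
  by (rule category.intro) simp_all

lemma category_walking: "category (walking invertible)"
  by (rule category.intro) (auto simp: walking_def split: if_splits)

lemma walking_simps [simp]:
  "Ob (walking invertible) = {0, 1}" "Ar (walking invertible) = (if invertible then {0, 1, 2, 3} else {0, 1, 3})"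
  "dm (walking invertible) a = a div 2" "cd (walking invertible) a = a mod 2" "idn (walking invertible) i = 3 * i"
  "b \<cdot>\<^bsub>walking invertible\<^esub> a = 2 * (a div 2) + b mod 2"
  by (simp_all add: walking_def)

lemma iso_arr_walking: "iso_arr (walking True) 1"
  by (rule iso_arrI[where g = 2]) simp_all

text \<open>The classical weight for inserters: the arrows 2 and 3 of the shape pick out the ends 0
  and 1 of the walking arrow, hence \<open>m - 2\<close>, and each 2-cell from 4 on goes to the
  transformation whose single component is the walking arrow 1.\<close>

definition weight :: "bool \<Rightarrow> (nat, nat, nat, nat, nat) cat_valued" where
  "weight invertible = diagram Cat point_cat (walking invertible)
     (\<lambda>m. const_func point_cat (walking invertible) (m - 2)) (\<lambda>m. const_nt point_cat (walking invertible) 1)"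

lemma finite_weight: "finite_weight (shape n) (weight invertible)"
proof -
  have *: "cat_functor (const_func point_cat (walking invertible) (m - 2))" if "2 \<le> m" "m < 4" for m
    by (rule cat_functor_const_func) (use that in \<open>auto simp: category_point_cat category_walking\<close>)
  have "two_functor (shape n) Cat (weight invertible)"
    unfolding weight_def
    by (rule two_functor_diagram)
      (auto simp: * two_category_Cat category_point_cat category_walking cat_functor_const_func
        nat_trans_const_nt)
  then show ?thesis
    by (auto simp: finite_weight_def weight_def)
qed

text \<open>The functor that classifies \<open>\<phi>\<close>. The chosen inverse is the value at
  arrow 2, which lies in the carrier only if \<open>invertible\<close> holds.\<close>

definition arrow_functor :: "bool \<Rightarrow> ('c, 'a) cat \<Rightarrow> 'a \<Rightarrow> (nat, nat, 'c, 'a) func" where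
  "arrow_functor invertible C \<phi> = \<lparr>Src = walking invertible, Tgt = C,
     onOb = (\<lambda>i\<in>{0, 1}. if i = 0 then dm C \<phi> else cd C \<phi>),
     onAr = (\<lambda>a\<in>Ar (walking invertible). if a = 0 then idn C (dm C \<phi>) else if a = 3 then idn C (cd C \<phi>)
        else if a = 1 then \<phi>
        else SOME \<psi>. \<psi> \<in> Ar C \<and> dm C \<psi> = cd C \<phi> \<and> cd C \<psi> = dm C \<phi> \<and>
          \<psi> \<cdot>\<^bsub>C\<^esub> \<phi> = idn C (dm C \<phi>) \<and> \<phi> \<cdot>\<^bsub>C\<^esub> \<psi> = idn C (cd C \<phi>))\<rparr>"

lemma arrow_functor_simps [simp]:
  "Src (arrow_functor invertible C \<phi>) = walking invertible" "Tgt (arrow_functor invertible C \<phi>) = C"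
  "onOb (arrow_functor invertible C \<phi>) 0 = dm C \<phi>" "onOb (arrow_functor invertible C \<phi>) 1 = cd C \<phi>"
  "onOb (arrow_functor invertible C \<phi>) (Suc 0) = cd C \<phi>"
  "onAr (arrow_functor invertible C \<phi>) 0 = idn C (dm C \<phi>)" "onAr (arrow_functor invertible C \<phi>) 3 = idn C (cd C \<phi>)"
  "onAr (arrow_functor invertible C \<phi>) 1 = \<phi>" "onAr (arrow_functor invertible C \<phi>) (Suc 0) = \<phi>"
  by (simp_all add: arrow_functor_def)

lemma cat_functor_arrow_functor:
  assumes C: "category C" and \<phi>: "\<phi> \<in> Ar C" and invertible: "invertible \<Longrightarrow> iso_arr C \<phi>"
  shows "cat_functor (arrow_functor invertible C \<phi>)"
proof -
  let ?F = "arrow_functor invertible C \<phi>"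
  have *: "onAr ?F 2 \<in> Ar C \<and> dm C (onAr ?F 2) = cd C \<phi> \<and> cd C (onAr ?F 2) = dm C \<phi> \<and>
          onAr ?F 2 \<cdot>\<^bsub>C\<^esub> \<phi> = idn C (dm C \<phi>) \<and> \<phi> \<cdot>\<^bsub>C\<^esub> onAr ?F 2 = idn C (cd C \<phi>)" if invertible
  proof -
    have "onAr ?F 2 = (SOME \<psi>. \<psi> \<in> Ar C \<and> dm C \<psi> = cd C \<phi> \<and> cd C \<psi> = dm C \<phi> \<and>
          \<psi> \<cdot>\<^bsub>C\<^esub> \<phi> = idn C (dm C \<phi>) \<and> \<phi> \<cdot>\<^bsub>C\<^esub> \<psi> = idn C (cd C \<phi>))"
      using that by (simp add: arrow_functor_def)
    then show ?thesis
      using someI_ex[of "\<lambda>\<psi>. \<psi> \<in> Ar C \<and> dm C \<psi> = cd C \<phi> \<and> cd C \<psi> = dm C \<phi> \<and>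
          \<psi> \<cdot>\<^bsub>C\<^esub> \<phi> = idn C (dm C \<phi>) \<and> \<phi> \<cdot>\<^bsub>C\<^esub> \<psi> = idn C (cd C \<phi>)"] invertible[OF that]
      by (auto simp: iso_arr_def)
  qed
  define F where "F = ?F"
  have F: "Src F = walking invertible" "Tgt F = C" "onOb F 0 = dm C \<phi>" "onOb F (Suc 0) = cd C \<phi>"
    "onAr F 0 = idn C (dm C \<phi>)" "onAr F 3 = idn C (cd C \<phi>)" "onAr F (Suc 0) = \<phi>"
    "invertible \<Longrightarrow> onAr F 2 \<in> Ar C" "invertible \<Longrightarrow> dm C (onAr F 2) = cd C \<phi>" "invertible \<Longrightarrow> cd C (onAr F 2) = dm C \<phi>"
    "invertible \<Longrightarrow> onAr F 2 \<cdot>\<^bsub>C\<^esub> \<phi> = idn C (dm C \<phi>)" "invertible \<Longrightarrow> \<phi> \<cdot>\<^bsub>C\<^esub> onAr F 2 = idn C (cd C \<phi>)"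
    unfolding F_def using * by simp_all
  have "cat_functor F"
  proof (rule cat_functor.intro)
    show "onOb F \<in> extensional (Ob (Src F))" "onAr F \<in> extensional (Ar (Src F))"
      unfolding F_def by (simp_all add: arrow_functor_def)
  qed (use C \<phi> in \<open>auto simp: F category_walking split: if_splits\<close>)
  then show ?thesis by (simp add: F_def)
qed

section \<open>The cone of an inserted cell\<close>

lemma hom_iso_imp_invertible2:
  assumes "iso_arr (hom_cat B X Y) \<alpha>" shows "invertible2 B \<alpha>"
proof -
  obtain \<beta> where "\<beta> \<in> Ar (hom_cat B X Y)" "src2 B \<beta> = tgt2 B \<alpha>" "tgt2 B \<beta> = src2 B \<alpha>"
    "\<beta> \<diamondop>\<^bsub>B\<^esub> \<alpha> = id2 B (src2 B \<alpha>)" "\<alpha> \<diamondop>\<^bsub>B\<^esub> \<beta> = id2 B (tgt2 B \<alpha>)"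
    using assms by (auto simp: iso_arr_def)
  then show ?thesis
    using assms unfolding invertible2_def by (intro iso_arrI[where g = \<beta>]) (auto simp: iso_arr_def)
qed

lemma invertible2E:
  assumes "invertible2 B \<alpha>"
  obtains \<beta> where "invertible2 B \<beta>" "\<beta> \<in> Cell2 B" "src2 B \<beta> = tgt2 B \<alpha>" "tgt2 B \<beta> = src2 B \<alpha>"
    "\<beta> \<diamondop>\<^bsub>B\<^esub> \<alpha> = id2 B (src2 B \<alpha>)" "\<alpha> \<diamondop>\<^bsub>B\<^esub> \<beta> = id2 B (tgt2 B \<alpha>)"
proof -
  have "iso_arr (vertical_cat B) \<alpha>" using assms by (simp add: invertible2_def)
  then obtain \<beta> where "iso_arr (vertical_cat B) \<beta>" "dm (vertical_cat B) \<beta> = cd (vertical_cat B) \<alpha>"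
     "cd (vertical_cat B) \<beta> = dm (vertical_cat B) \<alpha>"
     "\<beta> \<cdot>\<^bsub>vertical_cat B\<^esub> \<alpha> = idn (vertical_cat B) (dm (vertical_cat B) \<alpha>)"
     "\<alpha> \<cdot>\<^bsub>vertical_cat B\<^esub> \<beta> = idn (vertical_cat B) (cd (vertical_cat B) \<alpha>)"
    by (rule iso_arrE)
  then show thesis
    using that[of \<beta>] iso_arr_closed[of "vertical_cat B" \<beta>] by (simp add: invertible2_def)
qed

lemma nat_iso_id_nt: "cat_functor F \<Longrightarrow> nat_iso (id_nt F)"
  by (simp add: nat_iso_def nat_trans_id_nt category.iso_arr_idn)

text \<open>
  The data of an object \<open>x\<close> of \<open>P a\<close> and an arrow \<open>\<phi>\<close> of \<open>P b\<close>, with 1-cells \<open>c\<^sub>2, c\<^sub>3 : a \<rightarrow> b\<close>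
  taking \<open>x\<close> to the ends of \<open>\<phi>\<close> up to isomorphism and 2-cells \<open>\<theta>\<^sub>m : c\<^sub>2 \<Rightarrow> c\<^sub>3\<close> taking \<open>x\<close> to \<open>\<phi>\<close>;
  only the part of it which is indexed by cells of \<open>shape n\<close> is required.
\<close>

locale insertion =
  fixes A :: "('o, 'm, 'n) cat2" and P :: "('o, 'm, 'n, 'c, 'a) cat_valued"
    and n :: nat and a b x \<phi> c \<theta> \<delta> invertible
  assumes P: "two_functor A Cat P"
    and a: "0 < n \<Longrightarrow> a \<in> Obj A" and x: "0 < n \<Longrightarrow> x \<in> Ob (on0 P a)"
    and b: "1 < n \<Longrightarrow> b \<in> Obj A" and \<phi>: "1 < n \<Longrightarrow> \<phi> \<in> Ar (on0 P b)"
    and invertible: "1 < n \<Longrightarrow> invertible \<Longrightarrow> iso_arr (on0 P b) \<phi>"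
    and c: "\<And>m. \<lbrakk>2 \<le> m; m < 4; m < n\<rbrakk> \<Longrightarrow> c m \<in> Cell1 A \<and> src A (c m) = a \<and> tgt A (c m) = b"
    and \<delta>: "\<And>m. \<lbrakk>2 \<le> m; m < 4; m < n\<rbrakk> \<Longrightarrow> iso_arr (on0 P b) (\<delta> m) \<and>
          dm (on0 P b) (\<delta> m) = onOb (on1 P (c m)) x \<and>
          cd (on0 P b) (\<delta> m) = (if m = 2 then dm (on0 P b) \<phi> else cd (on0 P b) \<phi>)"
    and \<theta>: "\<And>m. \<lbrakk>4 \<le> m; m < n\<rbrakk> \<Longrightarrow> \<theta> m \<in> Cell2 A \<and> src2 A (\<theta> m) = c 2 \<and> tgt2 A (\<theta> m) = c 3 \<and>
          \<delta> 3 \<cdot>\<^bsub>on0 P b\<^esub> ntAt (on2 P (\<theta> m)) x = \<phi> \<cdot>\<^bsub>on0 P b\<^esub> \<delta> 2"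
begin

sublocale P: cat_valued_functor A P by (rule cat_valued_functorI[OF P])

abbreviation "F \<equiv> diagram A a b c \<theta>"

lemma two_functor_F: "two_functor (shape n) A F"
  by (rule two_functor_diagram[OF P.dom_two_category]) (use a b c \<theta> in auto)

section \<open>The transformation from the weight to \<open>P F\<close>\<close>

definition T0 :: "nat \<Rightarrow> (nat, nat, 'c, 'a) func" where
  "T0 = (\<lambda>d\<in>Obj (shape n). if d = 0 then const_func point_cat (on0 P a) x
      else arrow_functor invertible (on0 P b) \<phi>)"

text \<open>A functor on the point is an object, so the structure cell at arrow 2 or 3 is given by
  the single isomorphism \<open>\<delta> m\<close>.\<close>

definition T1 :: "nat \<Rightarrow> (nat, nat, 'c, 'a) nattrans" where
  "T1 = (\<lambda>m\<in>Cell1 (shape n). if m < 2 then id_nt (T0 m) else const_nt point_cat (on0 P b) (\<delta> m))"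

abbreviation "T \<equiv> \<lparr>ps0 = T0, ps1 = T1\<rparr>"

lemma T0_simps:
  "0 < n \<Longrightarrow> T0 0 = const_func point_cat (on0 P a) x" "1 < n \<Longrightarrow> T0 1 = arrow_functor invertible (on0 P b) \<phi>"
  by (simp_all add: T0_def)

lemma T1_simps:
  "m < n \<Longrightarrow> m < 2 \<Longrightarrow> T1 m = id_nt (T0 m)"
  "m < n \<Longrightarrow> 2 \<le> m \<Longrightarrow> m < 4 \<Longrightarrow> T1 m = const_nt point_cat (on0 P b) (\<delta> m)"
  by (simp_all add: T1_def)

lemma T0:
  assumes "d < n" "d < 2"
  shows "cat_functor (T0 d)" "Src (T0 d) = on0 (weight invertible) d" "Tgt (T0 d) = on0 (comp2 P F) d"
proof -
  consider "d = 0" | "d = 1" "1 < n" using assms by fastforce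
  then have "cat_functor (T0 d) \<and> Src (T0 d) = on0 (weight invertible) d \<and> Tgt (T0 d) = on0 (comp2 P F) d"
  proof cases
    case 1
    then show ?thesis
      using assms a x by (simp add: T0_simps weight_def cat_functor_const_func category_point_cat)
  next
    case 2
    then show ?thesis
      using assms b \<phi> invertible by (simp add: T0_simps[simplified] weight_def cat_functor_arrow_functor)
  qed
  then show "cat_functor (T0 d)" "Src (T0 d) = on0 (weight invertible) d" "Tgt (T0 d) = on0 (comp2 P F) d"
    by simp_all
qed

text \<open>The source and the target of the structure cell at arrow 2 or 3: constant functors at
  the domain and the codomain of \<open>\<delta> m\<close>.\<close>

lemma T1_eq:
  assumes m: "2 \<le> m" "m < 4" "m < n"
  shows "comp_func (on1 P (c m)) (T0 0) = const_func point_cat (on0 P b) (onOb (on1 P (c m)) x)"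
    and "comp_func (T0 1) (const_func point_cat (walking invertible) (m - 2))
      = const_func point_cat (on0 P b) (if m = 2 then dm (on0 P b) \<phi> else cd (on0 P b) \<phi>)"
proof -
  show "comp_func (on1 P (c m)) (T0 0) = const_func point_cat (on0 P b) (onOb (on1 P (c m)) x)"
    using m x c[OF m] by (simp add: T0_simps postcomp_const category_point_cat)
  have "m - 2 \<in> Ob (walking invertible)" "onOb (T0 1) (m - 2) = (if m = 2 then dm (on0 P b) \<phi> else cd (on0 P b) \<phi>)"
  proof -
    consider "m = 2" | "m = 3" using m by linarith
    then have "m - 2 \<in> Ob (walking invertible) \<and>
        onOb (T0 1) (m - 2) = (if m = 2 then dm (on0 P b) \<phi> else cd (on0 P b) \<phi>)"
      by cases (use m in \<open>simp_all add: T0_simps[simplified]\<close>)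
    then show "m - 2 \<in> Ob (walking invertible)"
      "onOb (T0 1) (m - 2) = (if m = 2 then dm (on0 P b) \<phi> else cd (on0 P b) \<phi>)" by simp_all
  qed
  then show "comp_func (T0 1) (const_func point_cat (walking invertible) (m - 2))
      = const_func point_cat (on0 P b) (if m = 2 then dm (on0 P b) \<phi> else cd (on0 P b) \<phi>)"
    using T0[of 1] m postcomp_const(1)[of "T0 1" point_cat "walking invertible" "on0 P b" "m - 2"]
    by (simp add: category_point_cat weight_def)
qed

lemma T1:
  assumes m: "m < n" "m < 4"
  shows "nat_iso (T1 m)" "nDom (T1 m) = comp_func (on1 (comp2 P F) m) (T0 (src (shape n) m))"
    "nCod (T1 m) = comp_func (T0 (tgt (shape n) m)) (on1 (weight invertible) m)"
proof -
  have "nat_iso (T1 m) \<and> nDom (T1 m) = comp_func (on1 (comp2 P F) m) (T0 (src (shape n) m)) \<and>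
    nCod (T1 m) = comp_func (T0 (tgt (shape n) m)) (on1 (weight invertible) m)"
  proof (cases "m < 2")
    case True
    note T = T0[OF m(1) True]
    have "nat_iso (T1 m)"
      using T m True by (simp add: T1_simps nat_iso_id_nt)
    moreover consider "m = 0" "0 < n" | "m = 1" "1 < n" using True m by fastforce
    then have "nDom (T1 m) = comp_func (on1 (comp2 P F) m) (T0 (src (shape n) m)) \<and>
       nCod (T1 m) = comp_func (T0 (tgt (shape n) m)) (on1 (weight invertible) m)"
      by cases (use T m True a b in \<open>simp_all add: T1_simps weight_def\<close>)
    ultimately show ?thesis by simp
  next
    case False
    then have m': "2 \<le> m" "m < 4" "m < n" using m by simp_all
    have "on0 P b \<in> Obj Cat" using b m' by simp
    then have "nat_iso (T1 m)"
      using \<delta>[OF m'] m' by (simp add: T1_simps nat_iso_def nat_trans_const_nt category_point_cat iso_arr_closed)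
    then show ?thesis
      using \<delta>[OF m'] m' T1_eq[OF m'] by (simp add: T1_simps weight_def)
  qed
  then show "nat_iso (T1 m)" "nDom (T1 m) = comp_func (on1 (comp2 P F) m) (T0 (src (shape n) m))"
    "nCod (T1 m) = comp_func (T0 (tgt (shape n) m)) (on1 (weight invertible) m)" by simp_all
qed

text \<open>The law for composites only meets pairs with an identity factor. The law at a 2-cell
  \<open>t \<ge> 4\<close> is the equation assumed of \<open>\<theta> t\<close>, and at an identity
  2-cell it is a unit law.\<close>

lemma pseudonatural_T: "pseudonatural (shape n) (weight invertible) (comp2 P F) T"
proof -
  interpret W: cat_valued_functor "shape n" "weight invertible"
    using finite_weight by (simp add: cat_valued_functorI finite_weight_def)
  interpret V: cat_valued_functor "shape n" "comp2 P F"
    by (rule cat_valued_functorI[OF two_functor_comp2[OF two_functor_F P]])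
  \<comment> \<open>The shape stays opaque, so that the 2-functor laws of \<open>W\<close> and
    \<open>V\<close> match before its case distinctions are unfolded.\<close>
  note [simp del] = comp2_simps diagram_simps shape_simps(4-)
  have T1': "nat_trans (T1 f)" if "f < n" "f < 4" for f
    using T1[OF that] by (simp add: nat_iso_def)
  have [simp]: "id1 (shape n) d = d" "id2 (shape n) d = d" for d by (simp_all add: shape_simps)
  have st: "src (shape n) f < n" "src (shape n) f < 2" "tgt (shape n) f < n" "tgt (shape n) f < 2"
    if "f < n" "f < 4" for f using that by (auto simp: shape_simps)
  note T0s = T0[OF st(1,2)] T0[OF st(3,4)]
  show ?thesis
  proof (rule pseudonatural.intro)
    show "two_functor (shape n) Cat (weight invertible)" by (rule W.two_functor_axioms)
    show "two_functor (shape n) Cat (comp2 P F)" by (rule V.two_functor_axioms)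
    fix f g w
    assume a: "f \<in> Cell1 (shape n)" "g \<in> Cell1 (shape n)" "tgt (shape n) f = src (shape n) g"
      "w \<in> Ob (on0 (weight invertible) (src (shape n) f))"
    then have w: "onOb (on1 (weight invertible) f) w \<in> Ob (on0 (weight invertible) (tgt (shape n) f))" by simp
    have fg: "f < n" "f < 4" "g < n" "g < 4" using a by simp_all
    have "f = 0 \<or> f \<noteq> 0 \<and> g = 1" using a(3) unfolding shape_composable by auto
    then show "ntAt (ps1 T (g \<odot>\<^bsub>shape n\<^esub> f)) w = ntAt (ps1 T g) (onOb (on1 (weight invertible) f) w)
        \<cdot>\<^bsub>on0 (comp2 P F) (tgt (shape n) g)\<^esub> onAr (on1 (comp2 P F) g) (ntAt (ps1 T f) w)"
    proof
      assume f: "f = 0"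
      then have 0: "src (shape n) g = 0" "src (shape n) f = 0" "tgt (shape n) f = 0" "0 < n"
         "g \<odot>\<^bsub>shape n\<^esub> f = g" "on1 (weight invertible) f = id_func (on0 (weight invertible) 0)" "T1 f = id_nt (T0 0)"
        using a fg W.cat_valued_rules(8)[of 0] by (simp_all add: shape_simps T1_simps)
      show ?thesis
        using 0 a fg f T0[of 0] T1[OF fg(3,4)] T1'[OF fg(3,4)] st[OF fg(3,4)] by simp
    next
      assume g: "f \<noteq> 0 \<and> g = 1"
      then have 1: "src (shape n) g = 1" "tgt (shape n) g = 1" "tgt (shape n) f = 1" "1 < n"
         "g \<odot>\<^bsub>shape n\<^esub> f = f" "on1 (comp2 P F) g = id_func (on0 (comp2 P F) 1)" "T1 g = id_nt (T0 1)"
        using a fg V.cat_valued_rules(8)[of 1] by (simp_all add: shape_simps T1_simps)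
      show ?thesis
        using 1 a w fg T0[of 1] T0s(1-3)[OF fg(1,2)] T1[OF fg(1,2)] T1'[OF fg(1,2)] st[OF fg(1,2)] by simp
    qed
  next
    fix t w assume t: "t \<in> Cell2 (shape n)" "w \<in> Ob (on0 (weight invertible) (src (shape n) (src2 (shape n) t)))"
    show "ntAt (ps1 T (tgt2 (shape n) t)) w
          \<cdot>\<^bsub>on0 (comp2 P F) (tgt (shape n) (src2 (shape n) t))\<^esub>
          ntAt (on2 (comp2 P F) t) (onOb (ps0 T (src (shape n) (src2 (shape n) t))) w)
        = onAr (ps0 T (tgt (shape n) (src2 (shape n) t))) (ntAt (on2 (weight invertible) t) w)
          \<cdot>\<^bsub>on0 (comp2 P F) (tgt (shape n) (src2 (shape n) t))\<^esub> ntAt (ps1 T (src2 (shape n) t)) w"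
    proof (cases "t < 4")
      case True
      then have tt: "src2 (shape n) t = t" "tgt2 (shape n) t = t" "t < n" using t by (simp_all add: shape_simps)
      have "on2 (comp2 P F) t = id_nt (on1 (comp2 P F) t)" "on2 (weight invertible) t = id_nt (on1 (weight invertible) t)"
        using V.cat_valued_rules(9)[of t] W.cat_valued_rules(9)[of t] t True by simp_all
      then show ?thesis
        using t tt True T1[OF tt(3) True] T1'[OF tt(3) True] T0s[OF tt(3) True] st[OF tt(3) True] by simp
    next
      case False
      then have tt: "4 \<le> t" "t < n" using t by simp_all
      have s: "src2 (shape n) t = 2" "tgt2 (shape n) t = 3" "src (shape n) 2 = 0" "tgt (shape n) 2 = 1"
        using False by (simp_all add: shape_simps)
      have w: "w = 0" using t s by (simp add: weight_def diagram_simps)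
      have T: "T1 2 = const_nt point_cat (on0 P b) (\<delta> 2)" "T1 3 = const_nt point_cat (on0 P b) (\<delta> 3)"
        "T0 0 = const_func point_cat (on0 P a) x" "T0 1 = arrow_functor invertible (on0 P b) \<phi>"
        using tt by (simp_all add: T1_simps T0_simps[simplified])
      have "on2 (comp2 P F) t = on2 P (\<theta> t)" "on2 (weight invertible) t = const_nt point_cat (walking invertible) 1"
         "on0 (comp2 P F) 1 = on0 P b"
        using False by (simp_all add: weight_def diagram_simps comp2_simps)
      then show ?thesis
        using \<theta>[OF tt] by (simp add: s w T[simplified])
    qed
  next
    fix d assume "d \<in> Obj (shape n)"
    then show "ps1 T (id1 (shape n) d) = id_nt (ps0 T d)"
      by (simp add: T1_simps)
  qed (use T0 T1 in \<open>simp_all\<close>, simp_all add: T0_def T1_def)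
qed

text \<open>The limit cone consists of \<open>h\<close>, of
  \<open>\<nu> : k 0 \<Rightarrow> k 1\<close>, and of isomorphisms \<open>s m\<close> from
  \<open>c m \<odot> h\<close> to \<open>k (m - 2)\<close>; the cell \<open>\<kappa>\<close> is
  determined by \<open>s 3 \<diamondop> \<kappa> = \<nu> \<diamondop> s 2\<close>. Its equation in
  \<open>P b\<close> follows from the naturality of \<open>\<zeta>\<close> at the walking arrow
  together with its compatibility with \<open>s 2\<close> and \<open>s 3\<close>. A 2-cell
  \<open>\<theta> m\<close> whiskered with \<open>h\<close> satisfies the same determining equation,
  by naturality of the cone, and therefore equals \<open>\<kappa>\<close>.\<close>

lemma insertion_exists:
  assumes lim: "has_finite_bilimits A" and lex: "left_exact A Cat P"
  obtains L z h h' \<eta> \<eta>' \<kappa> where "L \<in> Obj A" "z \<in> Ob (on0 P L)"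
    and "0 < n \<Longrightarrow> h \<in> Cell1 A \<and> src A h = L \<and> tgt A h = a \<and>
        iso_arr (on0 P a) \<eta> \<and> dm (on0 P a) \<eta> = onOb (on1 P h) z \<and> cd (on0 P a) \<eta> = x"
    and "1 < n \<Longrightarrow> h' \<in> Cell1 A \<and> src A h' = L \<and> tgt A h' = b \<and>
        iso_arr (on0 P b) \<eta>' \<and> dm (on0 P b) \<eta>' = onOb (on1 P h') z \<and> cd (on0 P b) \<eta>' = cd (on0 P b) \<phi>"
    and "3 < n \<Longrightarrow> \<kappa> \<in> Cell2 A \<and> src2 A \<kappa> = c 2 \<odot>\<^bsub>A\<^esub> h \<and> tgt2 A \<kappa> = c 3 \<odot>\<^bsub>A\<^esub> h \<and> (invertible \<longrightarrow> invertible2 A \<kappa>) \<and>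
        (\<delta> 3 \<cdot>\<^bsub>on0 P b\<^esub> onAr (on1 P (c 3)) \<eta>) \<cdot>\<^bsub>on0 P b\<^esub> ntAt (on2 P \<kappa>) z
        = \<phi> \<cdot>\<^bsub>on0 P b\<^esub> (\<delta> 2 \<cdot>\<^bsub>on0 P b\<^esub> onAr (on1 P (c 2)) \<eta>)"
    and "\<And>m. \<lbrakk>4 \<le> m; m < n\<rbrakk> \<Longrightarrow> \<theta> m \<star>\<^bsub>A\<^esub> id2 A h = \<kappa>"
proof -
  interpret W: cat_valued_functor "shape n" "weight invertible"
    using finite_weight by (simp add: cat_valued_functorI finite_weight_def)
  obtain L \<xi> where \<xi>: "is_bilimit A (shape n) (weight invertible) F L \<xi>"
    using lim finite_weight two_functor_F unfolding has_finite_bilimits_def by blast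
  obtain z \<zeta> where z: "z \<in> Ob (on0 P L)"
    and \<zeta>: "wpoint_iso (shape n) (weight invertible) (comp2 P F) (image_point P \<xi> z) (point_of T) \<zeta>"
    by (rule left_exact_point[OF P lex finite_weight two_functor_F \<xi> pseudonatural_T])
  have L: "L \<in> Obj A" and cone: "pseudonatural (shape n) (weight invertible) (comp2 (hom_from A L) F) \<xi>"
    using \<xi> by (simp_all add: is_bilimit_def)
  interpret cone: pseudonatural "shape n" "weight invertible" "comp2 (hom_from A L) F" \<xi> by (rule cone)
  note rules = cone_rules[OF cone two_functor_F]
  define h where "h = onOb (ps0 \<xi> 0) 0"
  define k where "k = (\<lambda>i. onOb (ps0 \<xi> 1) i)"
  define \<nu> where "\<nu> = onAr (ps0 \<xi> 1) 1"
  define s where "s = (\<lambda>m. ntAt (ps1 \<xi> m) 0)"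
  \<comment> \<open>The inverse of \<open>s 3\<close>. The witnesses have to be fixed before it is
    known that \<open>3 < n\<close>, so it is chosen by \<open>SOME\<close>, with an arbitrary value
    for smaller \<open>n\<close>.\<close>
  define \<kappa>' where "\<kappa>' = (SOME t. t \<in> Cell2 A \<and> src2 A t = k 1 \<and> tgt2 A t = c 3 \<odot>\<^bsub>A\<^esub> h \<and>
    invertible2 A t \<and> t \<diamondop>\<^bsub>A\<^esub> s 3 = id2 A (c 3 \<odot>\<^bsub>A\<^esub> h) \<and> s 3 \<diamondop>\<^bsub>A\<^esub> t = id2 A (k 1))"
  define \<kappa> where "\<kappa> = \<kappa>' \<diamondop>\<^bsub>A\<^esub> (\<nu> \<diamondop>\<^bsub>A\<^esub> s 2)"
  have \<zeta>0: "iso_arr (on0 (comp2 P F) d) (\<zeta> d w) \<and> dm (on0 (comp2 P F) d) (\<zeta> d w) = p0 (image_point P \<xi> z) d w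
      \<and> cd (on0 (comp2 P F) d) (\<zeta> d w) = p0 (point_of T) d w"
    if "d \<in> Obj (shape n)" "w \<in> Ob (on0 (weight invertible) d)" for d w
    using \<zeta> that unfolding wpoint_iso_def by blast
  have \<zeta>1: "\<zeta> d (cd (on0 (weight invertible) d) t) \<cdot>\<^bsub>on0 (comp2 P F) d\<^esub> p1 (image_point P \<xi> z) d t
      = p1 (point_of T) d t \<cdot>\<^bsub>on0 (comp2 P F) d\<^esub> \<zeta> d (dm (on0 (weight invertible) d) t)"
    if "d \<in> Obj (shape n)" "t \<in> Ar (on0 (weight invertible) d)" for d t
    using \<zeta> that unfolding wpoint_iso_def by blast
  have h: "h \<in> Cell1 A" "src A h = L" "tgt A h = a"
    "iso_arr (on0 P a) (\<zeta> 0 0)" "dm (on0 P a) (\<zeta> 0 0) = onOb (on1 P h) z" "cd (on0 P a) (\<zeta> 0 0) = x"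
    if "0 < n"
    using rules(1)[of 0 0] \<zeta>0[of 0 0] that
    by (simp_all add: h_def weight_def image_point_def point_of_def T0_simps)
  have k: "k i \<in> Cell1 A" "src A (k i) = L" "tgt A (k i) = b"
    "iso_arr (on0 P b) (\<zeta> 1 i)" "dm (on0 P b) (\<zeta> 1 i) = onOb (on1 P (k i)) z"
    "cd (on0 P b) (\<zeta> 1 i) = (if i = 0 then dm (on0 P b) \<phi> else cd (on0 P b) \<phi>)"
    if "1 < n" "i = 0 \<or> i = 1" for i
    using rules(1)[of 1 i] \<zeta>0[of 1 i] that
    by (auto simp: k_def weight_def image_point_def point_of_def T0_simps[simplified])
  have \<nu>: "\<nu> \<in> Cell2 A" "src2 A \<nu> = k 0" "tgt2 A \<nu> = k 1" "invertible \<Longrightarrow> invertible2 A \<nu>"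
    "\<zeta> 1 1 \<cdot>\<^bsub>on0 P b\<^esub> ntAt (on2 P \<nu>) z = \<phi> \<cdot>\<^bsub>on0 P b\<^esub> \<zeta> 1 0"
    if "1 < n"
  proof -
    show "\<nu> \<in> Cell2 A" "src2 A \<nu> = k 0" "tgt2 A \<nu> = k 1"
      using rules(2)[of 1 1] that by (simp_all add: \<nu>_def k_def weight_def)
    show "\<zeta> 1 1 \<cdot>\<^bsub>on0 P b\<^esub> ntAt (on2 P \<nu>) z = \<phi> \<cdot>\<^bsub>on0 P b\<^esub> \<zeta> 1 0"
      using \<zeta>1[of 1 1] that
      by (simp add: weight_def image_point_def point_of_def T0_simps[simplified] \<nu>_def)
    assume invertible
    then have "iso_arr (on0 (weight invertible) 1) 1" using iso_arr_walking by (simp add: weight_def)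
    then have "iso_arr (hom_cat A L b) \<nu>"
      using iso_arr_onAr[OF cone.functor_ps0, of 1 1] that
      by (simp add: \<nu>_def cone.Src_ps0 cone.Tgt_ps0)
    then show "invertible2 A \<nu>" by (rule hom_iso_imp_invertible2)
  qed
  have s: "s m \<in> Cell2 A" "src2 A (s m) = c m \<odot>\<^bsub>A\<^esub> h" "tgt2 A (s m) = k (m - 2)" "invertible2 A (s m)"
    "\<delta> m \<cdot>\<^bsub>on0 P b\<^esub> onAr (on1 P (c m)) (\<zeta> 0 0) = \<zeta> 1 (m - 2) \<cdot>\<^bsub>on0 P b\<^esub> ntAt (on2 P (s m)) z"
    if m: "2 \<le> m" "m < 4" "m < n" for m
  proof -
    have m': "m \<in> Cell1 (shape n)" "src (shape n) m = 0" "tgt (shape n) m = 1" "m \<noteq> 0" "m \<noteq> 1"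
      using m by simp_all
    have W: "on1 (weight invertible) m = const_func point_cat (walking invertible) (m - 2)" "0 \<in> Ob (on0 (weight invertible) 0)"
      using m by (simp_all add: weight_def)
    have F: "on1 (comp2 P F) m = on1 P (c m)" "on0 (comp2 P F) 1 = on0 P b" "on1 F m = c m"
      using m' by simp_all
    show "s m \<in> Cell2 A" "src2 A (s m) = c m \<odot>\<^bsub>A\<^esub> h" "tgt2 A (s m) = k (m - 2)"
      using rules(3)[of m 0, unfolded m'] m'(1) W by (simp_all add: s_def h_def k_def F[simplified])
    have "iso_arr (hom_cat A L b) (s m)"
      using rules(3)[of m 0, unfolded m'] m'(1) W by (simp add: s_def)
    then show "invertible2 A (s m)" by (rule hom_iso_imp_invertible2)
    have "\<forall>f\<in>Cell1 (shape n). \<forall>w\<in>Ob (on0 (weight invertible) (src (shape n) f)).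
        p2 (point_of T) f w \<cdot>\<^bsub>on0 (comp2 P F) (tgt (shape n) f)\<^esub> onAr (on1 (comp2 P F) f) (\<zeta> (src (shape n) f) w)
      = \<zeta> (tgt (shape n) f) (onOb (on1 (weight invertible) f) w) \<cdot>\<^bsub>on0 (comp2 P F) (tgt (shape n) f)\<^esub> p2 (image_point P \<xi> z) f w"
      using \<zeta> unfolding wpoint_iso_def by blast
    from this[rule_format, of m 0, unfolded m' F] m'(1) W
    show "\<delta> m \<cdot>\<^bsub>on0 P b\<^esub> onAr (on1 P (c m)) (\<zeta> 0 0) = \<zeta> 1 (m - 2) \<cdot>\<^bsub>on0 P b\<^esub> ntAt (on2 P (s m)) z"
      using m by (simp add: point_of_def image_point_def T1_simps s_def)
  qed
  show thesis
  proof (rule that[OF L z])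
    show "h \<in> Cell1 A \<and> src A h = L \<and> tgt A h = a \<and>
        iso_arr (on0 P a) (\<zeta> 0 0) \<and> dm (on0 P a) (\<zeta> 0 0) = onOb (on1 P h) z \<and> cd (on0 P a) (\<zeta> 0 0) = x"
      if "0 < n" using h[OF that] by simp
    show "k 1 \<in> Cell1 A \<and> src A (k 1) = L \<and> tgt A (k 1) = b \<and>
        iso_arr (on0 P b) (\<zeta> 1 1) \<and> dm (on0 P b) (\<zeta> 1 1) = onOb (on1 P (k 1)) z \<and>
        cd (on0 P b) (\<zeta> 1 1) = cd (on0 P b) \<phi>"
      if "1 < n" using k[OF that, of 1] by simp
    have \<kappa>': "\<kappa>' \<in> Cell2 A" "src2 A \<kappa>' = k 1" "tgt2 A \<kappa>' = c 3 \<odot>\<^bsub>A\<^esub> h" "invertible2 A \<kappa>'"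
      "\<kappa>' \<diamondop>\<^bsub>A\<^esub> s 3 = id2 A (c 3 \<odot>\<^bsub>A\<^esub> h)" "s 3 \<diamondop>\<^bsub>A\<^esub> \<kappa>' = id2 A (k 1)" if "3 < n"
    proof -
      have "invertible2 A (s 3)" using s(4)[of 3] that by simp
      then obtain t where "invertible2 A t" "t \<in> Cell2 A" "src2 A t = tgt2 A (s 3)" "tgt2 A t = src2 A (s 3)"
        "t \<diamondop>\<^bsub>A\<^esub> s 3 = id2 A (src2 A (s 3))" "s 3 \<diamondop>\<^bsub>A\<^esub> t = id2 A (tgt2 A (s 3))"
        by (rule invertible2E)
      then have "\<exists>t. t \<in> Cell2 A \<and> src2 A t = k 1 \<and> tgt2 A t = c 3 \<odot>\<^bsub>A\<^esub> h \<and>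
          invertible2 A t \<and> t \<diamondop>\<^bsub>A\<^esub> s 3 = id2 A (c 3 \<odot>\<^bsub>A\<^esub> h) \<and> s 3 \<diamondop>\<^bsub>A\<^esub> t = id2 A (k 1)"
        using s(2,3)[of 3] that by auto
      from someI_ex[OF this]
      show "\<kappa>' \<in> Cell2 A" "src2 A \<kappa>' = k 1" "tgt2 A \<kappa>' = c 3 \<odot>\<^bsub>A\<^esub> h" "invertible2 A \<kappa>'"
        "\<kappa>' \<diamondop>\<^bsub>A\<^esub> s 3 = id2 A (c 3 \<odot>\<^bsub>A\<^esub> h)" "s 3 \<diamondop>\<^bsub>A\<^esub> \<kappa>' = id2 A (k 1)"
        unfolding \<kappa>'_def by simp_all
    qed
    have s\<kappa>: "s 3 \<diamondop>\<^bsub>A\<^esub> \<kappa> = \<nu> \<diamondop>\<^bsub>A\<^esub> s 2" "\<kappa> \<in> Cell2 A" "src2 A \<kappa> = c 2 \<odot>\<^bsub>A\<^esub> h" "tgt2 A \<kappa> = c 3 \<odot>\<^bsub>A\<^esub> h"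
      if "3 < n"
    proof -
      have n: "1 < n" "2 < n" using that by simp_all
      note facts = \<nu>(1-3)[OF n(1)] \<kappa>'(1-3)[OF that] s(1-3)[of 2] s(1-3)[of 3] n that
      have "s 3 \<diamondop>\<^bsub>A\<^esub> \<kappa> = (s 3 \<diamondop>\<^bsub>A\<^esub> \<kappa>') \<diamondop>\<^bsub>A\<^esub> (\<nu> \<diamondop>\<^bsub>A\<^esub> s 2)"
        using facts by (simp add: \<kappa>_def)
      also have "\<dots> = \<nu> \<diamondop>\<^bsub>A\<^esub> s 2" using facts by (simp add: \<kappa>'(6))
      finally show "s 3 \<diamondop>\<^bsub>A\<^esub> \<kappa> = \<nu> \<diamondop>\<^bsub>A\<^esub> s 2" .
      show "\<kappa> \<in> Cell2 A" "src2 A \<kappa> = c 2 \<odot>\<^bsub>A\<^esub> h" "tgt2 A \<kappa> = c 3 \<odot>\<^bsub>A\<^esub> h"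
        using facts by (simp_all add: \<kappa>_def)
    qed
    show "\<kappa> \<in> Cell2 A \<and> src2 A \<kappa> = c 2 \<odot>\<^bsub>A\<^esub> h \<and> tgt2 A \<kappa> = c 3 \<odot>\<^bsub>A\<^esub> h \<and> (invertible \<longrightarrow> invertible2 A \<kappa>) \<and>
        (\<delta> 3 \<cdot>\<^bsub>on0 P b\<^esub> onAr (on1 P (c 3)) (\<zeta> 0 0)) \<cdot>\<^bsub>on0 P b\<^esub> ntAt (on2 P \<kappa>) z
        = \<phi> \<cdot>\<^bsub>on0 P b\<^esub> (\<delta> 2 \<cdot>\<^bsub>on0 P b\<^esub> onAr (on1 P (c 2)) (\<zeta> 0 0))"
      if n: "3 < n"
    proof (intro conjI impI)
      have n': "0 < n" "1 < n" "2 < n" using n by simp_all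
      note h = h[OF n'(1)] and k = k[OF n'(2)] and \<nu> = \<nu>[OF n'(2)] and \<kappa>' = \<kappa>'[OF n] and s\<kappa> = s\<kappa>[OF n]
      note s2 = s[of 2, simplified, OF n'(3)] and s3 = s[of 3, simplified, OF n]
      have c2: "c 2 \<in> Cell1 A" "src A (c 2) = a" "tgt A (c 2) = b" using c[of 2] n' by simp_all
      have c3: "c 3 \<in> Cell1 A" "src A (c 3) = a" "tgt A (c 3) = b" using c[of 3] n by simp_all
      show "\<kappa> \<in> Cell2 A" "src2 A \<kappa> = c 2 \<odot>\<^bsub>A\<^esub> h" "tgt2 A \<kappa> = c 3 \<odot>\<^bsub>A\<^esub> h" by (fact s\<kappa>)+
      show "invertible2 A \<kappa>" if invertible
      proof -
        interpret V: category "vertical_cat A" by (rule P.dom.category_vertical)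
        have "iso_arr (vertical_cat A) (\<nu> \<diamondop>\<^bsub>A\<^esub> s 2)"
          using V.iso_arr_cmp[of "s 2" \<nu>] s2 \<nu> that by (simp add: invertible2_def)
        then show ?thesis
          using V.iso_arr_cmp[of "\<nu> \<diamondop>\<^bsub>A\<^esub> s 2" \<kappa>'] s2 \<nu> \<kappa>' by (simp add: invertible2_def \<kappa>_def)
      qed
      interpret B: category "on0 P b" using b n' by simp
      have at: "ntAt (on2 P t) z \<in> Ar (on0 P b)"
        "dm (on0 P b) (ntAt (on2 P t) z) = onOb (on1 P (src2 A t)) z"
        "cd (on0 P b) (ntAt (on2 P t) z) = onOb (on1 P (tgt2 A t)) z"
        if "t \<in> Cell2 A" "src A (src2 A t) = L" "tgt A (src2 A t) = b" for t
        using that z by simp_all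
      have comp: "ntAt (on2 P (t \<diamondop>\<^bsub>A\<^esub> t')) z = ntAt (on2 P t) z \<cdot>\<^bsub>on0 P b\<^esub> ntAt (on2 P t') z"
        if "t \<in> Cell2 A" "t' \<in> Cell2 A" "tgt2 A t' = src2 A t" "src A (src2 A t') = L" "tgt A (src2 A t') = b" for t t'
        using that z by simp
      have z11: "\<zeta> 1 1 \<in> Ar (on0 P b)" "dm (on0 P b) (\<zeta> 1 1) = onOb (on1 P (k 1)) z"
        and z10: "\<zeta> 1 0 \<in> Ar (on0 P b)" "dm (on0 P b) (\<zeta> 1 0) = onOb (on1 P (k 0)) z"
           "cd (on0 P b) (\<zeta> 1 0) = dm (on0 P b) \<phi>"
        using k[of 0] k[of 1] by (simp_all add: iso_arr_closed)
      note srcs = h(1-3) k(1-3)[of 0, simplified] k(1-3)[of 1, simplified] c2 c3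
      have at3: "ntAt (on2 P (s 3)) z \<in> Ar (on0 P b)"
          "dm (on0 P b) (ntAt (on2 P (s 3)) z) = onOb (on1 P (c 3 \<odot>\<^bsub>A\<^esub> h)) z"
          "cd (on0 P b) (ntAt (on2 P (s 3)) z) = onOb (on1 P (k 1)) z"
        using at[of "s 3"] s3 srcs by (simp_all del: P.cat_valued_rules)
      have at2: "ntAt (on2 P (s 2)) z \<in> Ar (on0 P b)"
          "cd (on0 P b) (ntAt (on2 P (s 2)) z) = onOb (on1 P (k 0)) z"
        using at[of "s 2"] s2 srcs by (simp_all del: P.cat_valued_rules)
      have at\<kappa>: "ntAt (on2 P \<kappa>) z \<in> Ar (on0 P b)"
          "cd (on0 P b) (ntAt (on2 P \<kappa>) z) = onOb (on1 P (c 3 \<odot>\<^bsub>A\<^esub> h)) z"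
        using at[of \<kappa>] s\<kappa> srcs by (simp_all del: P.cat_valued_rules)
      have at\<nu>: "ntAt (on2 P \<nu>) z \<in> Ar (on0 P b)"
          "dm (on0 P b) (ntAt (on2 P \<nu>) z) = onOb (on1 P (k 0)) z"
          "cd (on0 P b) (ntAt (on2 P \<nu>) z) = onOb (on1 P (k 1)) z"
        using at[of \<nu>] \<nu> srcs by (simp_all del: P.cat_valued_rules)
      \<comment> \<open>Compatibility at arrow 3 trades \<open>\<delta> 3\<close> for the image of
        \<open>s 3\<close>, which cancels the inverse inside \<open>\<kappa>\<close>. Naturality at
        the walking arrow then produces \<open>\<phi>\<close>, and compatibility at arrow 2 produces
        \<open>\<delta> 2\<close>.\<close>
      have "(\<delta> 3 \<cdot>\<^bsub>on0 P b\<^esub> onAr (on1 P (c 3)) (\<zeta> 0 0)) \<cdot>\<^bsub>on0 P b\<^esub> ntAt (on2 P \<kappa>) z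
          = (\<zeta> 1 1 \<cdot>\<^bsub>on0 P b\<^esub> ntAt (on2 P (s 3)) z) \<cdot>\<^bsub>on0 P b\<^esub> ntAt (on2 P \<kappa>) z"
        using s3(5) by simp
      also have "\<dots> = \<zeta> 1 1 \<cdot>\<^bsub>on0 P b\<^esub> (ntAt (on2 P (s 3)) z \<cdot>\<^bsub>on0 P b\<^esub> ntAt (on2 P \<kappa>) z)"
        by (rule B.cmp_assoc) (use at3 at\<kappa> z11 in simp_all)
      also have "ntAt (on2 P (s 3)) z \<cdot>\<^bsub>on0 P b\<^esub> ntAt (on2 P \<kappa>) z = ntAt (on2 P (s 3 \<diamondop>\<^bsub>A\<^esub> \<kappa>)) z"
        by (rule comp[symmetric]) (use s3 s\<kappa> srcs in simp_all)
      also have "\<dots> = ntAt (on2 P \<nu>) z \<cdot>\<^bsub>on0 P b\<^esub> ntAt (on2 P (s 2)) z"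
        unfolding s\<kappa>(1) by (rule comp) (use s2 \<nu> srcs in simp_all)
      also have "\<zeta> 1 1 \<cdot>\<^bsub>on0 P b\<^esub> (ntAt (on2 P \<nu>) z \<cdot>\<^bsub>on0 P b\<^esub> ntAt (on2 P (s 2)) z)
          = (\<zeta> 1 1 \<cdot>\<^bsub>on0 P b\<^esub> ntAt (on2 P \<nu>) z) \<cdot>\<^bsub>on0 P b\<^esub> ntAt (on2 P (s 2)) z"
        by (rule B.cmp_assoc[symmetric]) (use at2 at\<nu> z11 in simp_all)
      also have "\<dots> = (\<phi> \<cdot>\<^bsub>on0 P b\<^esub> \<zeta> 1 0) \<cdot>\<^bsub>on0 P b\<^esub> ntAt (on2 P (s 2)) z"
        by (simp only: \<nu>(5))
      also have "\<dots> = \<phi> \<cdot>\<^bsub>on0 P b\<^esub> (\<zeta> 1 0 \<cdot>\<^bsub>on0 P b\<^esub> ntAt (on2 P (s 2)) z)"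
        by (rule B.cmp_assoc) (use at2 z10 \<phi> n' in simp_all)
      finally show "(\<delta> 3 \<cdot>\<^bsub>on0 P b\<^esub> onAr (on1 P (c 3)) (\<zeta> 0 0)) \<cdot>\<^bsub>on0 P b\<^esub> ntAt (on2 P \<kappa>) z
          = \<phi> \<cdot>\<^bsub>on0 P b\<^esub> (\<delta> 2 \<cdot>\<^bsub>on0 P b\<^esub> onAr (on1 P (c 2)) (\<zeta> 0 0))"
        using s2(5) by simp
    qed
    show "\<theta> m \<star>\<^bsub>A\<^esub> id2 A h = \<kappa>" if m: "4 \<le> m" "m < n" for m
    proof -
      have n: "0 < n" "1 < n" "2 < n" "3 < n" using m by simp_all
      note facts = h(1-3)[OF n(1)] \<nu>(1-3)[OF n(2)] s[of 2, simplified, OF n(3)] s[of 3, simplified, OF n(4)]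
        \<kappa>'[OF n(4)] \<theta>[OF m] c[of 2, simplified, OF n(3)] c[of 3, simplified, OF n(4)]
      have sh: "src2 (shape n) m = 2" "tgt2 (shape n) m = 3" "src (shape n) 2 = 0" "tgt (shape n) 2 = 1"
        "m \<in> Cell2 (shape n)" "0 \<in> Ob (on0 (weight invertible) 0)" "on2 F m = \<theta> m" "on0 F 1 = b"
        "ntAt (on2 (weight invertible) m) 0 = 1"
        using m by (simp_all add: weight_def)
      \<comment> \<open>Naturality of the cone at the 2-cell \<open>m\<close>, whose image under the
        weight is the walking arrow, and that in turn goes to \<open>\<nu>\<close>.\<close>
      have "s 3 \<diamondop>\<^bsub>A\<^esub> (\<theta> m \<star>\<^bsub>A\<^esub> id2 A h) = \<nu> \<diamondop>\<^bsub>A\<^esub> s 2"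
        using cone.ps1_natural[of m 0, unfolded sh comp2_simps hom_from_simps hom_cat_simps] sh(5,6) facts
        by (simp add: s_def \<nu>_def h_def)
      then have "\<kappa> = \<kappa>' \<diamondop>\<^bsub>A\<^esub> (s 3 \<diamondop>\<^bsub>A\<^esub> (\<theta> m \<star>\<^bsub>A\<^esub> id2 A h))" by (simp add: \<kappa>_def)
      also have "\<dots> = (\<kappa>' \<diamondop>\<^bsub>A\<^esub> s 3) \<diamondop>\<^bsub>A\<^esub> (\<theta> m \<star>\<^bsub>A\<^esub> id2 A h)"
        by (rule P.dom.cell2_rules(11)[symmetric]) (use facts in simp_all)
      also have "\<dots> = \<theta> m \<star>\<^bsub>A\<^esub> id2 A h" using facts by simp
      finally show ?thesis by simp
    qed
  qed
qed

end

section \<open>The 2-category of elements\<close>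

lemma op2_simps [simp]:
  "Obj (op2 C) = Obj C" "Cell1 (op2 C) = Cell1 C" "Cell2 (op2 C) = Cell2 C"
  "src (op2 C) = tgt C" "tgt (op2 C) = src C" "src2 (op2 C) = src2 C" "tgt2 (op2 C) = tgt2 C"
  "id1 (op2 C) = id1 C" "id2 (op2 C) = id2 C" "g \<odot>\<^bsub>op2 C\<^esub> f = f \<odot>\<^bsub>C\<^esub> g" "vcomp (op2 C) = vcomp C"
  "\<beta> \<star>\<^bsub>op2 C\<^esub> \<alpha> = \<alpha> \<star>\<^bsub>C\<^esub> \<beta>"
  by (simp_all add: op2_def)

lemma invertible2_op2 [simp]: "invertible2 (op2 C) \<alpha> = invertible2 C \<alpha>"
  by (simp add: invertible2_def vertical_cat_def op2_def)

lemma (in two_category) two_category_op2: "two_category (op2 C)"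
proof (rule two_category.intro)
  show "category (underlying_cat (op2 C))" "category (horizontal_cat (op2 C))"
    by (rule category.intro; simp)+
  show "category (vertical_cat (op2 C))"
    using category_vertical by (simp add: vertical_cat_def op2_def)
qed (simp_all add: interchange)

section \<open>Arrows and 2-cells of the 2-category of elements\<close>

lemma El_simps [simp]:
  "Obj (El A P) = el_objects A P" "Cell1 (El A P) = el_arrows A P" "Cell2 (El A P) = el_cells A P"
  "src (El A P) = elSrc" "tgt (El A P) = elTgt" "src2 (El A P) = elSrc2" "tgt2 (El A P) = elTgt2"
  "id1 (El A P) p = \<lparr>elSrc = p, elTgt = p, elBase = id1 A (snd p), elFib = idn (on0 P (snd p)) (fst p)\<rparr>"
  "id2 (El A P) u = \<lparr>elSrc2 = u, elTgt2 = u, elBase2 = id2 A (elBase u)\<rparr>"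
  "comp1 (El A P) = el_comp A P"
  "\<Phi> \<diamondop>\<^bsub>El A P\<^esub> \<Theta> = \<lparr>elSrc2 = elSrc2 \<Theta>, elTgt2 = elTgt2 \<Phi>, elBase2 = elBase2 \<Phi> \<diamondop>\<^bsub>A\<^esub> elBase2 \<Theta>\<rparr>"
  "\<Phi> \<star>\<^bsub>El A P\<^esub> \<Theta> = \<lparr>elSrc2 = el_comp A P (elSrc2 \<Phi>) (elSrc2 \<Theta>),
       elTgt2 = el_comp A P (elTgt2 \<Phi>) (elTgt2 \<Theta>), elBase2 = elBase2 \<Phi> \<star>\<^bsub>A\<^esub> elBase2 \<Theta>\<rparr>"
  by (simp_all add: El_def)

lemma el_comp_simps [simp]:
  "elSrc (el_comp A P v u) = elSrc u" "elTgt (el_comp A P v u) = elTgt v"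
  "elBase (el_comp A P v u) = elBase v \<odot>\<^bsub>A\<^esub> elBase u"
  "elFib (el_comp A P v u) = elFib v \<cdot>\<^bsub>on0 P (snd (elTgt v))\<^esub> onAr (on1 P (elBase v)) (elFib u)"
  by (simp_all add: el_comp_def)

lemma el_objects_iff: "p \<in> el_objects A P \<longleftrightarrow> snd p \<in> Obj A \<and> fst p \<in> Ob (on0 P (snd p))"
  by (auto simp: el_objects_def)

lemma el_arrows_rules:
  assumes "u \<in> el_arrows A P"
  shows "elSrc u \<in> el_objects A P" "elTgt u \<in> el_objects A P"
    and "elBase u \<in> Cell1 A" "src A (elBase u) = snd (elSrc u)" "tgt A (elBase u) = snd (elTgt u)"
    and "snd (elTgt u) = X \<Longrightarrow> elFib u \<in> Ar (on0 P X)"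
    and "snd (elTgt u) = X \<Longrightarrow> dm (on0 P X) (elFib u) = onOb (on1 P (elBase u)) (fst (elSrc u))"
    and "snd (elTgt u) = X \<Longrightarrow> cd (on0 P X) (elFib u) = fst (elTgt u)"
    and "snd (elSrc u) \<in> Obj A" "fst (elSrc u) \<in> Ob (on0 P (snd (elSrc u)))"
    and "snd (elTgt u) \<in> Obj A" "fst (elTgt u) \<in> Ob (on0 P (snd (elTgt u)))"
  using assms by (auto simp: el_arrows_def el_objects_iff)

lemma el_cells_rules:
  assumes "\<Theta> \<in> el_cells A P"
  shows "elSrc2 \<Theta> \<in> el_arrows A P" "elTgt2 \<Theta> \<in> el_arrows A P"
    and "elSrc (elTgt2 \<Theta>) = elSrc (elSrc2 \<Theta>)" "elTgt (elTgt2 \<Theta>) = elTgt (elSrc2 \<Theta>)"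
    and "elBase2 \<Theta> \<in> Cell2 A"
    and "src2 A (elBase2 \<Theta>) = elBase (elSrc2 \<Theta>)" "tgt2 A (elBase2 \<Theta>) = elBase (elTgt2 \<Theta>)"
  using assms by (auto simp: el_cells_def)

lemma el_cells_fib:
  assumes "\<Theta> \<in> el_cells A P"
  shows "elFib (elTgt2 \<Theta>) \<cdot>\<^bsub>on0 P (snd (elTgt (elSrc2 \<Theta>)))\<^esub>
       ntAt (on2 P (elBase2 \<Theta>)) (fst (elSrc (elSrc2 \<Theta>))) = elFib (elSrc2 \<Theta>)"
  using assms unfolding el_cells_def by blast

lemma el_cell_eq_iff:
  "\<lparr>elSrc2 = u, elTgt2 = v, elBase2 = t\<rparr> = \<Theta> \<longleftrightarrow> u = elSrc2 \<Theta> \<and> v = elTgt2 \<Theta> \<and> t = elBase2 \<Theta>"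
  by (auto intro: el_cell.equality)

context cat_valued_functor
begin

declare el_arrows_rules[of _ D V, simp] el_cells_rules[of _ D V, simp]

lemma el_comp_closed [simp]:
  assumes "u \<in> el_arrows D V" "v \<in> el_arrows D V" "elTgt u = elSrc v"
  shows "el_comp D V v u \<in> el_arrows D V"
proof -
  have "snd (elTgt u) = snd (elSrc v)" "fst (elTgt u) = fst (elSrc v)" using assms by simp_all
  then show ?thesis
    using assms(1,2) by (subst el_arrows_def) simp
qed

lemma el_id_closed:
  assumes "p \<in> el_objects D V"
  shows "\<lparr>elSrc = p, elTgt = p, elBase = id1 D (snd p), elFib = idn (on0 V (snd p)) (fst p)\<rparr> \<in> el_arrows D V"
  using assms by (subst el_arrows_def) (simp add: el_objects_iff)

lemma el_comp_assoc:
  assumes "u \<in> el_arrows D V" "v \<in> el_arrows D V" "w \<in> el_arrows D V" "elTgt u = elSrc v" "elTgt v = elSrc w"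
  shows "el_comp D V (el_comp D V w v) u = el_comp D V w (el_comp D V v u)"
proof -
  have "snd (elTgt u) = snd (elSrc v)" "fst (elTgt u) = fst (elSrc v)"
    "snd (elTgt v) = snd (elSrc w)" "fst (elTgt v) = fst (elSrc w)" using assms by simp_all
  then show ?thesis using assms(1-3) by (intro el_arrow.equality) simp_all
qed

lemma el_comp_id:
  assumes "u \<in> el_arrows D V"
  shows "el_comp D V u (id1 (El D V) (elSrc u)) = u" "el_comp D V (id1 (El D V) (elTgt u)) u = u"
  using assms by (auto intro!: el_arrow.equality)

text \<open>Naturality of \<open>on2 V p\<close> at the fibre arrow of \<open>f'\<close> brings the
  fibre of \<open>g'\<close> next to the component of \<open>p\<close> at \<open>y\<close>. The
  equations defining the two given 2-cells then apply, the one for \<open>\<Theta>\<close> under the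
  functor \<open>on1 V (elBase g)\<close>.\<close>

lemma el_hcomp_closed:
  assumes \<Theta>: "\<Theta> \<in> el_cells D V" and \<Phi>: "\<Phi> \<in> el_cells D V" and eq: "elTgt (elSrc2 \<Theta>) = elSrc (elSrc2 \<Phi>)"
  shows "\<lparr>elSrc2 = el_comp D V (elSrc2 \<Phi>) (elSrc2 \<Theta>), elTgt2 = el_comp D V (elTgt2 \<Phi>) (elTgt2 \<Theta>),
    elBase2 = elBase2 \<Phi> \<star>\<^bsub>D\<^esub> elBase2 \<Theta>\<rparr> \<in> el_cells D V"
proof -
  define f f' g g' where "f = elSrc2 \<Theta>" and "f' = elTgt2 \<Theta>" and "g = elSrc2 \<Phi>" and "g' = elTgt2 \<Phi>"
  define t p where "t = elBase2 \<Theta>" and "p = elBase2 \<Phi>"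
  define x X y Y z Z where "x = fst (elSrc f)" and "X = snd (elSrc f)" and "y = fst (elTgt f)"
    and "Y = snd (elTgt f)" and "z = fst (elTgt g)" and "Z = snd (elTgt g)"
  have ar: "f \<in> el_arrows D V" "f' \<in> el_arrows D V" "g \<in> el_arrows D V" "g' \<in> el_arrows D V"
    using assms by (simp_all add: f_def f'_def g_def g'_def)
  have tp: "t \<in> Cell2 D" "src2 D t = elBase f" "tgt2 D t = elBase f'"
     "p \<in> Cell2 D" "src2 D p = elBase g" "tgt2 D p = elBase g'"
    using assms by (simp_all add: t_def p_def f_def f'_def g_def g'_def)
  have st: "elSrc f = (x, X)" "elTgt f = (y, Y)" "elSrc f' = (x, X)" "elTgt f' = (y, Y)"
     "elSrc g = (y, Y)" "elTgt g = (z, Z)" "elSrc g' = (y, Y)" "elTgt g' = (z, Z)"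
    unfolding x_def X_def y_def Y_def z_def Z_def
    using assms by (simp_all add: f_def f'_def g_def g'_def)
  have ob: "X \<in> Obj D" "Y \<in> Obj D" "Z \<in> Obj D" "x \<in> Ob (on0 V X)" "y \<in> Ob (on0 V Y)" "z \<in> Ob (on0 V Z)"
    using el_arrows_rules(9-12)[OF ar(1)] el_arrows_rules(9-12)[OF ar(3)] by (simp_all add: st)
  have \<Theta>f: "elFib f' \<cdot>\<^bsub>on0 V Y\<^esub> ntAt (on2 V t) x = elFib f"
    using el_cells_fib[OF \<Theta>] by (simp add: f_def[symmetric] f'_def[symmetric] t_def[symmetric] st)
  have \<Phi>f: "elFib g' \<cdot>\<^bsub>on0 V Z\<^esub> ntAt (on2 V p) y = elFib g"
    using el_cells_fib[OF \<Phi>] by (simp add: g_def[symmetric] g'_def[symmetric] p_def[symmetric] st)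
  note [simp] = st ar ob tp
  let ?q = "ntAt (on2 V p) (onOb (on1 V (elBase f')) x)"
  have "(elFib g' \<cdot>\<^bsub>on0 V Z\<^esub> onAr (on1 V (elBase g')) (elFib f')) \<cdot>\<^bsub>on0 V Z\<^esub>
        (?q \<cdot>\<^bsub>on0 V Z\<^esub> onAr (on1 V (elBase g)) (ntAt (on2 V t) x))
      = elFib g' \<cdot>\<^bsub>on0 V Z\<^esub> ((onAr (on1 V (elBase g')) (elFib f') \<cdot>\<^bsub>on0 V Z\<^esub> ?q) \<cdot>\<^bsub>on0 V Z\<^esub>
        onAr (on1 V (elBase g)) (ntAt (on2 V t) x))"
    by simp
  also have "onAr (on1 V (elBase g')) (elFib f') \<cdot>\<^bsub>on0 V Z\<^esub> ?q
      = ntAt (on2 V p) y \<cdot>\<^bsub>on0 V Z\<^esub> onAr (on1 V (elBase g)) (elFib f')"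
    using nat_trans_naturality[of "on2 V p" "on0 V Y" "on0 V Z" "elFib f'"] by simp
  also have "elFib g' \<cdot>\<^bsub>on0 V Z\<^esub> ((ntAt (on2 V p) y \<cdot>\<^bsub>on0 V Z\<^esub> onAr (on1 V (elBase g)) (elFib f'))
         \<cdot>\<^bsub>on0 V Z\<^esub> onAr (on1 V (elBase g)) (ntAt (on2 V t) x))
      = (elFib g' \<cdot>\<^bsub>on0 V Z\<^esub> ntAt (on2 V p) y) \<cdot>\<^bsub>on0 V Z\<^esub>
         onAr (on1 V (elBase g)) (elFib f' \<cdot>\<^bsub>on0 V Y\<^esub> ntAt (on2 V t) x)"
    by simp
  also have "\<dots> = elFib g \<cdot>\<^bsub>on0 V Z\<^esub> onAr (on1 V (elBase g)) (elFib f)"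
    by (simp only: \<Theta>f \<Phi>f)
  finally have "(elFib g' \<cdot>\<^bsub>on0 V Z\<^esub> onAr (on1 V (elBase g')) (elFib f')) \<cdot>\<^bsub>on0 V Z\<^esub>
        (?q \<cdot>\<^bsub>on0 V Z\<^esub> onAr (on1 V (elBase g)) (ntAt (on2 V t) x))
      = elFib g \<cdot>\<^bsub>on0 V Z\<^esub> onAr (on1 V (elBase g)) (elFib f)" .
  then show ?thesis
    unfolding f_def[symmetric] f'_def[symmetric] g_def[symmetric] g'_def[symmetric] t_def[symmetric] p_def[symmetric]
    by (subst el_cells_def) simp
qed

lemma el_vcomp_closed:
  assumes \<Theta>: "\<Theta> \<in> el_cells D V" and \<Phi>: "\<Phi> \<in> el_cells D V" and eq: "elTgt2 \<Theta> = elSrc2 \<Phi>"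
  shows "\<lparr>elSrc2 = elSrc2 \<Theta>, elTgt2 = elTgt2 \<Phi>, elBase2 = elBase2 \<Phi> \<diamondop>\<^bsub>D\<^esub> elBase2 \<Theta>\<rparr> \<in> el_cells D V"
proof -
  have e: "elSrc (elSrc2 \<Phi>) = elSrc (elSrc2 \<Theta>)" "elTgt (elSrc2 \<Phi>) = elTgt (elSrc2 \<Theta>)"
    using el_cells_rules(3,4)[OF \<Theta>] eq by simp_all
  let ?V = "on0 V (snd (elTgt (elSrc2 \<Theta>)))" and ?x = "fst (elSrc (elSrc2 \<Theta>))"
  have "elFib (elTgt2 \<Phi>) \<cdot>\<^bsub>?V\<^esub> (ntAt (on2 V (elBase2 \<Phi>)) ?x \<cdot>\<^bsub>?V\<^esub> ntAt (on2 V (elBase2 \<Theta>)) ?x)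
      = (elFib (elTgt2 \<Phi>) \<cdot>\<^bsub>?V\<^esub> ntAt (on2 V (elBase2 \<Phi>)) ?x) \<cdot>\<^bsub>?V\<^esub> ntAt (on2 V (elBase2 \<Theta>)) ?x"
    using assms e by simp
  also have "\<dots> = elFib (elSrc2 \<Theta>)"
    using el_cells_fib[OF \<Theta>] el_cells_fib[OF \<Phi>] by (simp add: e eq)
  finally show ?thesis
    using assms e by (subst el_cells_def) simp
qed

lemma el_id2_closed:
  assumes "u \<in> el_arrows D V"
  shows "\<lparr>elSrc2 = u, elTgt2 = u, elBase2 = id2 D (elBase u)\<rparr> \<in> el_cells D V"
  using assms by (subst el_cells_def) simp

lemma two_category_El: "two_category (El D V)"
proof (rule two_category.intro)
  show "category (underlying_cat (El D V))"
    by (rule category.intro)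
      (use el_comp_id in \<open>simp_all add: el_id_closed el_comp_assoc\<close>)
  show "category (vertical_cat (El D V))"
    by (rule category.intro)
      (simp_all add: el_cell_eq_iff el_vcomp_closed el_id2_closed)
  show "category (horizontal_cat (El D V))"
    by (rule category.intro)
      (use el_comp_id el_id2_closed[OF el_id_closed] in
        \<open>simp_all add: el_cell_eq_iff el_hcomp_closed el_comp_assoc\<close>)
qed (auto simp: dom.interchange)

text \<open>The fibre of a composite is a fibre composed with the image of another under some
  \<open>on1 V\<close>, which preserves isomorphisms.\<close>

lemma wide_subcategory_cocartesian: "wide_subcategory (op2 (El D V)) (cocartesian D V)"
proof -
  interpret E: two_category "El D V" by (rule two_category_El)
  show ?thesis
  proof (rule wide_subcategory.intro[OF E.two_category_op2], unfold_locales)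
    show "cocartesian D V \<subseteq> Cell1 (op2 (El D V))" by (auto simp: cocartesian_def)
    show "id1 (op2 (El D V)) p \<in> cocartesian D V" if "p \<in> Obj (op2 (El D V))" for p
      using that by (auto simp: cocartesian_def el_id_closed el_objects_iff intro: category.iso_arr_idn)
    fix f g assume a: "f \<in> cocartesian D V" "g \<in> cocartesian D V" "tgt (op2 (El D V)) f = src (op2 (El D V)) g"
    then have f: "f \<in> el_arrows D V" "g \<in> el_arrows D V" "elTgt g = elSrc f"
      "iso_arr (on0 V (snd (elTgt f))) (elFib f)" "iso_arr (on0 V (snd (elTgt g))) (elFib g)"
      by (simp_all add: cocartesian_def)
    then have "iso_arr (on0 V (snd (elTgt f))) (onAr (on1 V (elBase f)) (elFib g))"
      by (intro iso_arr_onAr) simp_all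
    then have "iso_arr (on0 V (snd (elTgt f))) (elFib f \<cdot>\<^bsub>on0 V (snd (elTgt f))\<^esub> onAr (on1 V (elBase f)) (elFib g))"
      using f by (intro category.iso_arr_cmp) simp_all
    then show "g \<odot>\<^bsub>op2 (El D V)\<^esub> f \<in> cocartesian D V"
      using f by (simp add: cocartesian_def)
  qed
qed

text \<open>Composing the fibre equation of \<open>\<Theta>\<close> with the inverse base cell gives
  the fibre equation in the opposite direction, so the inverse lifts.\<close>

lemma invertible2_El:
  assumes \<Theta>: "\<Theta> \<in> el_cells D V" and inv: "invertible2 D (elBase2 \<Theta>)"
  shows "invertible2 (El D V) \<Theta>"
proof -
  obtain t where t: "t \<in> Cell2 D" "src2 D t = elBase (elTgt2 \<Theta>)" "tgt2 D t = elBase (elSrc2 \<Theta>)"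
    "t \<diamondop>\<^bsub>D\<^esub> elBase2 \<Theta> = id2 D (elBase (elSrc2 \<Theta>))" "elBase2 \<Theta> \<diamondop>\<^bsub>D\<^esub> t = id2 D (elBase (elTgt2 \<Theta>))"
    using inv by (rule invertible2E) (use \<Theta> in simp)
  let ?\<Theta>' = "\<lparr>elSrc2 = elTgt2 \<Theta>, elTgt2 = elSrc2 \<Theta>, elBase2 = t\<rparr>"
  let ?V = "on0 V (snd (elTgt (elSrc2 \<Theta>)))" and ?x = "fst (elSrc (elSrc2 \<Theta>))"
  have x: "?x \<in> Ob (on0 V (snd (elSrc (elSrc2 \<Theta>))))" using \<Theta> by simp
  have "elFib (elSrc2 \<Theta>) \<cdot>\<^bsub>?V\<^esub> ntAt (on2 V t) ?x
      = (elFib (elTgt2 \<Theta>) \<cdot>\<^bsub>?V\<^esub> ntAt (on2 V (elBase2 \<Theta>)) ?x) \<cdot>\<^bsub>?V\<^esub> ntAt (on2 V t) ?x"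
    by (simp only: el_cells_fib[OF \<Theta>])
  also have "\<dots> = elFib (elTgt2 \<Theta>) \<cdot>\<^bsub>?V\<^esub> (ntAt (on2 V (elBase2 \<Theta>)) ?x \<cdot>\<^bsub>?V\<^esub> ntAt (on2 V t) ?x)"
    using \<Theta> t(1-3) x by simp
  also have "ntAt (on2 V (elBase2 \<Theta>)) ?x \<cdot>\<^bsub>?V\<^esub> ntAt (on2 V t) ?x = ntAt (on2 V (elBase2 \<Theta> \<diamondop>\<^bsub>D\<^esub> t)) ?x"
    using \<Theta> t(1-3) x by simp
  also have "elFib (elTgt2 \<Theta>) \<cdot>\<^bsub>?V\<^esub> ntAt (on2 V (elBase2 \<Theta> \<diamondop>\<^bsub>D\<^esub> t)) ?x = elFib (elTgt2 \<Theta>)"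
    using \<Theta> x by (simp add: t)
  finally have "?\<Theta>' \<in> el_cells D V" using \<Theta> t by (subst el_cells_def) simp
  then show ?thesis
    unfolding invertible2_def by (intro iso_arrI[where g = ?\<Theta>']) (use \<Theta> t in simp_all)
qed

text \<open>The last premise has the form in which \<open>insertion_exists\<close> delivers its
  arrows.\<close>

lemma cocartesianI:
  assumes "p \<in> el_objects D V" "L \<in> Obj D" "z \<in> Ob (on0 V L)"
    and "h \<in> Cell1 D \<and> src D h = L \<and> tgt D h = snd p \<and> iso_arr (on0 V (snd p)) \<eta> \<and>
      dm (on0 V (snd p)) \<eta> = onOb (on1 V h) z \<and> cd (on0 V (snd p)) \<eta> = fst p"
  shows "\<lparr>elSrc = (z, L), elTgt = p, elBase = h, elFib = \<eta>\<rparr> \<in> cocartesian D V"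
  unfolding cocartesian_def El_simps using assms
  by (simp, subst el_arrows_def) (simp add: el_objects_iff iso_arr_closed)

text \<open>The fibre of \<open>v\<close> is an isomorphism and can serve as the structure cell at
  arrow 3. With the identity at arrow 2, the condition on the 2-cells of the diagram is the defining
  equation of 2-cells from \<open>u\<close> to \<open>v\<close>. Setting \<open>invertible\<close>
  to \<open>u \<in> cocartesian D V\<close> selects the iso-inserter precisely when (\<sigma>F1)
  asks for an invertible cell.\<close>

lemma insertion_parallel:
  assumes u: "u \<in> el_arrows D V" and v: "v \<in> cocartesian D V"
    and eq: "elSrc u = elSrc v" "elTgt u = elTgt v"
    and cells: "\<And>m. m < n \<Longrightarrow> \<Theta> m \<in> el_cells D V \<and> elSrc2 (\<Theta> m) = u \<and> elTgt2 (\<Theta> m) = v"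
  shows "insertion D V (4 + n) (snd (elSrc v)) (snd (elTgt v)) (fst (elSrc v)) (elFib u)
    (\<lambda>m. if m = 2 then elBase u else elBase v) (\<lambda>m. elBase2 (\<Theta> (m - 4)))
    (\<lambda>m. if m = 2 then idn (on0 V (snd (elTgt v))) (onOb (on1 V (elBase u)) (fst (elSrc v))) else elFib v)
    (u \<in> cocartesian D V)"
proof -
  have v': "v \<in> el_arrows D V" "iso_arr (on0 V (snd (elTgt v))) (elFib v)"
    using v by (simp_all add: cocartesian_def)
  have "elFib v \<cdot>\<^bsub>on0 V (snd (elTgt v))\<^esub> ntAt (on2 V (elBase2 (\<Theta> m))) (fst (elSrc v)) = elFib u"
    if "m < n" for m
    using el_cells_fib[of "\<Theta> m" D V] cells[OF that] by (simp add: eq)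
  moreover have "elBase2 (\<Theta> m) \<in> Cell2 D \<and> src2 D (elBase2 (\<Theta> m)) = elBase u \<and> tgt2 D (elBase2 (\<Theta> m)) = elBase v"
    if "m < n" for m
    using cells[OF that] by auto
  moreover have "u \<in> cocartesian D V \<Longrightarrow> iso_arr (on0 V (snd (elTgt v))) (elFib u)"
    by (simp add: cocartesian_def eq)
  moreover have "iso_arr (on0 V (snd (elTgt v)))
      (idn (on0 V (snd (elTgt v))) (onOb (on1 V (elBase u)) (fst (elSrc v))))"
    using u v' eq el_arrows_rules(3-5,9,10)[OF u] by (intro category.iso_arr_idn) simp_all
  ultimately show ?thesis
    using u v' eq el_arrows_rules(3-5,9,10)[OF u]
    by unfold_locales auto
qed

end

section \<open>The clauses of cofilteredness\<close>

theorem proposition3p2p8: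
  fixes A :: "('o, 'm, 'n) cat2" and P :: "('o, 'm, 'n, 'c, 'a) cat_valued"
  assumes "two_category A" and "has_finite_bilimits A"
    and "two_functor A Cat P" and "left_exact A Cat P"
  shows "sigma_cofiltered (El A P) (cocartesian A P)"
proof -
  interpret P: cat_valued_functor A P by (rule cat_valued_functorI[OF assms(3)])
  interpret E: wide_subcategory "op2 (El A P)" "cocartesian A P"
    by (rule P.wide_subcategory_cocartesian)
  show ?thesis
    unfolding sigma_cofiltered_def
  proof unfold_locales
    \<comment> \<open>The empty diagram: every assumption is guarded by a bound on \<open>n\<close>
      and so holds vacuously for arbitrary parameters.\<close>
    interpret I: insertion A P 0 undefined undefined undefined undefined undefined undefined undefined False
      by unfold_locales simp_all
    obtain L z where "L \<in> Obj A" "z \<in> Ob (on0 P L)"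
      by (rule I.insertion_exists[OF assms(2,4)])
    then have "(z, L) \<in> el_objects A P" by (simp add: el_objects_iff)
    then show "Obj (op2 (El A P)) \<noteq> {}" by auto
  next
    fix p q assume pq: "p \<in> Obj (op2 (El A P))" "q \<in> Obj (op2 (El A P))"
    \<comment> \<open>The object 1 carries the weight \<open>walking False\<close>, so this bilimit
      is the product of \<open>snd p\<close> with the arrow object of \<open>snd q\<close>. Choosing
      an identity for \<open>\<phi>\<close> makes the second arrow end at
      \<open>fst q\<close>.\<close>
    interpret I: insertion A P 2 "snd p" "snd q" "fst p" "idn (on0 P (snd q)) (fst q)"
        undefined undefined undefined False
      by unfold_locales (use pq in \<open>simp_all add: el_objects_iff\<close>)
    have q: "cd (on0 P (snd q)) (idn (on0 P (snd q)) (fst q)) = fst q"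
      using pq by (simp add: el_objects_iff)
    obtain L z h h' \<eta> \<eta>' where L: "L \<in> Obj A" "z \<in> Ob (on0 P L)"
      and h: "h \<in> Cell1 A \<and> src A h = L \<and> tgt A h = snd p \<and>
        iso_arr (on0 P (snd p)) \<eta> \<and> dm (on0 P (snd p)) \<eta> = onOb (on1 P h) z \<and> cd (on0 P (snd p)) \<eta> = fst p"
      and h': "h' \<in> Cell1 A \<and> src A h' = L \<and> tgt A h' = snd q \<and>
        iso_arr (on0 P (snd q)) \<eta>' \<and> dm (on0 P (snd q)) \<eta>' = onOb (on1 P h') z \<and> cd (on0 P (snd q)) \<eta>' = fst q"
      by (rule I.insertion_exists[OF assms(2,4), unfolded q]) simp
    let ?h = "\<lparr>elSrc = (z, L), elTgt = p, elBase = h, elFib = \<eta>\<rparr>"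
    let ?h' = "\<lparr>elSrc = (z, L), elTgt = q, elBase = h', elFib = \<eta>'\<rparr>"
    have "?h \<in> cocartesian A P" "?h' \<in> cocartesian A P"
      using P.cocartesianI[OF _ L h] P.cocartesianI[OF _ L h'] pq by simp_all
    then show "\<exists>f\<in>cocartesian A P. \<exists>g\<in>cocartesian A P. src (op2 (El A P)) f = p \<and>
        src (op2 (El A P)) g = q \<and> tgt (op2 (El A P)) f = tgt (op2 (El A P)) g"
      by (intro bexI[of _ ?h] bexI[of _ ?h']) simp_all
  next
    fix u v assume u: "u \<in> Cell1 (op2 (El A P))" and v: "v \<in> cocartesian A P"
      and eq: "src (op2 (El A P)) u = src (op2 (El A P)) v" "tgt (op2 (El A P)) u = tgt (op2 (El A P)) v"
    then have uv: "u \<in> el_arrows A P" "v \<in> el_arrows A P" "elSrc u = elSrc v" "elTgt u = elTgt v"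
      by (simp_all add: cocartesian_def)
    \<comment> \<open>There are no 2-cells from 4 on, so an undefined family of them will
      do.\<close>
    interpret I: insertion A P "4 + 0" "snd (elSrc v)" "snd (elTgt v)" "fst (elSrc v)" "elFib u"
      "\<lambda>m. if m = 2 then elBase u else elBase v" "\<lambda>m. elBase2 ((undefined :: nat \<Rightarrow> ('o, 'm, 'n, 'c, 'a) el_cell) (m - 4))"
      "\<lambda>m. if m = 2 then idn (on0 P (snd (elTgt v))) (onOb (on1 P (elBase u)) (fst (elSrc v))) else elFib v"
      "u \<in> cocartesian A P"
      by (rule P.insertion_parallel[OF uv(1) v uv(3,4)]) simp
    obtain L z h \<eta> \<kappa> where L: "L \<in> Obj A" "z \<in> Ob (on0 P L)"
      and h: "h \<in> Cell1 A \<and> src A h = L \<and> tgt A h = snd (elSrc v) \<and>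
        iso_arr (on0 P (snd (elSrc v))) \<eta> \<and> dm (on0 P (snd (elSrc v))) \<eta> = onOb (on1 P h) z \<and>
        cd (on0 P (snd (elSrc v))) \<eta> = fst (elSrc v)"
      and \<kappa>: "\<kappa> \<in> Cell2 A" "src2 A \<kappa> = elBase u \<odot>\<^bsub>A\<^esub> h" "tgt2 A \<kappa> = elBase v \<odot>\<^bsub>A\<^esub> h"
        "u \<in> cocartesian A P \<longrightarrow> invertible2 A \<kappa>"
      and eq\<kappa>: "(elFib v \<cdot>\<^bsub>on0 P (snd (elTgt v))\<^esub> onAr (on1 P (elBase v)) \<eta>)
            \<cdot>\<^bsub>on0 P (snd (elTgt v))\<^esub> ntAt (on2 P \<kappa>) z
        = elFib u \<cdot>\<^bsub>on0 P (snd (elTgt v))\<^esub>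
           (idn (on0 P (snd (elTgt v))) (onOb (on1 P (elBase u)) (fst (elSrc v)))
            \<cdot>\<^bsub>on0 P (snd (elTgt v))\<^esub> onAr (on1 P (elBase u)) \<eta>)"
      proof (rule I.insertion_exists[OF assms(2,4)], goal_cases)
        case prems: (1 L z h h' \<eta> \<eta>' \<kappa>)
        show ?case by (rule that[of L z h \<eta> \<kappa>]) (use prems in simp_all)
      qed
    let ?h = "\<lparr>elSrc = (z, L), elTgt = elSrc v, elBase = h, elFib = \<eta>\<rparr>"
    have h': "?h \<in> cocartesian A P"
      using P.cocartesianI[OF _ L h] uv by simp
    then have h'': "?h \<in> el_arrows A P" by (simp add: cocartesian_def)
    let ?\<Theta> = "\<lparr>elSrc2 = el_comp A P u ?h, elTgt2 = el_comp A P v ?h, elBase2 = \<kappa>\<rparr>"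
    \<comment> \<open>This typing lets the identity in the place of \<open>\<delta> 2\<close> be
      absorbed in \<open>eq\<kappa>\<close>, which thereby becomes the equation of a 2-cell of
      elements.\<close>
    have "onAr (on1 P (elBase u)) \<eta> \<in> Ar (on0 P (snd (elTgt v)))"
      "cd (on0 P (snd (elTgt v))) (onAr (on1 P (elBase u)) \<eta>) = onOb (on1 P (elBase u)) (fst (elSrc v))"
      using h uv el_arrows_rules(3-5)[OF uv(1)] by (simp_all add: iso_arr_closed)
    then have "?\<Theta> \<in> el_cells A P"
      using uv h'' \<kappa> eq\<kappa> by (subst el_cells_def) simp
    moreover from this have "u \<in> cocartesian A P \<longrightarrow> invertible2 (El A P) ?\<Theta>"
      using \<kappa>(4) P.invertible2_El[of ?\<Theta>] by simp
    ultimately show "\<exists>h\<in>cocartesian A P. \<exists>\<alpha>\<in>Cell2 (op2 (El A P)). src (op2 (El A P)) h = tgt (op2 (El A P)) u \<and>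
        src2 (op2 (El A P)) \<alpha> = h \<odot>\<^bsub>op2 (El A P)\<^esub> u \<and> tgt2 (op2 (El A P)) \<alpha> = h \<odot>\<^bsub>op2 (El A P)\<^esub> v \<and>
        (u \<in> cocartesian A P \<longrightarrow> invertible2 (op2 (El A P)) \<alpha>)"
      using uv by (intro bexI[OF _ h'] bexI[of _ ?\<Theta>]) simp_all
  next
    fix \<alpha> \<beta> assume ab: "\<alpha> \<in> Cell2 (op2 (El A P))" "\<beta> \<in> Cell2 (op2 (El A P))"
      "src2 (op2 (El A P)) \<alpha> = src2 (op2 (El A P)) \<beta>" "tgt2 (op2 (El A P)) \<alpha> = tgt2 (op2 (El A P)) \<beta>"
      and co: "tgt2 (op2 (El A P)) \<alpha> \<in> cocartesian A P"
    define u v where "u = elSrc2 \<alpha>" and "v = elTgt2 \<alpha>"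
    have ab': "\<alpha> \<in> el_cells A P" "\<beta> \<in> el_cells A P" "elSrc2 \<alpha> = u" "elTgt2 \<alpha> = v" "elSrc2 \<beta> = u" "elTgt2 \<beta> = v"
      using ab by (simp_all add: u_def v_def)
    have v: "v \<in> cocartesian A P" using co by (simp add: v_def)
    have uv: "u \<in> el_arrows A P" "v \<in> el_arrows A P" "elSrc u = elSrc v" "elTgt u = elTgt v"
      unfolding u_def v_def using ab by simp_all
    \<comment> \<open>The given 2-cells become the cells 4 and 5 of the shape, hence the shift by
      4.\<close>
    let ?\<Theta> = "\<lambda>m::nat. if m = 0 then \<alpha> else \<beta>"
    interpret I: insertion A P "4 + 2" "snd (elSrc v)" "snd (elTgt v)" "fst (elSrc v)" "elFib u"
      "\<lambda>m. if m = 2 then elBase u else elBase v" "\<lambda>m. elBase2 (?\<Theta> (m - 4))"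
      "\<lambda>m. if m = 2 then idn (on0 P (snd (elTgt v))) (onOb (on1 P (elBase u)) (fst (elSrc v))) else elFib v"
      "u \<in> cocartesian A P"
      by (rule P.insertion_parallel[OF uv(1) v uv(3,4)]) (use ab' in simp)
    obtain L z h \<eta> \<kappa> where L: "L \<in> Obj A" "z \<in> Ob (on0 P L)"
      and h: "h \<in> Cell1 A \<and> src A h = L \<and> tgt A h = snd (elSrc v) \<and>
        iso_arr (on0 P (snd (elSrc v))) \<eta> \<and> dm (on0 P (snd (elSrc v))) \<eta> = onOb (on1 P h) z \<and>
        cd (on0 P (snd (elSrc v))) \<eta> = fst (elSrc v)"
      and \<kappa>: "\<And>m. \<lbrakk>4 \<le> m; m < 4 + 2\<rbrakk> \<Longrightarrow> elBase2 (?\<Theta> (m - 4)) \<star>\<^bsub>A\<^esub> id2 A h = \<kappa>"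
      proof (rule I.insertion_exists[OF assms(2,4)], goal_cases)
        case prems: (1 L z h h' \<eta> \<eta>' \<kappa>)
        show ?case by (rule that[of L z h \<eta> \<kappa>]) (use prems in simp_all)
      qed
    let ?h = "\<lparr>elSrc = (z, L), elTgt = elSrc v, elBase = h, elFib = \<eta>\<rparr>"
    have h': "?h \<in> cocartesian A P"
      using P.cocartesianI[OF _ L h] uv by simp
    \<comment> \<open>Both sides are the inserted cell \<open>\<kappa>\<close>.\<close>
    have "elBase2 \<alpha> \<star>\<^bsub>A\<^esub> id2 A h = elBase2 \<beta> \<star>\<^bsub>A\<^esub> id2 A h"
      using \<kappa>[of 4] \<kappa>[of 5] by simp
    then show "\<exists>h\<in>cocartesian A P. src (op2 (El A P)) h = tgt (op2 (El A P)) (tgt2 (op2 (El A P)) \<alpha>) \<and>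
        id2 (op2 (El A P)) h \<star>\<^bsub>op2 (El A P)\<^esub> \<alpha> = id2 (op2 (El A P)) h \<star>\<^bsub>op2 (El A P)\<^esub> \<beta>"
      using ab' by (intro bexI[OF _ h']) simp
  qed
qed

end
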